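(* The following problem is coNP-hard: given a CNF formula $F$ and an integer $k$ written in binary, decide whether there exists a regular resolution proof (refutation) of $F$ of size at most $k$.
   Context: A CNF formula is a finite set of clauses. The resolution rule derives from clauses $\gamma \vee x$ and $\delta \vee \neg x$ the resolvent $\gamma \vee \delta$ (resolving on $x$). A resolution proof of $F$ is a directed acyclic graph whose nodes are clauses, whose leaves are clauses of $F$, in which each internal node is the resolvent of its two parents, and whose root is the empty clause. It is regular if no path from the root to a leaf contains two resolution steps on the same variable. The size of a proof is its number of clauses (nodes). *)

theory Defs
  imports Main
begin

section \<open>CNF formulas and regular resolution\<close>

text \<open>A literal is a pair (variable, polarity); (x, True) is x and (x, False) is the negation of x.
  A clause is a set of literals (a disjunction), a CNF formula a set of clauses.\<close>

type_synonym lit = "nat \<times> bool"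
type_synonym clause = "lit set"
type_synonym cnf = "clause set"

text \<open>A resolution DAG: nodes are 0..<m; node i is labelled by the clause lab i;
  par i = None means that i is a leaf, par i = Some (j, k, x) means that i is the resolvent
  of its two parents j (containing x) and k (containing the negation of x), resolving on x.
  Parents have smaller indices (a topological order), so the graph is acyclic; the root is
  node m - 1.\<close>

type_synonym res_dag = "nat \<times> (nat \<Rightarrow> clause) \<times> (nat \<Rightarrow> (nat \<times> nat \<times> nat) option)"

definition dag_edges :: "res_dag \<Rightarrow> (nat \<times> nat) set" where
  "dag_edges P = (case P of (m, lab, par) \<Rightarrow>
     {(i, j). i < m \<and> (\<exists>j' k x. par i = Some (j', k, x) \<and> (j = j' \<or> j = k))})"

definition pivot :: "res_dag \<Rightarrow> nat \<Rightarrow> nat" where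
  "pivot P i = (case P of (m, lab, par) \<Rightarrow> (case par i of Some (j, k, x) \<Rightarrow> x | None \<Rightarrow> 0))"

definition is_internal :: "res_dag \<Rightarrow> nat \<Rightarrow> bool" where
  "is_internal P i = (case P of (m, lab, par) \<Rightarrow> i < m \<and> par i \<noteq> None)"

definition dag_size :: "res_dag \<Rightarrow> nat" where
  "dag_size P = fst P"

definition resolution_proof :: "cnf \<Rightarrow> res_dag \<Rightarrow> bool" where
  "resolution_proof F P = (case P of (m, lab, par) \<Rightarrow>
     0 < m
     \<and> (\<forall>i<m. case par i of
           None \<Rightarrow> lab i \<in> F
         | Some (j, k, x) \<Rightarrow> j < i \<and> k < i \<and> j \<noteq> k
              \<and> (x, True) \<in> lab j \<and> (x, False) \<in> lab k
              \<and> lab i = (lab j - {(x, True)}) \<union> (lab k - {(x, False)}))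
     \<and> lab (m - 1) = {}
     \<and> (\<forall>i<m. (m - 1, i) \<in> (dag_edges P)\<^sup>*))"

text \<open>Regularity: no path from the root contains two resolution steps on the same variable.
  (Every path from the root extends to a root-to-leaf path.)\<close>

definition regular :: "res_dag \<Rightarrow> bool" where
  "regular P = (\<forall>i j. (fst P - 1, i) \<in> (dag_edges P)\<^sup>* \<longrightarrow> (i, j) \<in> (dag_edges P)\<^sup>+
      \<longrightarrow> is_internal P i \<longrightarrow> is_internal P j \<longrightarrow> pivot P i \<noteq> pivot P j)"

definition regular_resolution_proof :: "cnf \<Rightarrow> res_dag \<Rightarrow> bool" where
  "regular_resolution_proof F P = (resolution_proof F P \<and> regular P)"

section \<open>Binary encodings of instances\<close>

fun bits_of :: "nat \<Rightarrow> bool list" where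
  "bits_of n = (if n = 0 then [] else (n mod 2 = 1) # bits_of (n div 2))"

text \<open>Self-delimiting binary encoding of a natural number: each bit b becomes [True, b],
  followed by the terminator [False].\<close>

definition enc_nat :: "nat \<Rightarrow> bool list" where
  "enc_nat n = concat (map (\<lambda>b. [True, b]) (bits_of n)) @ [False]"

definition enc_int :: "int \<Rightarrow> bool list" where
  "enc_int k = (k < 0) # enc_nat (nat \<bar>k\<bar>)"

definition enc_list :: "('a \<Rightarrow> bool list) \<Rightarrow> 'a list \<Rightarrow> bool list" where
  "enc_list e xs = concat (map (\<lambda>x. True # e x) xs) @ [False]"

definition enc_lit :: "lit \<Rightarrow> bool list" where
  "enc_lit l = snd l # enc_nat (fst l)"

definition enc_instance :: "lit list list \<Rightarrow> int \<Rightarrow> bool list" where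
  "enc_instance cs k = enc_list (enc_list enc_lit) cs @ enc_int k"

text \<open>The decision problem: a word is a yes-instance iff it encodes a CNF formula F
  (given as a list of clauses, each a list of literals) and an integer k (in binary)
  such that F has a regular resolution refutation of size at most k.\<close>

definition REG_RES_SIZE :: "bool list set" where
  "REG_RES_SIZE = {w. \<exists>cs k. w = enc_instance cs k \<and>
      (\<exists>P. regular_resolution_proof (set (map set cs)) P \<and> int (dag_size P) \<le> k)}"

section \<open>Turing machines, polynomial time, NP, coNP, hardness\<close>

text \<open>A deterministic single-tape Turing machine (Q, S, delta): states 0..<Q (0 initial,
  1 halting), tape symbols 0..<S (0 blank, 1 bit False, 2 bit True); delta q a = (q', a', d)
  with move d in {-1, 0, 1}.\<close>

type_synonym tm = "nat \<times> nat \<times> (nat \<Rightarrow> nat \<Rightarrow> nat \<times> nat \<times> int)"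
type_synonym config = "nat \<times> (int \<Rightarrow> nat) \<times> int"

definition wf_tm :: "tm \<Rightarrow> bool" where
  "wf_tm M = (case M of (Q, S, \<delta>) \<Rightarrow> 2 \<le> Q \<and> 3 \<le> S \<and>
     (\<forall>q<Q. \<forall>a<S. q \<noteq> 1 \<longrightarrow> (case \<delta> q a of (q', a', d) \<Rightarrow> q' < Q \<and> a' < S \<and> d \<in> {-1, 0, 1})))"

definition tm_step :: "tm \<Rightarrow> config \<Rightarrow> config" where
  "tm_step M c = (case M of (Q, S, \<delta>) \<Rightarrow> case c of (q, t, p) \<Rightarrow>
     if q = 1 then c else (case \<delta> q (t p) of (q', a', d) \<Rightarrow> (q', t(p := a'), p + d)))"

definition tm_init :: "bool list \<Rightarrow> config" where
  "tm_init x = (0, \<lambda>i. if 0 \<le> i \<and> i < int (length x) then (if x ! nat i then 2 else 1) else 0, 0)"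

text \<open>Output: the maximal block of bit symbols starting at the head position.\<close>

definition tm_output :: "config \<Rightarrow> bool list" where
  "tm_output c = (case c of (q, t, p) \<Rightarrow>
     map (\<lambda>i. t (p + int i) = 2) [0..<(LEAST n. t (p + int n) \<notin> {1, 2})])"

definition poly_time_computable :: "(bool list \<Rightarrow> bool list) \<Rightarrow> bool" where
  "poly_time_computable f = (\<exists>M c d. wf_tm M \<and> (\<forall>x. \<exists>n.
     n \<le> c * (length x + 1) ^ d \<and> fst ((tm_step M ^^ n) (tm_init x)) = 1
     \<and> tm_output ((tm_step M ^^ n) (tm_init x)) = f x))"

definition in_P :: "bool list set \<Rightarrow> bool" where
  "in_P L = poly_time_computable (\<lambda>x. [x \<in> L])"

definition enc_pair :: "bool list \<Rightarrow> bool list \<Rightarrow> bool list" where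
  "enc_pair x y = concat (map (\<lambda>b. [True, b]) x) @ [False] @ y"

definition in_NP :: "bool list set \<Rightarrow> bool" where
  "in_NP L = (\<exists>V c d. in_P V \<and> (\<forall>x. x \<in> L \<longleftrightarrow>
     (\<exists>y. length y \<le> c * (length x + 1) ^ d \<and> enc_pair x y \<in> V)))"

definition in_coNP :: "bool list set \<Rightarrow> bool" where
  "in_coNP L = in_NP (- L)"

text \<open>Hardness under polynomial-time many-one (Karp) reductions.\<close>

definition coNP_hard :: "bool list set \<Rightarrow> bool" where
  "coNP_hard L = (\<forall>L'. in_coNP L' \<longrightarrow>
     (\<exists>f. poly_time_computable f \<and> (\<forall>x. x \<in> L' \<longleftrightarrow> f x \<in> L)))"

end

theory Submission
  imports Defs
begin

text \<open>The obstacle is the machine model: the reduction has to run on a concrete single-tape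
  machine. Its running time is therefore bounded once for all transducer programs from a condition
  on the images of single letters (\<open>good\<close>), and each instruction is only inspected
  letter by letter. Arithmetic is done by counting passes. The input serves as its own counter: n
  letters \<open>K\<close> cause n + 1 passes and multiply unary amounts by n + 1, so every length
  has the form C * (n + 1)^deg. The row length needs no computation either, since one mark per cell
  of the first row makes the far fields grow accordingly.

  A block may depend only on the kind of its cell, so row ends cannot be treated specially. Blank
  margins longer than the running time make them harmless: where a window runs over a row end, the
  cell it meets is as blank as the true neighbour on the tape. Certificates of every length up to
  the bound are covered by guessed cells that may be blank, provided that everything to their right
  within the row is blank too.\<close>

text \<open>An unsatisfiable formula with v variables has a regular refutation with fewer than 2^(v+1) clauses, read off a
  decision tree, and a satisfiable one has none at all. So with a bound k = 2^L - 1 for L > v, which has only L binary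
  digits, the problem is the unsatisfiability of the formula, and it suffices to compute a Cook-Levin formula
  in polynomial time.

  The tableau of the verifier is laid out along one line, with a fixed distance R between the windows and the cells
  they determine. The formula is then a sequence of blocks that differ only in unary indices, and it can be
  written by rewriting a word in repeated left-to-right passes. Since all step clauses are Horn, a satisfying assignment
  contains the true run for the certificate read off its first row, and no clauses for uniqueness of symbols are needed.\<close>

section \<open>Transducer programs on a single-tape machine\<close>

text \<open>An instruction is a transducer with two states. It is applied to the whole word over and over,
  starting each pass in state False, until a pass ends in state False; then the next instruction starts.\<close>

type_synonym 'a instr = "bool \<Rightarrow> 'a \<Rightarrow> bool \<times> 'a list"

fun transduce :: "'a instr \<Rightarrow> bool \<Rightarrow> 'a list \<Rightarrow> bool \<times> 'a list" where
  "transduce \<tau> ph [] = (ph, [])"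
| "transduce \<tau> ph (a # w) = (case \<tau> ph a of (ph', u) \<Rightarrow> case transduce \<tau> ph' w of (ph'', v) \<Rightarrow> (ph'', u @ v))"

inductive loop :: "'a instr \<Rightarrow> 'a list \<Rightarrow> 'a list \<Rightarrow> bool" for \<tau> where
  stop: "transduce \<tau> False w = (False, w') \<Longrightarrow> loop \<tau> w w'"
| again: "transduce \<tau> False w = (True, w1) \<Longrightarrow> loop \<tau> w1 w' \<Longrightarrow> loop \<tau> w w'"

fun run_program :: "'a instr list \<Rightarrow> 'a list \<Rightarrow> 'a list \<Rightarrow> bool" where
  "run_program [] w w' \<longleftrightarrow> w = w'"
| "run_program (\<tau> # P) w w' \<longleftrightarrow> (\<exists>w1. loop \<tau> w w1 \<and> run_program P w1 w')"

lemma run_program_append: "run_program P w w1 \<Longrightarrow> run_program P' w1 w2 \<Longrightarrow> run_program (P @ P') w w2"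
  by (induction P arbitrary: w) auto

text \<open>The machine uses the tape as a queue: the first letter is erased and its image is appended on the
  right. The mark Some None ends the word; None is the blank.\<close>

datatype 'a st = Pop nat bool | Run nat bool "'a option list" | Back nat bool

text \<open>Erasing leaves a blank to the left of the queue, which is where the way back stops. The
  mark is dequeued and enqueued again like a letter, and the phase then chooses between the same
  instruction and the next. \<open>Pop\<close> on a blank idles; this does not happen in a run, as
  the mark keeps the queue nonempty.\<close>

fun adelta :: "'a instr list \<Rightarrow> 'a st \<Rightarrow> 'a option option \<Rightarrow> 'a st \<times> 'a option option \<times> int" where
  "adelta P (Pop i ph) s = (case s of
     None \<Rightarrow> (Pop i ph, None, 0)
   | Some None \<Rightarrow> (Run (if ph then i else Suc i) False [None], None, 1)
   | Some (Some a) \<Rightarrow> (case (P ! i) ph a of (ph', u) \<Rightarrow> (Run i ph' (map Some u), None, 1)))"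
| "adelta P (Run i ph u) None = (case u of [] \<Rightarrow> (Back i ph, None, -1) | b # v \<Rightarrow> (Run i ph v, Some b, 1))"
| "adelta P (Run i ph u) (Some b) = (Run i ph u, Some b, 1)"
| "adelta P (Back i ph) None = (Pop i ph, None, 1)"
| "adelta P (Back i ph) (Some b) = (Back i ph, Some b, -1)"

type_synonym 'a conf = "'a st \<times> (int \<Rightarrow> 'a option option) \<times> int"

fun astep :: "'a instr list \<Rightarrow> 'a conf \<Rightarrow> 'a conf" where
  "astep P (st, t, p) = (if st = Pop (length P) False then (st, t, p)
     else (case adelta P st (t p) of (st', b, d) \<Rightarrow> (st', t(p := b), p + d)))"

definition reaches :: "'a instr list \<Rightarrow> 'a conf \<Rightarrow> nat \<Rightarrow> 'a conf \<Rightarrow> bool" where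
  "reaches P c N c' = (\<exists>n\<le>N. (astep P ^^ n) c = c')"

lemma reaches_refl: "reaches P c N c"
  unfolding reaches_def by (intro exI[of _ 0]) auto

lemma reaches_mono: "reaches P c N c' \<Longrightarrow> N \<le> N' \<Longrightarrow> reaches P c N' c'"
  unfolding reaches_def using order_trans by blast

lemma reaches_trans:
  assumes "reaches P c N c'" "reaches P c' M c''"
  shows "reaches P c (N + M) c''"
proof -
  obtain n m where "n \<le> N" "(astep P ^^ n) c = c'" "m \<le> M" "(astep P ^^ m) c' = c''"
    using assms unfolding reaches_def by blast
  then have "(astep P ^^ (m + n)) c = c''" "m + n \<le> N + M" by (simp_all add: funpow_add)
  then show ?thesis unfolding reaches_def by blast
qed

lemma reaches_step: "astep P c = c' \<Longrightarrow> reaches P c 1 c'"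
  unfolding reaches_def by (intro exI[of _ 1]) auto

definition tape_word :: "int \<Rightarrow> 'b list \<Rightarrow> int \<Rightarrow> 'b option" where
  "tape_word p w = (\<lambda>i. if p \<le> i \<and> i < p + int (length w) then Some (w ! nat (i - p)) else None)"

lemma tape_word_in: "k < length w \<Longrightarrow> tape_word p w (p + int k) = Some (w ! k)"
  by (auto simp: tape_word_def)

lemma tape_word_end [simp]: "tape_word p w (p + int (length w)) = None"
  by (auto simp: tape_word_def)

lemma tape_word_before [simp]: "tape_word p w (p - 1) = None"
  by (auto simp: tape_word_def)

lemma tape_word_hd: "tape_word p (a # w) p = Some a"
  by (auto simp: tape_word_def)

lemma tape_word_pop: "(tape_word p (a # w))(p := None) = tape_word (p + 1) w"
proof
  fix i
  show "((tape_word p (a # w))(p := None)) i = tape_word (p + 1) w i"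
  proof (cases "p + 1 \<le> i \<and> i < p + 1 + int (length w)")
    case True
    then have "nat (i - p) = Suc (nat (i - (p + 1)))" by linarith
    then show ?thesis using True by (auto simp: tape_word_def)
  next
    case False
    then show ?thesis by (cases "i = p") (auto simp: tape_word_def)
  qed
qed

lemma tape_word_push: "(tape_word p w)(p + int (length w) := Some b) = tape_word p (w @ [b])"
  by (rule ext) (auto simp: tape_word_def nth_append)

lemma run_right:
  "k \<le> length w \<Longrightarrow> reaches P (Run i ph u, tape_word p w, p + int k) (length w - k) (Run i ph u, tape_word p w, p + int (length w))"
proof (induction "length w - k" arbitrary: k)
  case 0
  then show ?case by (simp add: reaches_refl)
next
  case (Suc m)
  then have k: "k < length w" by simp
  have s: "astep P (Run i ph u, tape_word p w, p + int k) = (Run i ph u, tape_word p w, p + int (Suc k))"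
    using k by (simp add: tape_word_in fun_upd_idem)
  have "m = length w - Suc k" "Suc k \<le> length w" using Suc by simp_all
  from reaches_trans[OF reaches_step[OF s] Suc.hyps(1)[OF this]]
  show ?case using k by (simp add: Suc_diff_Suc)
qed

lemma run_write:
  "reaches P (Run i ph u, tape_word p w, p + int (length w)) (length u) (Run i ph [], tape_word p (w @ u), p + int (length (w @ u)))"
proof (induction u arbitrary: w)
  case Nil
  show ?case by (simp add: reaches_refl)
next
  case (Cons b u)
  have "astep P (Run i ph (b # u), tape_word p w, p + int (length w)) = (Run i ph u, tape_word p (w @ [b]), p + int (length (w @ [b])))"
    by (simp add: tape_word_push)
  from reaches_trans[OF reaches_step[OF this] Cons.IH] show ?case by simp
qed

lemma run_back:
  "k \<le> length w \<Longrightarrow> reaches P (Back i ph, tape_word p w, p + int k - 1) (k + 1) (Pop i ph, tape_word p w, p)"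
proof (induction k)
  case 0
  have "tape_word p w (p - 1) = None" by simp
  then show ?case by (intro reaches_mono[OF reaches_step]) (auto simp: fun_upd_idem)
next
  case (Suc k)
  have s: "astep P (Back i ph, tape_word p w, p + int (Suc k) - 1) = (Back i ph, tape_word p w, p + int k - 1)"
    using Suc by (simp add: tape_word_in fun_upd_idem)
  from reaches_trans[OF reaches_step[OF s] Suc.IH] show ?case using Suc by simp
qed

lemma run_total:
  "reaches P (Run i ph u, tape_word p w, p) (2 * (length w + length u) + 2) (Pop i ph, tape_word p (w @ u), p)"
proof -
  have 1: "reaches P (Run i ph u, tape_word p w, p) (length w) (Run i ph u, tape_word p w, p + int (length w))"
    using run_right[of 0 w] by simp
  have 2: "reaches P (Run i ph [], tape_word p (w @ u), p + int (length (w @ u))) 1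
             (Back i ph, tape_word p (w @ u), p + int (length (w @ u)) - 1)"
    by (rule reaches_step) (simp add: fun_upd_idem tape_word_def)
  show ?thesis
    by (rule reaches_mono[OF reaches_trans[OF reaches_trans[OF reaches_trans[OF 1 run_write] 2] run_back[of "length (w @ u)"]]])
      simp_all
qed

lemma step_letter:
  assumes "i < length P" "(P ! i) ph a = (ph', u)"
  shows "reaches P (Pop i ph, tape_word p (Some a # w), p) (2 * (length w + length u) + 3)
           (Pop i ph', tape_word (p + 1) (w @ map Some u), p + 1)"
proof -
  have "astep P (Pop i ph, tape_word p (Some a # w), p) = (Run i ph' (map Some u), tape_word (p + 1) w, p + 1)"
    using assms by (simp add: tape_word_hd tape_word_pop)
  from reaches_trans[OF reaches_step[OF this] run_total]
  show ?thesis by (rule reaches_mono) simp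
qed

lemma step_mark:
  assumes "i < length P"
  shows "reaches P (Pop i ph, tape_word p (None # w), p) (2 * length w + 5)
           (Pop (if ph then i else Suc i) False, tape_word (p + 1) (w @ [None]), p + 1)"
proof -
  have "astep P (Pop i ph, tape_word p (None # w), p) = (Run (if ph then i else Suc i) False [None], tape_word (p + 1) w, p + 1)"
    using assms by (simp add: tape_word_hd tape_word_pop)
  from reaches_trans[OF reaches_step[OF this] run_total]
  show ?thesis by (rule reaches_mono) simp
qed

text \<open>In the middle of a pass the queue holds the unread input, the mark and the output
  \<open>v\<close> written so far. The bound \<open>l\<close> covers \<open>v\<close> and all output
  still to come, so every letter can be charged the same cost.\<close>

lemma pass_letters:
  assumes "i < length P" "\<And>ph a. length (snd ((P ! i) ph a)) \<le> k"
  shows "transduce (P ! i) ph w = (ph', w') \<Longrightarrow> length w * k + length v \<le> l \<Longrightarrow>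
    reaches P (Pop i ph, tape_word p (map Some w @ None # v), p) (length w * (2 * (length w + l + k + 1) + 3))
     (Pop i ph', tape_word (p + int (length w)) (None # v @ map Some w'), p + int (length w))"
proof (induction w arbitrary: ph p w' v l)
  case Nil
  then show ?case by (simp add: reaches_refl)
next
  case (Cons a w)
  obtain ph1 u where u: "(P ! i) ph a = (ph1, u)" by fastforce
  obtain w1 where w1: "transduce (P ! i) ph1 w = (ph', w1)" "w' = u @ w1"
    using Cons.prems u by (auto split: prod.splits)
  have lu: "length u \<le> k" using assms(2)[of ph a] u by simp
  have b: "length w * k + length (v @ map Some u) \<le> l" using Cons.prems(2) lu by simp
  from step_letter[OF assms(1) u, of p "map Some w @ None # v"]
  have 1: "reaches P (Pop i ph, tape_word p (map Some (a # w) @ None # v), p) (2 * (length w + length v + 1 + length u) + 3)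
     (Pop i ph1, tape_word (p + 1) (map Some w @ None # v @ map Some u), p + 1)" by (simp add: add.assoc)
  have lv: "length v \<le> l" using Cons.prems(2) by simp
  show ?case
  proof (rule reaches_mono)
    from reaches_trans[OF 1 Cons.IH[OF w1(1) b, of "p + 1"]]
    show "reaches P (Pop i ph, tape_word p (map Some (a # w) @ None # v), p)
       ((2 * (length w + length v + 1 + length u) + 3) + length w * (2 * (length w + l + k + 1) + 3))
       (Pop i ph', tape_word (p + int (length (a # w))) (None # v @ map Some w'), p + int (length (a # w)))"
      using w1 by (simp add: algebra_simps)
    have "2 * (length w + length v + 1 + length u) + 3 \<le> 2 * (length (a # w) + l + k + 1) + 3"
      using lu lv by simp
    then have "(2 * (length w + length v + 1 + length u) + 3) + length w * (2 * (length w + l + k + 1) + 3)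
      \<le> (2 * (length (a # w) + l + k + 1) + 3) + length w * (2 * (length (a # w) + l + k + 1) + 3)"
      by (rule add_mono[OF _ mult_le_mono2]) simp_all
    then show "(2 * (length w + length v + 1 + length u) + 3) + length w * (2 * (length w + l + k + 1) + 3)
      \<le> length (a # w) * (2 * (length (a # w) + l + k + 1) + 3)" by simp
  qed
qed

lemma transduce_length:
  assumes "\<And>ph a. length (snd (\<tau> ph a)) \<le> k"
  shows "length (snd (transduce \<tau> ph w)) \<le> k * length w"
proof (induction w arbitrary: ph)
  case (Cons a w)
  obtain ph1 u where u: "\<tau> ph a = (ph1, u)" by fastforce
  show ?case using assms[of ph a] Cons[of ph1] u by (auto split: prod.split)
qed simp

lemma pass:
  assumes "i < length P" "\<And>ph a. length (snd ((P ! i) ph a)) \<le> k" "transduce (P ! i) False w = (ph', w')"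
    and "length w \<le> l"
  shows "reaches P (Pop i False, tape_word p (map Some w @ [None]), p) (10 * (k + 1) * (l + 1) ^ 2)
     (Pop (if ph' then i else Suc i) False, tape_word (p + int (length w) + 1) (map Some w' @ [None]), p + int (length w) + 1)"
proof -
  note 1 = pass_letters[OF assms(1,2,3), of "[]" "length w * k" p, simplified]
  note 2 = step_mark[OF assms(1), of ph' "p + int (length w)" "map Some w'"]
  have lw': "length w' \<le> k * length w" using transduce_length[where \<tau> = "P ! i" and k = k and ph = False and w = w, OF assms(2)] assms(3) by simp
  have "length w * (2 * (length w + length w * k + k + 1) + 3) + (2 * length w' + 5)
     \<le> length w * (2 * (length w + length w * k + k + 1) + 3) + (2 * (k * length w) + 5)"
    using lw' by simp
  also have "\<dots> \<le> l * (2 * (l + l * k + k + 1) + 3) + (2 * (k * l) + 5)"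
    using assms(4) by (intro add_mono mult_mono) auto
  also have "\<dots> \<le> 10 * (k + 1) * (l + 1) ^ 2"
    by (simp add: algebra_simps power2_eq_square)
  finally show ?thesis
    using reaches_mono[OF reaches_trans[OF 1 2]] by simp
qed

abbreviation cnt :: "('a \<Rightarrow> bool) \<Rightarrow> 'a list \<Rightarrow> nat" where
  "cnt U w \<equiv> length (filter U w)"

text \<open>Every pass that ends in state True uses up a U-letter, so the number of U-letters bounds the number of
  passes. Only A-letters can lengthen the word and their number never grows, so a pass adds only linearly
  many letters. Together this makes every program of good instructions polynomial.\<close>

definition good :: "('a \<Rightarrow> bool) \<Rightarrow> ('a \<Rightarrow> bool) \<Rightarrow> 'a instr \<Rightarrow> bool" where
  "good U A \<tau> \<longleftrightarrow> (\<forall>ph a. case \<tau> ph a of (ph', u) \<Rightarrow>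
     cnt U u \<le> (if U a then 1 else 0) \<and> cnt A u \<le> (if A a then 1 else 0) \<and>
     (\<not> A a \<longrightarrow> length u \<le> 1) \<and> (\<not> ph \<and> ph' \<longrightarrow> U a \<and> cnt U u = 0))"

lemma goodD:
  assumes "good U A \<tau>" "\<tau> ph a = (ph', u)"
  shows "cnt U u \<le> (if U a then 1 else 0)" "cnt A u \<le> (if A a then 1 else 0)"
    "\<not> A a \<Longrightarrow> length u \<le> 1" "\<not> ph \<Longrightarrow> ph' \<Longrightarrow> U a \<and> cnt U u = 0"
  using spec[OF spec[OF assms(1)[unfolded good_def], of ph], of a] assms(2) by auto

lemma transduce_good:
  assumes "good U A \<tau>" "\<And>ph a. length (snd (\<tau> ph a)) \<le> k"
  shows "transduce \<tau> ph w = (ph', w') \<Longrightarrow> cnt U w' \<le> cnt U w \<and> cnt A w' \<le> cnt A w \<and>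
     length w' \<le> length w + k * cnt A w \<and> (\<not> ph \<and> ph' \<longrightarrow> cnt U w' < cnt U w)"
proof (induction w arbitrary: ph w')
  case (Cons a w)
  obtain ph1 u where u: "\<tau> ph a = (ph1, u)" by fastforce
  obtain w1 where w1: "transduce \<tau> ph1 w = (ph', w1)" "w' = u @ w1"
    using Cons.prems u by (auto split: prod.splits)
  note IH = Cons.IH[OF w1(1)]
  have lu: "length u \<le> k" using assms(2)[of ph a] u by simp
  note g = goodD[OF assms(1) u]
  show ?case
  proof (intro conjI)
    show "cnt U w' \<le> cnt U (a # w)" "cnt A w' \<le> cnt A (a # w)"
      using IH g(1,2) w1(2) by (auto split: if_splits)
    show "length w' \<le> length (a # w) + k * cnt A (a # w)"
      using IH g(3) lu w1(2) by (cases "A a") auto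
    show "\<not> ph \<and> ph' \<longrightarrow> cnt U w' < cnt U (a # w)"
      using IH g(1,4) w1(2) by (cases ph1) (auto split: if_splits)
  qed
qed auto

text \<open>The potential \<open>length w + cnt U w * (k * a)\<close> never increases: a pass that
  ends in state True adds at most \<open>k * a\<close> letters and uses up a U. Hence one
  \<open>l\<close> bounds the word in all passes of the loop.\<close>

lemma loop_reaches:
  assumes "good U A \<tau>" "\<And>ph a. length (snd (\<tau> ph a)) \<le> k" "i < length P" "P ! i = \<tau>"
  shows "loop \<tau> w w' \<Longrightarrow> cnt A w \<le> a \<Longrightarrow> length w + cnt U w * (k * a) \<le> l \<Longrightarrow>
    (\<exists>p'. reaches P (Pop i False, tape_word p (map Some w @ [None]), p) ((cnt U w + 1) * (10 * (k + 1) * (l + 1) ^ 2))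
      (Pop (Suc i) False, tape_word p' (map Some w' @ [None]), p')) \<and> length w' \<le> l + k * a"
proof (induction arbitrary: p rule: loop.induct)
  case (stop w w')
  have "length w \<le> l" using stop.prems by simp
  have t: "transduce (P ! i) False w = (False, w')" using stop assms(4) by simp
  have 1: "reaches P (Pop i False, tape_word p (map Some w @ [None]), p) (10 * (k + 1) * (l + 1) ^ 2)
     (Pop (Suc i) False, tape_word (p + int (length w) + 1) (map Some w' @ [None]), p + int (length w) + 1)"
    using pass[OF assms(3) _ t \<open>length w \<le> l\<close>, of k p] assms(2,4) by simp
  have "length w' \<le> length w + k * cnt A w" using transduce_good[OF assms(1,2) stop.hyps] by simp
  also have "\<dots> \<le> l + k * a" using stop.prems \<open>length w \<le> l\<close> by (intro add_mono mult_mono) auto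
  finally have "length w' \<le> l + k * a" .
  with reaches_mono[OF 1, of "(cnt U w + 1) * (10 * (k + 1) * (l + 1) ^ 2)"] show ?case by auto
next
  case (again w w1 w')
  have "length w \<le> l" using again.prems by simp
  have t: "transduce (P ! i) False w = (True, w1)" using again assms(4) by simp
  have 1: "reaches P (Pop i False, tape_word p (map Some w @ [None]), p) (10 * (k + 1) * (l + 1) ^ 2)
     (Pop i False, tape_word (p + int (length w) + 1) (map Some w1 @ [None]), p + int (length w) + 1)"
    using pass[OF assms(3) _ t \<open>length w \<le> l\<close>, of k p] assms(2,4) by simp
  have g: "cnt U w1 < cnt U w" "cnt A w1 \<le> cnt A w" "length w1 \<le> length w + k * cnt A w"
    using transduce_good[OF assms(1,2) again.hyps(1)] by simp_all
  have a1: "cnt A w1 \<le> a" using g again.prems by simp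
  have "length w1 + cnt U w1 * (k * a) \<le> length w + k * a + cnt U w1 * (k * a)"
    using g(3) again.prems(1) mult_le_mono2[of "cnt A w" a k] by linarith
  also have "\<dots> = length w + Suc (cnt U w1) * (k * a)" by simp
  also have "\<dots> \<le> length w + cnt U w * (k * a)"
    using g(1) by (intro add_mono mult_right_mono) auto
  finally have l1: "length w1 + cnt U w1 * (k * a) \<le> l" using again.prems(2) by simp
  obtain p' where p': "reaches P (Pop i False, tape_word (p + int (length w) + 1) (map Some w1 @ [None]), p + int (length w) + 1)
      ((cnt U w1 + 1) * (10 * (k + 1) * (l + 1) ^ 2))
      (Pop (Suc i) False, tape_word p' (map Some w' @ [None]), p')" and lw: "length w' \<le> l + k * a"
    using again.IH[OF a1 l1] by blast
  have "10 * (k + 1) * (l + 1) ^ 2 + (cnt U w1 + 1) * (10 * (k + 1) * (l + 1) ^ 2)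
     = (cnt U w1 + 2) * (10 * (k + 1) * (l + 1) ^ 2)" by simp
  also have "\<dots> \<le> (cnt U w + 1) * (10 * (k + 1) * (l + 1) ^ 2)"
    using g(1) by (intro mult_right_mono) auto
  finally show ?case using reaches_mono[OF reaches_trans[OF 1 p']] lw by blast
qed

lemma square_aux: "b * (10 * a * (a * b ^ 2) ^ 2) = 10 * a ^ 3 * (b :: nat) ^ 5"
  by (simp add: eval_nat_numeral algebra_simps)

text \<open>The prefix \<open>P0\<close> of instructions already executed is needed because states
  hold absolute positions in the program. One instruction costs at most a fifth power and can square
  the length of the word, which turns exponent d for the rest into 2 * d; hence
  \<open>5 + 2 * d\<close>.\<close>

lemma run_program_reaches:
  assumes "\<And>\<tau>. \<tau> \<in> set Q \<Longrightarrow> (\<exists>U A. good U A \<tau>) \<and> (\<forall>ph a. length (snd (\<tau> ph a)) \<le> k)"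
  shows "\<exists>c d. \<forall>P0 w w' p. run_program Q w w' \<longrightarrow> (\<exists>p'. reaches (P0 @ Q) (Pop (length P0) False, tape_word p (map Some w @ [None]), p)
     (c * (length w + 1) ^ d) (Pop (length (P0 @ Q)) False, tape_word p' (map Some w' @ [None]), p'))"
  using assms
proof (induction Q)
  case Nil
  show ?case using reaches_refl by fastforce
next
  case (Cons \<tau> Q)
  then obtain c d where IH: "\<And>P0 w w' p. run_program Q w w' \<Longrightarrow> (\<exists>p'. reaches (P0 @ Q) (Pop (length P0) False, tape_word p (map Some w @ [None]), p)
     (c * (length w + 1) ^ d) (Pop (length (P0 @ Q)) False, tape_word p' (map Some w' @ [None]), p'))"
    by (metis list.set_intros(2))
  obtain U A where g: "good U A \<tau>" using Cons.prems[of \<tau>] by auto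
  have k: "\<And>ph a. length (snd (\<tau> ph a)) \<le> k" using Cons.prems by auto
  let ?c1 = "10 * (k + 1) ^ 3" and ?c2 = "c * (2 + 2 * k) ^ d"
  have step: "\<exists>p'. reaches (P0 @ \<tau> # Q) (Pop (length P0) False, tape_word p (map Some w @ [None]), p)
      ((?c1 + ?c2) * (length w + 1) ^ (5 + 2 * d))
      (Pop (length (P0 @ \<tau> # Q)) False, tape_word p' (map Some w' @ [None]), p')"
    if pr: "run_program (\<tau> # Q) w w'" for P0 w w' p
  proof -
    obtain w1 where w1: "loop \<tau> w w1" "run_program Q w1 w'" using pr by auto
    define n where "n = length w"
    \<comment> \<open>The length n serves as a crude bound both for the number of passes and for the
      number of growing letters.\<close>
    define l where "l = n + n * (k * n)"
    have cn: "cnt U w \<le> n" "cnt A w \<le> n" by (simp_all add: n_def)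
    have ll: "length w + cnt U w * (k * n) \<le> l" using cn by (simp add: l_def n_def)
    have i: "length P0 < length (P0 @ \<tau> # Q)" "(P0 @ \<tau> # Q) ! length P0 = \<tau>" by simp_all
    obtain p1 where p1: "reaches (P0 @ \<tau> # Q) (Pop (length P0) False, tape_word p (map Some w @ [None]), p)
       ((cnt U w + 1) * (10 * (k + 1) * (l + 1) ^ 2)) (Pop (Suc (length P0)) False, tape_word p1 (map Some w1 @ [None]), p1)"
      and lw1: "length w1 \<le> l + k * n"
      using loop_reaches[OF g k i w1(1) cn(2) ll] by blast
    obtain p2 where p2: "reaches (P0 @ \<tau> # Q) (Pop (Suc (length P0)) False, tape_word p1 (map Some w1 @ [None]), p1)
       (c * (length w1 + 1) ^ d) (Pop (length (P0 @ \<tau> # Q)) False, tape_word p2 (map Some w' @ [None]), p2)"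
      using IH[OF w1(2), of "P0 @ [\<tau>]" p1] by auto
    have "l + 1 \<le> (k + 1) * (n + 1) ^ 2" by (simp add: l_def algebra_simps power2_eq_square)
    then have "(cnt U w + 1) * (10 * (k + 1) * (l + 1) ^ 2) \<le> (n + 1) * (10 * (k + 1) * ((k + 1) * (n + 1) ^ 2) ^ 2)"
      using cn by (intro mult_mono power_mono) auto
    also have "\<dots> = ?c1 * (n + 1) ^ 5" by (rule square_aux)
    also have "\<dots> \<le> ?c1 * (n + 1) ^ (5 + 2 * d)" by (intro mult_left_mono power_increasing) auto
    finally have b1: "(cnt U w + 1) * (10 * (k + 1) * (l + 1) ^ 2) \<le> ?c1 * (n + 1) ^ (5 + 2 * d)" .
    have "length w1 + 1 \<le> (2 + 2 * k) * (n + 1) ^ 2"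
      using lw1 by (simp add: l_def algebra_simps power2_eq_square)
    then have "c * (length w1 + 1) ^ d \<le> c * ((2 + 2 * k) * (n + 1) ^ 2) ^ d"
      by (intro mult_left_mono power_mono) auto
    also have "\<dots> = ?c2 * (n + 1) ^ (2 * d)" by (simp only: power_mult_distrib power_mult mult.assoc)
    also have "\<dots> \<le> ?c2 * (n + 1) ^ (5 + 2 * d)" by (intro mult_left_mono power_increasing) auto
    finally have "c * (length w1 + 1) ^ d \<le> ?c2 * (n + 1) ^ (5 + 2 * d)" .
    with b1 have "(cnt U w + 1) * (10 * (k + 1) * (l + 1) ^ 2) + c * (length w1 + 1) ^ d
       \<le> (?c1 + ?c2) * (length w + 1) ^ (5 + 2 * d)"
      by (simp only: distrib_right n_def[symmetric] add_mono)
    from reaches_mono[OF reaches_trans[OF p1 p2] this]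
    show ?thesis by blast
  qed
  show ?case
    by (rule exI[of _ "?c1 + ?c2"], rule exI[of _ "5 + 2 * d"]) (use step in blast)
qed

section \<open>Compilation of programs into numbered states and symbols\<close>

lemma ex_distinct_list:
  assumes "finite S" "set xs \<subseteq> S" "distinct xs"
  shows "\<exists>zs. set zs = S \<and> distinct zs \<and> take (length xs) zs = xs"
proof -
  obtain ys where "set ys = S - set xs" "distinct ys"
    using finite_distinct_list[of "S - set xs"] assms(1) by auto
  then show ?thesis using assms by (intro exI[of _ "xs @ ys"]) auto
qed

definition index_of :: "'b list \<Rightarrow> 'b \<Rightarrow> nat" where
  "index_of zs a = (LEAST i. i < length zs \<and> zs ! i = a)"

lemma index_of_props:
  assumes "a \<in> set zs"
  shows "index_of zs a < length zs" "zs ! index_of zs a = a"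
proof -
  have "\<exists>i. i < length zs \<and> zs ! i = a" using assms by (simp add: in_set_conv_nth)
  from LeastI_ex[OF this] show "index_of zs a < length zs" "zs ! index_of zs a = a" by (simp_all add: index_of_def)
qed

lemma index_of_nth: "distinct zs \<Longrightarrow> i < length zs \<Longrightarrow> index_of zs (zs ! i) = i"
  using index_of_props[of "zs ! i" zs] by (simp add: nth_eq_iff_index_eq)

text \<open>\<open>Run\<close> carries a word, so there are infinitely many values of type
  \<open>'a st\<close>; bounding that word leaves a finite set closed under steps. The position past
  the last instruction occurs only in phase False, which makes the halting state unique among the
  \<open>Pop\<close> states there.\<close>

definition ok_st :: "'a instr list \<Rightarrow> nat \<Rightarrow> 'a st set" where
  "ok_st P m = {st. case st of
     Pop i ph \<Rightarrow> i < length P \<or> i = length P \<and> \<not> ph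
   | Back i ph \<Rightarrow> i < length P \<or> i = length P \<and> \<not> ph
   | Run i ph u \<Rightarrow> (i < length P \<or> i = length P \<and> \<not> ph) \<and> length u \<le> m}"

lemma ok_st_simps:
  "Pop i ph \<in> ok_st P m \<longleftrightarrow> i < length P \<or> i = length P \<and> \<not> ph"
  "Back i ph \<in> ok_st P m \<longleftrightarrow> i < length P \<or> i = length P \<and> \<not> ph"
  "Run i ph u \<in> ok_st P m \<longleftrightarrow> (i < length P \<or> i = length P \<and> \<not> ph) \<and> length u \<le> m"
  by (simp_all add: ok_st_def)

lemma finite_ok_st: "finite (ok_st (P :: 'a::finite instr list) m)"
proof (rule finite_subset)
  let ?I = "{..length P} \<times> (UNIV :: bool set)" and ?U = "{u :: 'a option list. set u \<subseteq> UNIV \<and> length u \<le> m}"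
  show "ok_st P m \<subseteq> (\<lambda>(i, ph). Pop i ph) ` ?I \<union> (\<lambda>(i, ph). Back i ph) ` ?I \<union> (\<lambda>((i, ph), u). Run i ph u) ` (?I \<times> ?U)"
  proof
    fix st assume "st \<in> ok_st P m"
    then show "st \<in> (\<lambda>(i, ph). Pop i ph) ` ?I \<union> (\<lambda>(i, ph). Back i ph) ` ?I \<union> (\<lambda>((i, ph), u). Run i ph u) ` (?I \<times> ?U)"
      by (cases st) (auto simp: ok_st_simps image_iff)
  qed
  show "finite ((\<lambda>(i, ph). Pop i ph) ` ?I \<union> (\<lambda>(i, ph). Back i ph) ` ?I \<union> (\<lambda>((i, ph), u). Run i ph u) ` (?I \<times> ?U))"
    by (intro finite_UnI finite_imageI finite_cartesian_product finite_lists_length_le) auto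
qed

lemma adelta_ok:
  assumes "st \<in> ok_st P m" "st \<noteq> Pop (length P) False"
    and "\<forall>\<tau>\<in>set P. \<forall>ph a. length (snd (\<tau> ph a)) \<le> m" "1 \<le> m"
  shows "case adelta P st s of (st', b, d) \<Rightarrow> st' \<in> ok_st P m \<and> d \<in> {-1, 0, 1}"
proof (cases st)
  case (Pop i ph)
  then have i: "i < length P" using assms by (auto simp: ok_st_simps)
  show ?thesis
  proof (cases s)
    case None
    then show ?thesis using Pop i by (simp add: ok_st_simps)
  next
    case (Some b)
    show ?thesis
    proof (cases b)
      case None
      then show ?thesis using Pop Some i assms(4) by (cases ph) (auto simp: ok_st_simps)
    next
      case (Some a)
      obtain ph' u where u: "(P ! i) ph a = (ph', u)" by fastforce
      then have "length u \<le> m" using bspec[OF assms(3) nth_mem[OF i]] by (metis snd_conv)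
      then show ?thesis using Pop Some \<open>s = Some b\<close> i u by (simp add: ok_st_simps)
    qed
  qed
next
  case (Run i ph u)
  then show ?thesis using assms(1) by (cases s; cases u) (auto simp: ok_st_simps)
next
  case (Back i ph)
  then show ?thesis using assms(1) by (cases s) (auto simp: ok_st_simps)
qed

text \<open>This is the only link from programs to Turing machines. The start state is a
  \<open>Run\<close> state about to append \<open>tail_word\<close> and the mark, so a program finds
  fixed material behind its input.\<close>

lemma poly_time_computable_program:
  fixes bit :: "bool \<Rightarrow> 'a::finite"
  assumes inj: "inj bit"
    and good: "\<And>\<tau>. \<tau> \<in> set P \<Longrightarrow> \<exists>U A. good U A \<tau>"
    and run: "\<And>x. run_program P (map bit x @ tail_word) (map bit (f x))"
    and "P \<noteq> []"
  shows "poly_time_computable f"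
proof -
  define ls where "ls = insert (length tail_word + 1) ((\<lambda>(\<tau>, ph, a). length (snd (\<tau> ph a))) ` (set P \<times> UNIV))"
  define m where "m = Max ls"
  have fin: "finite ls" by (auto simp: ls_def)
  have mP: "length (snd (\<tau> ph a)) \<le> m" if "\<tau> \<in> set P" for \<tau> ph a
    unfolding m_def by (rule Max_ge[OF fin]) (unfold ls_def, rule insertI2, rule image_eqI[of _ _ "(\<tau>, ph, a)"], use that in auto)
  have mP': "\<forall>\<tau>\<in>set P. \<forall>ph a. length (snd (\<tau> ph a)) \<le> m" using mP by blast
  have mb: "length tail_word + 1 \<le> m" unfolding m_def using fin by (intro Max_ge) (auto simp: ls_def)
  define st0 where "st0 = Run 0 False (map Some tail_word @ [None])"
  define st1 :: "'a st" where "st1 = Pop (length P) False"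
  let ?S = "ok_st P m"
  have "set [st0, st1] \<subseteq> ?S" using mb \<open>P \<noteq> []\<close> by (simp add: st0_def st1_def ok_st_simps)
  moreover have "distinct [st0, st1]" by (simp add: st0_def st1_def)
  \<comment> \<open>The machine model prescribes the numbers 0 and 1 for the start and the halting
    state, and below 0, 1, 2 for the blank and the two bits, so these head the enumerations.\<close>
  ultimately obtain zs where zs: "set zs = ?S" "distinct zs" "take 2 zs = [st0, st1]"
    using ex_distinct_list[OF finite_ok_st] by (metis length_Cons list.size(3) numeral_2_eq_2)
  have "distinct [None, Some (Some (bit False)), Some (Some (bit True))]"
    using inj by (simp add: inj_eq)
  then obtain ys where ys: "set ys = (UNIV :: 'a option option set)" "distinct ys"
      "take 3 ys = [None, Some (Some (bit False)), Some (Some (bit True))]"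
    using ex_distinct_list[OF finite_UNIV] by (metis length_Cons list.size(3) numeral_3_eq_3 subset_UNIV)
  have lz: "2 \<le> length zs" and ly: "3 \<le> length ys"
    using arg_cong[OF zs(3), of length] arg_cong[OF ys(3), of length] by (simp_all add: min_def split: if_splits)
  have z: "zs ! 0 = st0" "zs ! 1 = st1"
    using arg_cong[OF zs(3), of "\<lambda>l. l ! 0"] arg_cong[OF zs(3), of "\<lambda>l. l ! 1"] by simp_all
  have y: "ys ! 0 = None" "ys ! 1 = Some (Some (bit False))" "ys ! 2 = Some (Some (bit True))"
    using arg_cong[OF ys(3), of "\<lambda>l. l ! 0"] arg_cong[OF ys(3), of "\<lambda>l. l ! 1"] arg_cong[OF ys(3), of "\<lambda>l. l ! 2"] by simp_all
  have l0: "0 < length zs" "1 < length zs" "0 < length ys" "1 < length ys" "2 < length ys"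
    using lz ly by linarith+
  have zi: "index_of zs st0 = 0" "index_of zs st1 = 1"
    using index_of_nth[OF zs(2) l0(1)] index_of_nth[OF zs(2) l0(2)] z by simp_all
  have yi: "index_of ys None = 0" "index_of ys (Some (Some (bit False))) = 1" "index_of ys (Some (Some (bit True))) = 2"
    using index_of_nth[OF ys(2) l0(3)] index_of_nth[OF ys(2) l0(4)] index_of_nth[OF ys(2) l0(5)] y by simp_all
  have yl: "index_of ys b < length ys" "ys ! index_of ys b = b" for b
    using index_of_props[of b ys] ys(1) by simp_all
  define \<delta> where "\<delta> = (\<lambda>q s. case adelta P (zs ! q) (ys ! s) of (st, b, d) \<Rightarrow> (index_of zs st, index_of ys b, d))"
  define M where "M = (length zs, length ys, \<delta>)"
  have wf: "wf_tm M"
  proof -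
    have "case \<delta> q s of (q', s', d) \<Rightarrow> q' < length zs \<and> s' < length ys \<and> d \<in> {-1, 0, 1}"
      if q: "q < length zs" "q \<noteq> 1" for q s
    proof -
      have "zs ! q \<in> ?S" using nth_mem[OF q(1)] zs(1) by simp
      moreover have "zs ! q \<noteq> Pop (length P) False"
        using nth_eq_iff_index_eq[OF zs(2) q(1), of 1] q(2) z(2) l0 by (simp add: st1_def)
      moreover obtain st' b d where ad: "adelta P (zs ! q) (ys ! s) = (st', b, d)" by (metis prod_cases3)
      ultimately have "st' \<in> ?S \<and> d \<in> {-1, 0, 1}"
        using adelta_ok[of "zs ! q" P m "ys ! s", OF _ _ mP'] mb by simp
      then show ?thesis
        using yl(1) index_of_props(1)[of st' zs] by (simp add: \<delta>_def ad zs(1))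
    qed
    then show ?thesis using lz ly by (simp add: wf_tm_def M_def)
  qed
  define conc where "conc = (\<lambda>(st, t :: int \<Rightarrow> 'a option option, p :: int). (index_of zs st, index_of ys \<circ> t, p))"
  have sim1: "tm_step M (conc c) = conc (astep P c) \<and> fst (astep P c) \<in> ?S" if "fst c \<in> ?S" for c
  proof -
    obtain st t p where c: "c = (st, t, p)" by (metis prod_cases3)
    have st: "st \<in> ?S" using that c by simp
    show ?thesis
    proof (cases "st = st1")
      case True
      then show ?thesis using st zi(2) unfolding st1_def by (simp add: c conc_def tm_step_def M_def)
    next
      case False
      have ne: "index_of zs st \<noteq> 1"
        using False index_of_props(2)[of st zs] st zs(1) z(2) by metis
      obtain st' b d where ad: "adelta P st (t p) = (st', b, d)" by (metis prod_cases3)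
      then have "st' \<in> ?S"
        using adelta_ok[of st P m "t p", OF st _ mP'] mb False by (simp add: st1_def)
      moreover have "\<delta> (index_of zs st) (index_of ys (t p)) = (index_of zs st', index_of ys b, d)"
        using index_of_props(2)[of st zs] st yl(2) by (simp add: \<delta>_def ad zs(1))
      moreover have "(index_of ys \<circ> t)(p := index_of ys b) = index_of ys \<circ> t(p := b)" by (simp add: fun_eq_iff)
      ultimately show ?thesis
        using False ne by (simp add: c conc_def tm_step_def M_def st1_def ad)
    qed
  qed
  have sim: "(tm_step M ^^ n) (conc c) = conc ((astep P ^^ n) c) \<and> fst ((astep P ^^ n) c) \<in> ?S"
    if "fst c \<in> ?S" for c n
    by (induction n) (use that sim1 in auto)
  obtain c d where cd: "\<And>P0 w w' p. run_program P w w' \<Longrightarrow> (\<exists>p'. reaches (P0 @ P) (Pop (length P0) False, tape_word p (map Some w @ [None]), p)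
     (c * (length w + 1) ^ d) (Pop (length (P0 @ P)) False, tape_word p' (map Some w' @ [None]), p'))"
    using run_program_reaches[of P m] good mP by blast
  define lb where "lb = length tail_word"
  define cc where "cc = 4 * (lb + 1) + c * (lb + 1) ^ d"
  have main: "\<exists>n\<le>cc * (length x + 1) ^ (d + 1). fst ((tm_step M ^^ n) (tm_init x)) = 1
     \<and> tm_output ((tm_step M ^^ n) (tm_init x)) = f x" for x
  proof -
    let ?W = "map Some (map bit x) :: 'a option list"
    let ?V = "map Some (map bit (f x)) @ [None] :: 'a option list"
    have init: "tm_init x = conc (st0, tape_word 0 ?W, 0)"
      by (auto simp: tm_init_def conc_def zi tape_word_def yi fun_eq_iff)
    have 1: "reaches P (st0, tape_word 0 ?W, 0) (2 * (length x + lb + 1) + 2) (Pop 0 False, tape_word 0 (map Some (map bit x @ tail_word) @ [None]), 0)"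
      using run_total[of P 0 False "map Some tail_word @ [None]" 0 ?W] by (simp add: st0_def lb_def)
    obtain p' where 2: "reaches P (Pop 0 False, tape_word 0 (map Some (map bit x @ tail_word) @ [None]), 0)
       (c * (length x + lb + 1) ^ d) (st1, tape_word p' ?V, p')"
      using cd[OF run[of x], of "[]" 0] by (auto simp: st1_def lb_def)
    have "(length x + lb + 1) \<le> (lb + 1) * (length x + 1)" by simp
    then have "c * (length x + lb + 1) ^ d \<le> c * ((lb + 1) * (length x + 1)) ^ d"
      by (intro mult_left_mono power_mono) auto
    also have "\<dots> = c * (lb + 1) ^ d * (length x + 1) ^ d" by (simp only: power_mult_distrib mult.assoc)
    also have "\<dots> \<le> c * (lb + 1) ^ d * (length x + 1) ^ (d + 1)"
      by (intro mult_left_mono power_increasing) auto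
    finally have b2: "c * (length x + lb + 1) ^ d \<le> c * (lb + 1) ^ d * (length x + 1) ^ (d + 1)" .
    have "2 * (length x + lb + 1) + 2 \<le> 4 * (lb + 1) * (length x + 1) ^ 1" by (simp add: algebra_simps)
    also have "\<dots> \<le> 4 * (lb + 1) * (length x + 1) ^ (d + 1)"
      by (intro mult_left_mono power_increasing) auto
    finally have "2 * (length x + lb + 1) + 2 + c * (length x + lb + 1) ^ d \<le> cc * (length x + 1) ^ (d + 1)"
      using b2 by (simp only: cc_def distrib_right add_mono)
    from reaches_mono[OF reaches_trans[OF 1 2] this]
    obtain n where n: "n \<le> cc * (length x + 1) ^ (d + 1)" "(astep P ^^ n) (st0, tape_word 0 ?W, 0) = (st1, tape_word p' ?V, p')"
      unfolding reaches_def by blast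
    have "st0 \<in> ?S" using nth_mem[OF l0(1)] zs(1) z(1) by simp
    then have fin: "(tm_step M ^^ n) (tm_init x) = conc (st1, tape_word p' ?V, p')"
      using sim[of "(st0, tape_word 0 ?W, 0)" n] n(2) init by simp
    have bits: "(index_of ys \<circ> tape_word p' ?V) (p' + int k) \<in> {1, 2} \<and> ((index_of ys \<circ> tape_word p' ?V) (p' + int k) = 2 \<longleftrightarrow> f x ! k)"
      if "k < length (f x)" for k
    proof -
      have "tape_word p' ?V (p' + int k) = Some (?V ! k)" using that by (intro tape_word_in) simp
      also have "?V ! k = Some (bit (f x ! k))" using that by (simp add: nth_append)
      finally show ?thesis using yi by (cases "f x ! k") auto
    qed
    \<comment> \<open>The mark behind the result is neither of the two bits, so it ends the output
      block.\<close>
    have "tape_word p' ?V (p' + int (length (f x))) = Some (?V ! length (f x))" by (intro tape_word_in) simp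
    then have "tape_word p' ?V (p' + int (length (f x))) = Some None" by (simp add: nth_append)
    then have e: "(index_of ys \<circ> tape_word p' ?V) (p' + int (length (f x))) \<notin> {1, 2}"
      using yl(2)[of "Some None"] y by auto
    have "(LEAST k. (index_of ys \<circ> tape_word p' ?V) (p' + int k) \<notin> {1, 2}) = length (f x)"
      by (rule Least_equality) (use e bits in \<open>auto simp: not_less[symmetric]\<close>)
    then have "tm_output (conc (st1, tape_word p' ?V, p')) = map (\<lambda>k. (index_of ys \<circ> tape_word p' ?V) (p' + int k) = 2) [0..<length (f x)]"
      by (simp add: tm_output_def conc_def)
    also have "\<dots> = f x" using bits by (intro nth_equalityI) auto
    finally show ?thesis using n(1) fin by (auto simp: conc_def zi)
  qed
  show ?thesis unfolding poly_time_computable_def using wf main by blast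
qed

section \<open>Loops over words\<close>

abbreviation hom :: "('a \<Rightarrow> 'b list) \<Rightarrow> 'a list \<Rightarrow> 'b list" where
  "hom g w \<equiv> concat (map g w)"

lemma hom_hom: "hom g (hom h w) = hom (\<lambda>a. hom g (h a)) w"
  by (induction w) auto

lemma hom_cong: "(\<And>a. a \<in> set w \<Longrightarrow> g a = h a) \<Longrightarrow> hom g w = hom h w"
  by (induction w) auto

lemma transduce_append: "transduce \<tau> ph (u @ v) = (case transduce \<tau> ph u of (ph1, u') \<Rightarrow> case transduce \<tau> ph1 v of (ph2, v') \<Rightarrow> (ph2, u' @ v'))"
  by (induction u arbitrary: ph) (auto split: prod.split)

definition hom_instr :: "('a \<Rightarrow> 'a list) \<Rightarrow> 'a instr" where
  "hom_instr h = (\<lambda>ph a. (ph, h a))"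

lemma transduce_hom_instr: "transduce (hom_instr h) ph w = (ph, hom h w)"
  by (induction w) (auto simp: hom_instr_def)

lemma loop_hom_instr: "loop (hom_instr h) w (hom h w)"
  by (rule loop.stop) (simp add: transduce_hom_instr)

lemma good_hom_instr:
  assumes "\<And>a. \<not> A a \<Longrightarrow> length (h a) \<le> 1" "\<And>a. cnt A (h a) \<le> (if A a then 1 else 0)"
  shows "good (\<lambda>_. False) A (hom_instr h)"
  using assms by (simp add: good_def hom_instr_def)

text \<open>Each pass of the loop turns the first U into U' and applies h everywhere else; the last pass, which finds no U, applies h as well.\<close>

definition consume :: "'a \<Rightarrow> 'a \<Rightarrow> ('a \<Rightarrow> 'a list) \<Rightarrow> 'a instr" where
  "consume U U' h = (\<lambda>ph a. if a = U \<and> \<not> ph then (True, [U']) else (ph, h a))"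

lemma transduce_consume_True: "transduce (consume U U' h) True w = (True, hom h w)"
  by (induction w) (auto simp: consume_def)

lemma transduce_consume_False: "U \<notin> set w \<Longrightarrow> transduce (consume U U' h) False w = (False, hom h w)"
  by (induction w) (auto simp: consume_def)

lemma transduce_consume_split:
  "U \<notin> set u \<Longrightarrow> transduce (consume U U' h) False (u @ U # v) = (True, hom h u @ U' # hom h v)"
  by (simp add: transduce_append transduce_consume_False) (simp add: consume_def[of U U' h] transduce_consume_True[unfolded consume_def])

lemma count_list_hom:
  assumes "h U = [U]" "\<And>a. a \<noteq> U \<Longrightarrow> U \<notin> set (h a)"
  shows "count_list (hom h w) U = count_list w U"
  using assms by (induction w) auto

text \<open>\<open>base\<close> and \<open>step\<close> are the recursion of the k-fold iterate
  \<open>g k\<close> of \<open>h\<close>. The final pass, which meets no U, accounts for the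
  \<open>Suc\<close>.\<close>

lemma loop_consume:
  assumes U: "U \<noteq> U'" "h U = [U]" "\<And>a. a \<noteq> U \<Longrightarrow> U \<notin> set (h a)" "\<And>k. g k U' = [U']"
    and base: "\<And>a. a \<noteq> U \<Longrightarrow> g 1 a = h a"
    and step: "\<And>k a. a \<noteq> U \<Longrightarrow> hom (\<lambda>b. if b = U then [U'] else g k b) (h a) = g (Suc k) a"
  shows "loop (consume U U' h) w (hom (\<lambda>a. if a = U then [U'] else g (Suc (count_list w U)) a) w)"
proof (induction "count_list w U" arbitrary: w)
  case 0
  then have n: "U \<notin> set w" by (simp add: count_list_0_iff)
  have "hom (\<lambda>a. if a = U then [U'] else g (Suc (count_list w U)) a) w = hom h w"
    by (rule hom_cong) (use n base 0 in auto)
  then show ?case by (simp add: loop.stop transduce_consume_False n)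
next
  case (Suc k)
  then have "U \<in> set w" by (metis count_list_0_iff nat.distinct(1))
  then obtain u v where w: "w = u @ U # v" "U \<notin> set u" by (meson split_list_first)
  let ?w = "hom h u @ U' # hom h v"
  have "count_list u U = 0" using w(2) by (simp add: count_list_0_iff)
  then have k: "count_list ?w U = k"
    using Suc.hyps(2) U(1) count_list_hom[of h U, OF U(2,3)] w(1) by simp
  let ?G = "\<lambda>k a. if a = U then [U'] else g k a"
  have G: "hom (?G (Suc k)) (h a) = ?G (Suc (Suc k)) a" for a
    using step U(2) by (cases "a = U") auto
  have "loop (consume U U' h) ?w (hom (?G (Suc k)) ?w)"
    using Suc.hyps(1)[OF k[symmetric]] unfolding k .
  moreover have "hom (?G (Suc k)) ?w = hom (?G (Suc (Suc k))) w"
    using U(1,4) by (simp add: hom_hom G w(1))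
  ultimately have "loop (consume U U' h) ?w (hom (?G (Suc (count_list w U))) w)"
    unfolding Suc.hyps(2)[symmetric] by (simp only:)
  moreover have "transduce (consume U U' h) False w = (True, ?w)"
    unfolding w(1) by (rule transduce_consume_split[OF w(2)])
  ultimately show ?case by (rule loop.again[rotated])
qed

lemma good_consume:
  assumes "U \<noteq> U'" "h U = [U]" "\<And>a. a \<noteq> U \<Longrightarrow> U \<notin> set (h a)" "\<not> A U" "\<not> A U'"
    "\<And>a. \<not> A a \<Longrightarrow> length (h a) \<le> 1" "\<And>a. cnt A (h a) \<le> (if A a then 1 else 0)"
  shows "good (\<lambda>a. a = U) A (consume U U' h)"
proof -
  have "cnt (\<lambda>a. a = U) (h a) = 0" if "a \<noteq> U" for a
    using assms(3)[OF that] by (auto simp: filter_empty_conv)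
  then show ?thesis using assms by (auto simp: good_def consume_def)
qed

text \<open>The r-th pass removes the r-th U and applies h to everything after it, so that the j-th segment is hit j times.\<close>

definition ladder :: "'a \<Rightarrow> ('a \<Rightarrow> 'a list) \<Rightarrow> 'a instr" where
  "ladder U h = (\<lambda>ph a. if a = U \<and> \<not> ph then (True, []) else (ph, if ph then h a else [a]))"

lemma transduce_ladder_True: "transduce (ladder U h) True w = (True, hom h w)"
  by (induction w) (auto simp: ladder_def)

lemma transduce_ladder_False: "U \<notin> set w \<Longrightarrow> transduce (ladder U h) False w = (False, w)"
  by (induction w) (auto simp: ladder_def)

lemma transduce_ladder_split:
  "U \<notin> set u \<Longrightarrow> transduce (ladder U h) False (u @ U # v) = (True, u @ hom h v)"
  by (simp add: transduce_append transduce_ladder_False) (simp add: ladder_def[of U h] transduce_ladder_True[unfolded ladder_def])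

text \<open>\<open>pre\<close> holds what lies before the first remaining U and is final, since a
  pass rewrites only what follows that U. The remaining segments are replaced by their images in
  every pass, so the induction is on the number of segments with their contents arbitrary.\<close>

lemma loop_ladder:
  assumes U: "h U = [U]" "\<And>a. a \<noteq> U \<Longrightarrow> U \<notin> set (h a)"
    and base: "\<And>a. a \<noteq> U \<Longrightarrow> g 1 a = h a"
    and step: "\<And>k a. a \<noteq> U \<Longrightarrow> hom (g k) (h a) = g (Suc k) a"
    and post: "U \<notin> set post" "hom h post = post"
  shows "U \<notin> set pre \<Longrightarrow> \<forall>s\<in>set segs. U \<notin> set s \<Longrightarrow>
    loop (ladder U h) (pre @ hom (\<lambda>s. U # s) segs @ post) (pre @ hom (\<lambda>j. hom (g (Suc j)) (segs ! j)) [0..<length segs] @ post)"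
proof (induction segs arbitrary: pre rule: length_induct)
  case (1 segs)
  show ?case
  proof (cases segs)
    case Nil
    then show ?thesis using 1 post by (simp add: loop.stop transduce_ladder_False)
  next
    case (Cons s ss)
    have homU: "U \<notin> set (hom h x)" if "U \<notin> set x" for x using that U(2) by auto (metis U(2))
    have gg: "hom (g k) (hom h x) = hom (g (Suc k)) x" if "U \<notin> set x" for x k
      unfolding hom_hom by (rule hom_cong) (metis step that)
    have g1: "hom (g (Suc 0)) s = hom h s"
      by (rule hom_cong) (metis base 1(3) Cons One_nat_def list.set_intros(1))
    have t: "transduce (ladder U h) False (pre @ hom (\<lambda>s. U # s) segs @ post) = (True, (pre @ hom h s) @ hom (\<lambda>s. U # s) (map (hom h) ss) @ post)"
      using transduce_ladder_split[OF 1(2)] U(1) post(2) by (simp add: Cons hom_hom comp_def)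
    have "loop (ladder U h) ((pre @ hom h s) @ hom (\<lambda>s. U # s) (map (hom h) ss) @ post)
       ((pre @ hom h s) @ hom (\<lambda>j. hom (g (Suc j)) (map (hom h) ss ! j)) [0..<length (map (hom h) ss)] @ post)"
      by (rule 1(1)[rule_format]) (use 1(2,3) homU Cons in auto)
    moreover have "hom (\<lambda>j. hom (g (Suc j)) (map (hom h) ss ! j)) [0..<length (map (hom h) ss)]
      = hom (\<lambda>j. hom (g (Suc (Suc j))) (ss ! j)) [0..<length ss]"
      unfolding length_map by (rule hom_cong) (use gg 1(3) Cons in auto)
    moreover have "hom (\<lambda>j. hom (g (Suc j)) (segs ! j)) [0..<length segs]
      = hom h s @ hom (\<lambda>j. hom (g (Suc (Suc j))) (ss ! j)) [0..<length ss]"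
      by (simp add: Cons upt_conv_Cons g1 map_Suc_upt[symmetric] comp_def del: upt_Suc)
    ultimately show ?thesis using loop.again[OF t] by simp
  qed
qed

lemma good_ladder:
  assumes "h U = [U]" "\<And>a. a \<noteq> U \<Longrightarrow> U \<notin> set (h a)"
    "\<And>a. \<not> A a \<Longrightarrow> length (h a) \<le> 1" "\<And>a. cnt A (h a) \<le> (if A a then 1 else 0)"
  shows "good (\<lambda>a. a = U) A (ladder U h)"
proof -
  have "cnt (\<lambda>a. a = U) (h a) = 0" if "a \<noteq> U" for a
    using assms(2)[OF that] by (auto simp: filter_empty_conv)
  then have "case ladder U h ph a of (ph', u) \<Rightarrow>
     cnt (\<lambda>a. a = U) u \<le> (if a = U then 1 else 0) \<and> cnt A u \<le> (if A a then 1 else 0) \<and>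
     (\<not> A a \<longrightarrow> length u \<le> 1) \<and> (\<not> ph \<and> ph' \<longrightarrow> a = U \<and> cnt (\<lambda>a. a = U) u = 0)" for ph a
    using assms(1) assms(3,4)[of a] by (cases "a = U") (auto simp: ladder_def)
  then show ?thesis by (simp add: good_def)
qed

datatype fam = Bl | Gu | No | Ka

text \<open>Bit is an input or output bit and Z the end of the input. K counts the input letters; Fam f stands for one
  of the unary amounts that are multiplied by a power of the input length: blanks (Bl), guessed cells (Gu),
  later cells (No) and digits of the size bound (Ka); their flag is False while they are fresh in a round.
  Cell h b is an initial tape cell with bit b, scanned by the head iff h. MI and MW mark a block and
  a block of the first row (D is a used MW), and Fi and Fw are growing unary fields for the index of a
  cell and of its successor in time. E becomes a bit False.\<close>

datatype letter = Bit bool | Z | E | K bool | Cell bool bool | Fam fam bool | MI | MW | D | Fi | Fw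

instance fam :: finite
proof
  have "UNIV = {Bl, Gu, No, Ka}" using fam.exhaust by auto
  then show "finite (UNIV :: fam set)" by (metis finite.emptyI finite_insert)
qed

instance letter :: finite
proof
  have "UNIV \<subseteq> range Bit \<union> {Z, E, MI, MW, D, Fi, Fw} \<union> range K \<union> range (\<lambda>(a, b). Cell a b) \<union> range (\<lambda>(a, b). Fam a b)"
  proof
    fix x :: letter
    show "x \<in> range Bit \<union> {Z, E, MI, MW, D, Fi, Fw} \<union> range K \<union> range (\<lambda>(a, b). Cell a b) \<union> range (\<lambda>(a, b). Fam a b)"
      by (cases x) (auto simp: image_iff)
  qed
  then show "finite (UNIV :: letter set)" by (rule finite_subset) auto
qed

text \<open>A bit becomes two cells because \<open>enc_pair\<close> doubles the bits of its first
  component; Z yields the cell of the terminator. The phase records whether the head has been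
  placed; the left margin must be inserted at that moment, as nothing stands before the input.
  Because of Z the first pass ends in state True, and a second one finds nothing left to
  convert.\<close>

definition front :: "nat \<Rightarrow> letter instr" where
  "front C ph a = (case a of
     Bit b \<Rightarrow> (True, (if ph then [] else replicate C (Fam Bl True)) @ [Cell (\<not> ph) True, Cell False b, K False])
   | Z \<Rightarrow> (True, (if ph then [] else replicate C (Fam Bl True)) @ [Cell (\<not> ph) False])
   | _ \<Rightarrow> (ph, [a]))"

lemma good_front: "good (\<lambda>a. a = Z \<or> a \<in> range Bit) (\<lambda>a. a = Z \<or> a \<in> range Bit) (front C)"
  by (auto simp: good_def front_def image_iff split: letter.split)

definition raw :: "letter \<Rightarrow> bool" where
  "raw a \<longleftrightarrow> a = Z \<or> a \<in> range Bit"

lemma transduce_front_not_raw: "\<forall>a\<in>set w. \<not> raw a \<Longrightarrow> transduce (front C) ph w = (ph, w)"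
  by (induction w) (auto simp: front_def raw_def split: letter.splits)

definition xcells :: "bool list \<Rightarrow> letter list" where
  "xcells x = (case hom (\<lambda>b. [Cell False True, Cell False b, K False]) x @ [Cell False False] of
     Cell h b # w \<Rightarrow> Cell True b # w | w \<Rightarrow> w)"

lemma transduce_front_True: "transduce (front C) True (map Bit x) = (True, hom (\<lambda>b. [Cell False True, Cell False b, K False]) x)"
  by (induction x) (auto simp: front_def)

lemma loop_front:
  assumes "\<forall>a\<in>set w. \<not> raw a"
  shows "loop (front C) (map Bit x @ Z # w) (replicate C (Fam Bl True) @ xcells x @ w)"
proof -
  have t: "transduce (front C) False (map Bit x @ Z # w) = (True, replicate C (Fam Bl True) @ xcells x @ w)"
  proof (cases x)
    case Nil
    then show ?thesis using assms by (simp add: transduce_front_not_raw) (simp add: front_def xcells_def)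
  next
    case (Cons b x')
    have 1: "front C False (Bit b) = (True, replicate C (Fam Bl True) @ [Cell True True, Cell False b, K False])"
      "front C True Z = (True, [Cell False False])"
      by (simp_all add: front_def)
    show ?thesis using assms by (simp add: Cons transduce_append transduce_front_not_raw transduce_front_True 1 xcells_def)
  qed
  have "\<forall>a\<in>set (xcells x). \<not> raw a"
    by (cases x) (auto simp: xcells_def raw_def)
  then have "transduce (front C) False (replicate C (Fam Bl True) @ xcells x @ w) = (False, replicate C (Fam Bl True) @ xcells x @ w)"
    using assms by (intro transduce_front_not_raw) (auto simp: raw_def)
  from loop.again[OF t loop.stop[OF this]] show ?thesis .
qed

section \<open>Multiplying unary amounts by powers of the input length plus one\<close>

definition scale :: "(fam \<Rightarrow> nat) \<Rightarrow> letter list \<Rightarrow> letter list" where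
  "scale e = hom (\<lambda>a. case a of Fam f b \<Rightarrow> replicate (e f) a | _ \<Rightarrow> [a])"

definition mult_hom :: "fam set \<Rightarrow> letter \<Rightarrow> letter list" where
  "mult_hom Fs a = (case a of Fam f b \<Rightarrow> if b \<and> f \<in> Fs then [a, Fam f False] else [a] | _ \<Rightarrow> [a])"

definition reset_hom :: "fam set \<Rightarrow> letter \<Rightarrow> letter list" where
  "reset_hom Fs a = (case a of Fam f b \<Rightarrow> if b \<and> f \<in> Fs then [] else [Fam f True] | K _ \<Rightarrow> [K False] | _ \<Rightarrow> [a])"

text \<open>With n counters the loop makes n + 1 passes, each adding one stale copy next to every
  fresh letter of a chosen family; the reset drops the originals, makes the copies fresh and
  restores the counters. This multiplies by n + 1. Stale copies must not breed: the amounts would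
  grow exponentially.\<close>

definition round :: "fam set \<Rightarrow> letter instr list" where
  "round Fs = [consume (K False) (K True) (mult_hom Fs), hom_instr (reset_hom Fs)]"

definition fresh :: "letter \<Rightarrow> bool" where
  "fresh a \<longleftrightarrow> a \<noteq> K True \<and> (\<forall>f. a \<noteq> Fam f False)"

lemma good_round: "\<tau> \<in> set (round Fs) \<Longrightarrow> \<exists>U A. good U A \<tau>"
proof -
  have "good (\<lambda>a. a = K False) (\<lambda>a. a \<in> range (\<lambda>f. Fam f True)) (consume (K False) (K True) (mult_hom Fs))"
    by (rule good_consume) (auto simp: mult_hom_def split: letter.splits if_splits)
  moreover have "good (\<lambda>_. False) (\<lambda>_. False) (hom_instr (reset_hom Fs))"
    by (rule good_hom_instr) (auto simp: reset_hom_def split: letter.splits)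
  ultimately show "\<tau> \<in> set (round Fs) \<Longrightarrow> \<exists>U A. good U A \<tau>" by (auto simp: round_def)
qed

lemma run_program_round:
  assumes "\<forall>a\<in>set w. fresh a" "count_list w (K False) = n"
  shows "run_program (round Fs) w (scale (\<lambda>f. if f \<in> Fs then Suc n else 1) w)"
proof -
  define g where "g = (\<lambda>k a. case a of Fam f b \<Rightarrow> if b \<and> f \<in> Fs then a # replicate k (Fam f False) else [a] | _ \<Rightarrow> [a])"
  let ?G = "\<lambda>a. if a = K False then [K True] else g (Suc n) a"
  have "loop (consume (K False) (K True) (mult_hom Fs)) w (hom ?G w)"
    unfolding assms(2)[symmetric]
    by (rule loop_consume) (auto simp: mult_hom_def g_def replicate_append_same split: letter.splits if_splits)
  moreover have "loop (hom_instr (reset_hom Fs)) (hom ?G w) (hom (reset_hom Fs) (hom ?G w))"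
    by (rule loop_hom_instr)
  moreover have "hom (reset_hom Fs) (hom ?G w) = scale (\<lambda>f. if f \<in> Fs then Suc n else 1) w"
    unfolding hom_hom scale_def
    by (rule hom_cong) (use assms(1) in \<open>auto simp: g_def reset_hom_def fresh_def split: letter.splits\<close>)
  ultimately show ?thesis by (auto simp: round_def)
qed

lemma scale_scale: "scale e (scale e' w) = scale (\<lambda>f. e' f * e f) w"
  unfolding scale_def hom_hom
proof (rule hom_cong)
  fix a :: letter
  have "concat (replicate i (replicate j b)) = replicate (i * j) b" for i j and b :: letter
    by (induction i) (auto simp: replicate_add)
  then show "hom (\<lambda>a. case a of Fam f b \<Rightarrow> replicate (e f) a | _ \<Rightarrow> [a]) (case a of Fam f b \<Rightarrow> replicate (e' f) a | _ \<Rightarrow> [a])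
    = (case a of Fam f b \<Rightarrow> replicate (e' f * e f) a | _ \<Rightarrow> [a])"
    by (simp split: letter.split)
qed

lemma scale_fresh: "\<forall>a\<in>set w. fresh a \<Longrightarrow> \<forall>a\<in>set (scale e w). fresh a"
  by (induction w) (auto simp: scale_def split: letter.splits)

lemma scale_count: "count_list (scale e w) (K b) = count_list w (K b)"
proof (induction w)
  case (Cons a w)
  have "count_list (replicate k (Fam f c)) (K b) = 0" for k f c by (induction k) auto
  then show ?case using Cons by (auto simp: scale_def split: letter.split)
qed (simp add: scale_def)

text \<open>A family takes part in the first \<open>deg f\<close> rounds only, so each amount gets
  its own power.\<close>

definition rounds :: "(fam \<Rightarrow> nat) \<Rightarrow> nat \<Rightarrow> letter instr list" where
  "rounds deg r = hom (\<lambda>r. round {f. r < deg f}) [0..<r]"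

lemma good_rounds: "\<tau> \<in> set (rounds deg r) \<Longrightarrow> \<exists>U A. good U A \<tau>"
  using good_round by (auto simp: rounds_def)

lemma run_program_rounds:
  assumes "\<forall>a\<in>set w. fresh a" "count_list w (K False) = n"
  shows "run_program (rounds deg r) w (scale (\<lambda>f. Suc n ^ min r (deg f)) w)"
proof (induction r)
  case 0
  have "scale (\<lambda>f. 1) w = w" by (induction w) (auto simp: scale_def split: letter.split)
  then show ?case by (simp add: rounds_def)
next
  case (Suc r)
  let ?w = "scale (\<lambda>f. Suc n ^ min r (deg f)) w"
  have "run_program (round {f. r < deg f}) ?w (scale (\<lambda>f. if f \<in> {f. r < deg f} then Suc n else 1) ?w)"
    by (rule run_program_round) (use assms in \<open>auto simp: scale_fresh scale_count\<close>)
  moreover have "Suc n ^ min r (deg f) * (if f \<in> {f. r < deg f} then Suc n else 1) = Suc n ^ min (Suc r) (deg f)" for f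
    by (cases "r < deg f") (simp_all add: min_def)
  ultimately have "run_program (round {f. r < deg f}) ?w (scale (\<lambda>f. Suc n ^ min (Suc r) (deg f)) w)"
    by (simp only: scale_scale)
  from run_program_append[OF Suc this] show ?case by (simp add: rounds_def)
qed

section \<open>Generating the formula\<close>

abbreviation dup :: "bool list \<Rightarrow> bool list" where
  "dup \<equiv> hom (\<lambda>b. [True, b])"

fun nat_of_bits :: "bool list \<Rightarrow> nat" where
  "nat_of_bits [] = 0"
| "nat_of_bits (b # l) = (if b then 1 else 0) + 2 * nat_of_bits l"

declare bits_of.simps [simp del]

lemma nat_of_bits_pos: "nat_of_bits (l @ [True]) > 0"
  by (induction l) auto

text \<open>The least significant bit comes first, so the canonical digit lists are those ending in
  True. This is why the code of a variable must end in a nonempty run of ones.\<close>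

lemma bits_of_nat_of_bits: "bits_of (nat_of_bits (l @ [True])) = l @ [True]"
proof (induction l)
  case Nil
  show ?case by (simp add: bits_of.simps)
next
  case (Cons b l)
  have "nat_of_bits ((b # l) @ [True]) > 0" by (rule nat_of_bits_pos)
  then show ?case using Cons by (simp add: bits_of.simps[of "_ + _"])
qed

text \<open>The cell index is written in unary, so that it can be produced by letting a field grow in every pass.\<close>

definition var :: "nat \<Rightarrow> nat \<Rightarrow> nat" where
  "var i s = nat_of_bits (replicate i True @ False # replicate (Suc s) True)"

lemma bits_of_var: "bits_of (var i s) = replicate i True @ False # replicate (Suc s) True"
  using bits_of_nat_of_bits[of "replicate i True @ False # replicate s True"]
  by (simp add: var_def replicate_append_same)

lemma var_inject [simp]: "var i s = var i' s' \<longleftrightarrow> i = i' \<and> s = s'"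
proof
  assume "var i s = var i' s'"
  then have e: "replicate i True @ False # replicate (Suc s) True = replicate i' True @ False # replicate (Suc s') True"
    by (metis bits_of_var)
  from arg_cong[OF e, of "\<lambda>l. length (takeWhile id l)"] have "i = i'"
    by (simp add: takeWhile_append)
  moreover from arg_cong[OF e, of length] this have "s = s'" by simp
  ultimately show "i = i' \<and> s = s'" by simp
qed simp

lemma map_hom: "map f (hom g xs) = hom (\<lambda>x. map f (g x)) xs"
  by (induction xs) auto

text \<open>A literal template (polarity, far, offset, s): relative to the cell of the current block, or, if far, to its
  successor in time, it speaks about symbol s.
\<close>

type_synonym tlit = "bool \<times> bool \<times> nat \<times> nat"

definition inst :: "nat \<Rightarrow> nat \<Rightarrow> tlit \<Rightarrow> lit" where
  "inst a b = (\<lambda>(pol, far, off, s). (var (off + (if far then b else a)) s, pol))"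

text \<open>This is the code of a literal as a list element with a gap: the field marks the place
  inside the leading run of doubled ones where the block index will grow. Ones written before the
  field thus add the offset to that index.\<close>

definition tlit_word :: "tlit \<Rightarrow> letter list" where
  "tlit_word = (\<lambda>(pol, far, off, s). map Bit [True, pol] @ map Bit (dup (replicate off True)) @
     (if far then Fw else Fi) # map Bit (dup (False # replicate (Suc s) True) @ [False]))"

definition tclause_word :: "tlit list \<Rightarrow> letter list" where
  "tclause_word c = Bit True # hom tlit_word c @ [Bit False]"

definition TT :: "nat \<Rightarrow> letter list" where
  "TT k = map Bit (dup (replicate k True))"

lemma TT_add: "TT j @ TT k = TT (k + j)"
  by (simp add: TT_def replicate_add add.commute[of k])

lemma TT_Suc': "TT k @ Bit True # Bit True # w = TT (Suc k) @ w"
proof -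
  have "TT k @ TT 1 @ w = TT (1 + k) @ w" by (metis TT_add append_assoc)
  then show ?thesis by (simp add: TT_def)
qed

lemma TT_1: "TT (Suc 0) = [Bit True, Bit True]"
  by (simp add: TT_def)

lemma TT_Cons: "Bit True # Bit True # TT k = TT (Suc k)" "Bit True # Bit True # TT k @ w = TT (Suc k) @ w"
  by (simp_all add: TT_def)

text \<open>The net effect of the last three instructions on a letter of a block, with final field
  lengths \<open>a\<close> and \<open>b\<close>.\<close>

definition subst :: "nat \<Rightarrow> nat \<Rightarrow> letter \<Rightarrow> letter list" where
  "subst a b l = (case l of Bit x \<Rightarrow> [Bit x] | Fi \<Rightarrow> TT a | Fw \<Rightarrow> TT b | _ \<Rightarrow> [])"

lemma subst_Bit: "subst a b (Bit x) = [Bit x]"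
  by (simp add: subst_def)

lemma hom_subst_Bit: "hom (subst a b) (map Bit l) = map Bit l"
  by (induction l) (auto simp: subst_def)

lemma subst_tlit: "hom (subst a b) (tlit_word t) = map Bit (True # enc_lit (inst a b t))"
proof -
  obtain pol far off s where t: "t = (pol, far, off, s)" by (metis prod_cases4)
  have "hom (subst a b) (tlit_word t) = map Bit [True, pol] @ map Bit (dup (replicate off True)) @
     subst a b (if far then Fw else Fi) @ map Bit (dup (False # replicate (Suc s) True) @ [False])"
    unfolding tlit_word_def t prod.case by (simp only: map_append concat_append hom_subst_Bit subst_Bit append_Nil2 list.map concat.simps append_Cons append_Nil append_assoc)
  then show ?thesis
    by (simp add: t inst_def enc_lit_def enc_nat_def bits_of_var subst_def TT_def replicate_add)
qed

lemma subst_tclause: "hom (subst a b) (tclause_word c) = map Bit (True # enc_list enc_lit (map (inst a b) c))"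
proof -
  have "hom (subst a b) (hom tlit_word c) = map Bit (hom (\<lambda>t. True # enc_lit (inst a b t)) c)"
    by (induction c) (simp_all add: subst_tlit)
  then show ?thesis by (simp add: tclause_word_def enc_list_def subst_def comp_def)
qed

definition block :: "bool \<Rightarrow> tlit list list \<Rightarrow> letter list" where
  "block first cs = (if first then [MW] else []) @ hom tclause_word cs"

definition is_block :: "letter \<Rightarrow> bool" where
  "is_block a = (case a of Cell _ _ \<Rightarrow> True | Fam f _ \<Rightarrow> f \<noteq> Ka | _ \<Rightarrow> False)"

definition is_first :: "letter \<Rightarrow> bool" where
  "is_first a \<longleftrightarrow> is_block a \<and> a \<notin> range (Fam No)"

text \<open>The \<open>Ka\<close> letters and E do not describe cells: they spell the end of the
  instance, where a doubled digit one is the pair True, True.\<close>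

definition expand :: "(letter \<Rightarrow> tlit list list) \<Rightarrow> letter \<Rightarrow> letter list" where
  "expand cls a = (if is_block a then MI # block (is_first a) (cls a)
     else case a of Fam _ _ \<Rightarrow> [Bit True, Bit True] | E \<Rightarrow> [Bit False] | K _ \<Rightarrow> [] | _ \<Rightarrow> [a])"

definition incW :: "letter \<Rightarrow> letter list" where
  "incW a = (case a of Fw \<Rightarrow> [Bit True, Bit True, Fw] | _ \<Rightarrow> [a])"

definition incI :: "letter \<Rightarrow> letter list" where
  "incI a = (case a of Fw \<Rightarrow> [Bit True, Bit True, Fw] | Fi \<Rightarrow> [Bit True, Bit True, Fi] | _ \<Rightarrow> [a])"

definition keep_bits :: "letter \<Rightarrow> letter list" where
  "keep_bits a = (case a of Bit b \<Rightarrow> [Bit b] | _ \<Rightarrow> [])"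

definition prog :: "(letter \<Rightarrow> tlit list list) \<Rightarrow> nat \<Rightarrow> (fam \<Rightarrow> nat) \<Rightarrow> nat \<Rightarrow> letter instr list" where
  "prog cls C deg r = front C # rounds deg r @
     [hom_instr (expand cls), consume MW D incW, ladder MI incI, hom_instr keep_bits]"

lemma tlit_word_letters: "set (tlit_word t) \<subseteq> range Bit \<union> {MW, Fi, Fw}"
proof -
  obtain pol far off s where t: "t = (pol, far, off, s)" by (metis prod_cases4)
  have B: "set (map Bit l) \<subseteq> range Bit \<union> {MW, Fi, Fw}" for l by auto
  show ?thesis
    by (simp only: t tlit_word_def prod.case set_append list.set(2) Un_subset_iff insert_subset B) simp
qed

lemma block_letters: "set (block b cs) \<subseteq> range Bit \<union> {MW, Fi, Fw}"
proof -
  have 1: "set (hom tlit_word c) \<subseteq> range Bit \<union> {MW, Fi, Fw}" for c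
    unfolding set_concat set_map using tlit_word_letters by blast
  have "set (tclause_word c) \<subseteq> range Bit \<union> {MW, Fi, Fw}" for c
    using 1[of c] unfolding tclause_word_def by (simp add: rangeI)
  then have "set (hom tclause_word cs) \<subseteq> range Bit \<union> {MW, Fi, Fw}"
    unfolding set_concat set_map by blast
  then show ?thesis by (cases b) (simp_all add: block_def)
qed

lemma good_prog:
  assumes "\<tau> \<in> set (prog cls C deg r)"
  shows "\<exists>U A. good U A \<tau>"
proof -
  have 1: "good (\<lambda>_. False) (\<lambda>a. is_block a \<or> (\<exists>f b. a = Fam f b)) (hom_instr (expand cls))"
  proof (rule good_hom_instr)
    fix a
    show "length (expand cls a) \<le> 1" if "\<not> (is_block a \<or> (\<exists>f b. a = Fam f b))"
      using that by (auto simp: expand_def split: letter.split)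
    have "filter (\<lambda>a. is_block a \<or> (\<exists>f b. a = Fam f b)) (block b cs) = []" for b cs
      using block_letters[of b cs] by (auto simp: filter_empty_conv is_block_def)
    then have "filter (\<lambda>a. is_block a \<or> (\<exists>f b. a = Fam f b)) (expand cls a) = []" if "is_block a \<or> (\<exists>f b. a = Fam f b)"
      using that by (auto simp: expand_def is_block_def[of MI] is_block_def[of "Bit _"] split: letter.splits)
    moreover have "filter (\<lambda>a. is_block a \<or> (\<exists>f b. a = Fam f b)) (expand cls a) = []" if "\<not> (is_block a \<or> (\<exists>f b. a = Fam f b))"
      using that by (auto simp: expand_def is_block_def split: letter.splits)
    ultimately have "filter (\<lambda>a. is_block a \<or> (\<exists>f b. a = Fam f b)) (expand cls a) = []" by blast
    then show "cnt (\<lambda>a. is_block a \<or> (\<exists>f b. a = Fam f b)) (expand cls a) \<le> (if is_block a \<or> (\<exists>f b. a = Fam f b) then 1 else 0)"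
      by simp
  qed
  \<comment> \<open>Only fields lengthen the word, and the image of a field contains just one field,
    so growth is additive per pass.\<close>
  have 2: "good (\<lambda>a. a = MW) (\<lambda>a. a = Fw) (consume MW D incW)"
    by (rule good_consume) (auto simp: incW_def split: letter.splits)
  have 3: "good (\<lambda>a. a = MI) (\<lambda>a. a = Fw \<or> a = Fi) (ladder MI incI)"
    by (rule good_ladder) (auto simp: incI_def split: letter.splits)
  have 4: "good (\<lambda>_. False) (\<lambda>_. False) (hom_instr keep_bits)"
    by (rule good_hom_instr) (auto simp: keep_bits_def split: letter.splits)
  from assms show ?thesis
    using good_front[of C] good_rounds[of \<tau> deg r] 1 2 3 4 by (auto simp: prog_def)
qed

text \<open>There is one MW per cell of the first row, so \<open>consume\<close> makes R + 1 passes
  and puts R + 1 ones before every Fw; \<open>ladder\<close> then adds j + 1 ones to both fields of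
  block j. The two surplus ones are compensated by the offsets in the clause templates.\<close>

lemma expand_blocks:
  assumes tys: "\<forall>a\<in>set tys. is_block a"
    and R: "R = length (filter is_first tys)"
  shows "\<exists>w. run_program [consume MW D incW, ladder MI incI, hom_instr keep_bits]
      (hom (expand cls) tys @ map Bit z) w \<and>
    w = map Bit (hom (\<lambda>j. hom (\<lambda>c. True # enc_list enc_lit (map (inst (Suc j) (Suc j + Suc R)) c)) (cls (tys ! j))) [0..<length tys] @ z)"
proof -
  let ?w = "hom (expand cls) tys @ map Bit z"
  let ?tail = "map Bit z :: letter list"
  define gW where "gW = (\<lambda>k a. case a of Fw \<Rightarrow> TT k @ [Fw] | _ \<Rightarrow> [a])"
  define gI where "gI = (\<lambda>k a. case a of Fw \<Rightarrow> TT k @ [Fw] | Fi \<Rightarrow> TT k @ [Fi] | _ \<Rightarrow> [a])"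
  let ?GW = "\<lambda>a. if a = MW then [D] else gW (Suc R) a"
  have cb: "count_list (block b cs) MW = (if b then 1 else 0)" for b cs
  proof -
    have MW: "MW \<notin> set (tlit_word t)" for t
      by (cases t) (auto simp: tlit_word_def)
    have "MW \<notin> set (hom tclause_word cs)"
      using MW by (simp add: tclause_word_def)
    then show ?thesis by (simp add: block_def)
  qed
  have "count_list (hom (expand cls) tys) MW = length (filter is_first tys)"
    using tys by (induction tys) (auto simp: expand_def cb)
  moreover have "MW \<notin> set ?tail" by auto
  ultimately have cR: "count_list ?w MW = R" using R by simp
  have "loop (consume MW D incW) ?w (hom ?GW ?w)"
    unfolding cR[symmetric]
    by (rule loop_consume) (auto simp: incW_def gW_def TT_Suc' TT_1 TT_Cons split: letter.splits)
  moreover have "hom ?GW ?w = hom (\<lambda>s. MI # s) (map (\<lambda>a. hom ?GW (block (is_first a) (cls a))) tys) @ ?tail"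
  proof -
    have "hom ?GW ?tail = ?tail" by (induction z) (auto simp: gW_def)
    moreover have "hom ?GW (hom (expand cls) tys) = hom (\<lambda>s. MI # s) (map (\<lambda>a. hom ?GW (block (is_first a) (cls a))) tys)"
      unfolding hom_hom map_map
      by (rule hom_cong) (use tys in \<open>auto simp: expand_def gW_def\<close>)
    ultimately show ?thesis by simp
  qed
  moreover define segs where "segs = map (\<lambda>a. hom ?GW (block (is_first a) (cls a))) tys"
  ultimately have 1: "loop (consume MW D incW) ?w (hom (\<lambda>s. MI # s) segs @ ?tail)" by simp
  have segs: "\<forall>s\<in>set segs. MI \<notin> set s"
  proof -
    have "MI \<notin> set (hom ?GW (block b cs))" for b cs
    proof -
      have "MI \<notin> set (?GW a)" if "a \<in> range Bit \<union> {MW, Fi, Fw}" for a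
        using that by (auto simp: gW_def TT_def)
      then show ?thesis using block_letters[of b cs] unfolding set_concat set_map by blast
    qed
    then show ?thesis unfolding segs_def by auto
  qed
  have tail: "hom incI ?tail = ?tail" by (induction z) (auto simp: incI_def)
  have 2: "loop (ladder MI incI) ([] @ hom (\<lambda>s. MI # s) segs @ ?tail) ([] @ hom (\<lambda>j. hom (gI (Suc j)) (segs ! j)) [0..<length segs] @ ?tail)"
  proof (rule loop_ladder)
    show "hom incI ?tail = ?tail" by (rule tail)
    show "\<forall>s\<in>set segs. MI \<notin> set s" by (rule segs)
  qed (auto simp: incI_def gI_def TT_Suc' TT_1 TT_Cons split: letter.splits)
  have 3: "loop (hom_instr keep_bits) (hom (\<lambda>j. hom (gI (Suc j)) (segs ! j)) [0..<length segs] @ ?tail)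
     (hom keep_bits (hom (\<lambda>j. hom (gI (Suc j)) (segs ! j)) [0..<length segs] @ ?tail))"
    by (rule loop_hom_instr)
  have kb: "hom keep_bits (map Bit l) = map Bit l" for l by (induction l) (auto simp: keep_bits_def)
  have gb: "hom (gI k) (map Bit l) = map Bit l" for k l by (induction l) (auto simp: gI_def)
  \<comment> \<open>A block contains only these letters, so the whole computation on blocks reduces
    to four cases.\<close>
  have letter: "hom keep_bits (hom (gI k) (?GW a)) = subst k (k + Suc R) a" if "a \<in> range Bit \<union> {MW, Fi, Fw}" for a k
  proof -
    have kb: "hom keep_bits (TT i) = TT i" for i unfolding TT_def by (rule kb)
    have gb: "hom (gI k) (TT i) = TT i" for i unfolding TT_def by (rule gb)
    have gg: "gI k Fi = TT k @ [Fi]" "gI k Fw = TT k @ [Fw]" "gI k (Bit x) = [Bit x]" "gI k D = [D]"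
        "gW i Fi = [Fi]" "gW i Fw = TT i @ [Fw]" "gW i (Bit x) = [Bit x]"
        "keep_bits Fi = []" "keep_bits Fw = []" "keep_bits (Bit x) = [Bit x]" "keep_bits D = []"
        "subst k i Fi = TT k" "subst k i Fw = TT i" "subst k i (Bit x) = [Bit x]" "subst k i MW = []" for i x
      by (simp_all add: gI_def gW_def keep_bits_def subst_def)
    from that consider x where "a = Bit x" | "a = MW" | "a = Fi" | "a = Fw" by auto
    then show ?thesis
      by cases (simp_all add: gg kb gb TT_add)
  qed
  have body: "hom keep_bits (hom (gI k) (hom ?GW (block b cs)))
     = map Bit (hom (\<lambda>c. True # enc_list enc_lit (map (inst k (k + Suc R)) c)) cs)" for k b cs
  proof -
    have "hom keep_bits (hom (gI k) (hom ?GW (block b cs))) = hom (subst k (k + Suc R)) (block b cs)"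
      unfolding hom_hom by (rule hom_cong) (use block_letters[of b cs] letter[unfolded hom_hom] in blast)
    also have "\<dots> = hom (subst k (k + Suc R)) (hom tclause_word cs)"
      by (simp add: block_def subst_def)
    also have "\<dots> = map Bit (hom (\<lambda>c. True # enc_list enc_lit (map (inst k (k + Suc R)) c)) cs)"
      by (induction cs) (simp_all add: subst_tclause)
    finally show ?thesis .
  qed
  have "hom keep_bits (hom (\<lambda>j. hom (gI (Suc j)) (segs ! j)) [0..<length segs])
     = hom (\<lambda>j. hom keep_bits (hom (gI (Suc j)) (segs ! j))) [0..<length segs]"
    by (simp add: hom_hom)
  also have "\<dots> = hom (\<lambda>j. map Bit (hom (\<lambda>c. True # enc_list enc_lit (map (inst (Suc j) (Suc j + Suc R)) c)) (cls (tys ! j)))) [0..<length tys]"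
    unfolding segs_def length_map
    by (rule hom_cong) (simp add: body del: add_Suc_right add_Suc)
  also have "\<dots> = map Bit (hom (\<lambda>j. hom (\<lambda>c. True # enc_list enc_lit (map (inst (Suc j) (Suc j + Suc R)) c)) (cls (tys ! j))) [0..<length tys])"
    by (rule map_hom[symmetric])
  finally have "hom keep_bits (hom (\<lambda>j. hom (gI (Suc j)) (segs ! j)) [0..<length segs] @ ?tail)
     = map Bit (hom (\<lambda>j. hom (\<lambda>c. True # enc_list enc_lit (map (inst (Suc j) (Suc j + Suc R)) c)) (cls (tys ! j))) [0..<length tys] @ z)"
    using kb[of z] by (simp only: map_append concat_append)
  with 1 2 3 have "loop (consume MW D incW) ?w (hom (\<lambda>s. MI # s) segs @ ?tail)"
    "loop (ladder MI incI) (hom (\<lambda>s. MI # s) segs @ ?tail) (hom (\<lambda>j. hom (gI (Suc j)) (segs ! j)) [0..<length segs] @ ?tail)"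
    "loop (hom_instr keep_bits) (hom (\<lambda>j. hom (gI (Suc j)) (segs ! j)) [0..<length segs] @ ?tail)
      (map Bit (hom (\<lambda>j. hom (\<lambda>c. True # enc_list enc_lit (map (inst (Suc j) (Suc j + Suc R)) c)) (cls (tys ! j))) [0..<length tys] @ z))"
    by (simp_all only: append_Nil)
  then show ?thesis unfolding run_program.simps by blast
qed

section \<open>The complete program and the instance that it writes\<close>

definition tail_word :: "(fam \<Rightarrow> nat) \<Rightarrow> letter list" where
  "tail_word C = replicate (C Gu) (Fam Gu True) @ replicate (C Bl) (Fam Bl True) @ replicate (C No) (Fam No True) @
     [E, E] @ replicate (C Ka) (Fam Ka True) @ [E]"

definition amount :: "(fam \<Rightarrow> nat) \<Rightarrow> (fam \<Rightarrow> nat) \<Rightarrow> nat \<Rightarrow> fam \<Rightarrow> nat" where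
  "amount C deg n f = C f * Suc n ^ deg f"

text \<open>The first row is the tape with \<open>enc_pair x y\<close> for a guessed y between two
  blank margins; \<open>No\<close> cells provide the later rows.\<close>

definition skeleton :: "(fam \<Rightarrow> nat) \<Rightarrow> bool list \<Rightarrow> letter list" where
  "skeleton e x = replicate (e Bl) (Fam Bl True) @ filter is_block (xcells x) @ replicate (e Gu) (Fam Gu True) @
     replicate (e Bl) (Fam Bl True) @ replicate (e No) (Fam No True)"

definition formula :: "(letter \<Rightarrow> tlit list list) \<Rightarrow> letter list \<Rightarrow> lit list list" where
  "formula cls tys = (let R = length (filter is_first tys) in
     hom (\<lambda>j. map (map (inst (Suc j) (Suc j + Suc R))) (cls (tys ! j))) [0..<length tys])"

lemma scale_append: "scale e (u @ v) = scale e u @ scale e v"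
  by (simp add: scale_def)

lemma scale_replicate: "scale e (replicate k (Fam f b)) = replicate (k * e f) (Fam f b)"
  by (induction k) (auto simp: scale_def replicate_add)

lemma scale_no_fam: "\<forall>f b. Fam f b \<notin> set w \<Longrightarrow> scale e w = w"
  by (induction w) (auto simp: scale_def split: letter.split)

lemma xcells_letters: "set (xcells x) \<subseteq> {a. \<exists>h b. a = Cell h b} \<union> {K False}"
  by (cases x) (auto simp: xcells_def)

lemma xcells_count: "count_list (xcells x) (K False) = length x"
proof -
  have "count_list (hom (\<lambda>b. [Cell False True, Cell False b, K False]) x) (K False) = length x" for x
    by (induction x) auto
  then show ?thesis by (cases x) (simp_all add: xcells_def)
qed

lemma count_list_replicate_Fam: "count_list (replicate k (Fam f b)) (K c) = 0"
  by (induction k) auto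

lemma enc_list_hom: "hom (\<lambda>c. True # e c) cs @ [False] = enc_list e cs"
  by (simp add: enc_list_def)

lemma run_program_prog:
  assumes deg: "\<And>f. deg f \<le> r" and Ka: "C Ka > 0"
  shows "run_program (prog cls (C Bl) deg r) (map Bit x @ Z # tail_word C)
    (map Bit (enc_instance (formula cls (skeleton (amount C deg (length x)) x))
       (int (nat_of_bits (replicate (amount C deg (length x) Ka) True)))))"
proof -
  define e where "e = amount C deg (length x)"
  define tys where "tys = skeleton e x"
  let ?w0 = "replicate (C Bl) (Fam Bl True) @ xcells x @ tail_word C"
  have "\<forall>a\<in>set (tail_word C). \<not> raw a" by (auto simp: tail_word_def raw_def)
  then have 1: "loop (front (C Bl)) (map Bit x @ Z # tail_word C) ?w0" by (rule loop_front)
  have "\<forall>a\<in>set ?w0. fresh a"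
    using xcells_letters[of x] by (auto simp: tail_word_def fresh_def)
  moreover have "count_list ?w0 (K False) = length x"
    by (simp add: tail_word_def count_list_replicate_Fam xcells_count)
  moreover have "min r (deg f) = deg f" for f using deg[of f] by simp
  ultimately have 2: "run_program (rounds deg r) ?w0 (scale (\<lambda>f. Suc (length x) ^ deg f) ?w0)"
    using run_program_rounds[of ?w0 "length x" deg r] by (simp only:)
  let ?t = "[E, E] @ replicate (e Ka) (Fam Ka True) @ [E]"
  let ?w1 = "replicate (e Bl) (Fam Bl True) @ xcells x @ replicate (e Gu) (Fam Gu True) @
     replicate (e Bl) (Fam Bl True) @ replicate (e No) (Fam No True) @ ?t"
  have "scale (\<lambda>f. Suc (length x) ^ deg f) (xcells x) = xcells x"
    using xcells_letters[of x] by (intro scale_no_fam) auto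
  moreover have "scale s [E, E] = [E, E]" "scale s [E] = [E]" for s by (simp_all add: scale_def)
  ultimately have w1: "scale (\<lambda>f. Suc (length x) ^ deg f) ?w0 = ?w1"
    by (simp only: tail_word_def scale_append scale_replicate e_def amount_def append_assoc)
  \<comment> \<open>The two leading bits are the end of the clause list and the nonnegative sign of
    the size bound; the last bit ends its digits.\<close>
  let ?z = "[False, False] @ dup (replicate (e Ka) True) @ [False]"
  have K: "hom (expand cls) (xcells x) = hom (expand cls) (filter is_block (xcells x))"
  proof -
    have "hom (expand cls) w = hom (expand cls) (filter is_block w)" if "set w \<subseteq> {a. \<exists>h b. a = Cell h b} \<union> {K False}" for w
      using that by (induction w) (auto simp: expand_def is_block_def)
    then show ?thesis using xcells_letters[of x] by blast
  qed
  have t: "hom (expand cls) ?t = map Bit ?z"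
    by (simp add: expand_def is_block_def map_concat)
  have w2: "hom (expand cls) ?w1 = hom (expand cls) tys @ map Bit ?z"
    unfolding map_append concat_append K t[unfolded map_append concat_append] tys_def skeleton_def by (simp only: append_assoc)
  have 3: "loop (hom_instr (expand cls)) ?w1 (hom (expand cls) tys @ map Bit ?z)"
    using loop_hom_instr[of "expand cls" ?w1] unfolding w2 .
  have tb: "\<forall>a\<in>set tys. is_block a" by (auto simp: tys_def skeleton_def is_block_def)
  let ?R = "length (filter is_first tys)"
  let ?out = "hom (\<lambda>j. hom (\<lambda>c. True # enc_list enc_lit (map (inst (Suc j) (Suc j + Suc ?R)) c)) (cls (tys ! j))) [0..<length tys] @ ?z"
  have 4: "run_program [consume MW D incW, ladder MI incI, hom_instr keep_bits] (hom (expand cls) tys @ map Bit ?z) (map Bit ?out)"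
    using expand_blocks[OF tb refl, of cls ?z] by auto
  have out: "?out = enc_instance (formula cls tys) (int (nat_of_bits (replicate (e Ka) True)))"
  proof -
    have "e Ka > 0" using Ka by (simp add: e_def amount_def)
    then have "replicate (e Ka) True = replicate (e Ka - 1) True @ [True]"
      by (metis Suc_pred' replicate_Suc replicate_append_same)
    then have "bits_of (nat_of_bits (replicate (e Ka) True)) = replicate (e Ka) True"
      by (metis bits_of_nat_of_bits)
    then have k: "enc_int (int (nat_of_bits (replicate (e Ka) True))) = False # dup (replicate (e Ka) True) @ [False]"
      by (simp add: enc_int_def enc_nat_def)
    have F: "hom (\<lambda>j. hom (\<lambda>c. True # enc_list enc_lit (map (inst (Suc j) (Suc j + Suc ?R)) c)) (cls (tys ! j))) [0..<length tys]
      = hom (\<lambda>c. True # enc_list enc_lit c) (formula cls tys)"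
      unfolding formula_def Let_def hom_hom by (simp add: comp_def del: add_Suc_right)
    have "enc_list (enc_list enc_lit) (formula cls tys) = hom (\<lambda>c. True # enc_list enc_lit c) (formula cls tys) @ [False]"
      by (rule enc_list_hom[symmetric])
    then show ?thesis unfolding F enc_instance_def k by simp
  qed
  have "run_program (rounds deg r @ [hom_instr (expand cls), consume MW D incW, ladder MI incI, hom_instr keep_bits]) ?w0 (map Bit ?out)"
    by (rule run_program_append[OF 2[unfolded w1]]) (use 3 4 in \<open>auto simp only: run_program.simps\<close>)
  then have "run_program (prog cls (C Bl) deg r) (map Bit x @ Z # tail_word C) (map Bit ?out)"
    using 1 unfolding prog_def run_program.simps by blast
  then show ?thesis unfolding out unfolding tys_def e_def .
qed

theorem poly_time_formula:
  assumes "C Ka > 0"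
  shows "poly_time_computable (\<lambda>x. enc_instance (formula cls (skeleton (amount C deg (length x)) x))
       (int (nat_of_bits (replicate (amount C deg (length x) Ka) True))))"
proof -
  let ?r = "deg Bl + deg Gu + deg No + deg Ka"
  have d: "deg f \<le> ?r" for f by (cases f) auto
  have "run_program (prog cls (C Bl) deg ?r) (map Bit x @ Z # tail_word C)
    (map Bit (enc_instance (formula cls (skeleton (amount C deg (length x)) x))
       (int (nat_of_bits (replicate (amount C deg (length x) Ka) True)))))" for x
    by (rule run_program_prog) (use d assms in auto)
  then show ?thesis
    by (intro poly_time_computable_program[where bit = Bit and P = "prog cls (C Bl) deg ?r" and tail_word = "Z # tail_word C"])
      (auto simp: inj_def good_prog, auto simp: prog_def)
qed

section \<open>Encodings and regular resolution\<close>

definition prefix_free :: "('a \<Rightarrow> bool list) \<Rightarrow> bool" where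
  "prefix_free e \<longleftrightarrow> (\<forall>x y r s. e x @ r = e y @ s \<longrightarrow> x = y \<and> r = s)"

lemma nat_of_bits_bits_of: "nat_of_bits (bits_of n) = n"
proof (induction n rule: less_induct)
  case (less n)
  show ?case
  proof (cases "n = 0")
    case False
    then have "nat_of_bits (bits_of (n div 2)) = n div 2" by (intro less.IH) simp
    then show ?thesis using False by (simp add: bits_of.simps[of n]) presburger
  qed (simp add: bits_of.simps)
qed

lemma dup_prefix_free: "dup l @ False # r = dup l' @ False # s \<Longrightarrow> l = l' \<and> r = s"
proof (induction l arbitrary: l')
  case Nil
  then show ?case by (cases l') auto
next
  case (Cons b l)
  then show ?case by (cases l') auto
qed

lemma prefix_free_enc_nat: "prefix_free enc_nat"
  unfolding prefix_free_def enc_nat_def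
  using dup_prefix_free nat_of_bits_bits_of by (metis append.simps(1,2) append_assoc)

lemma prefix_free_enc_list:
  assumes "prefix_free e"
  shows "prefix_free (enc_list e)"
proof -
  have "enc_list e xs @ r = enc_list e ys @ s \<Longrightarrow> xs = ys \<and> r = s" for xs ys r s
  proof (induction xs arbitrary: ys)
    case Nil
    then show ?case by (cases ys) (auto simp: enc_list_def)
  next
    case (Cons x xs)
    then obtain y ys' where y: "ys = y # ys'" by (cases ys) (auto simp: enc_list_def)
    have "e x @ (enc_list e xs @ r) = e y @ (enc_list e ys' @ s)"
      using Cons.prems by (simp add: y enc_list_def)
    then have "x = y" "enc_list e xs @ r = enc_list e ys' @ s"
      using assms unfolding prefix_free_def by blast+
    then show ?case using Cons.IH y by simp
  qed
  then show ?thesis unfolding prefix_free_def by blast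
qed

lemma prefix_free_enc_lit: "prefix_free enc_lit"
  unfolding prefix_free_def
proof (intro allI impI)
  fix x y :: lit and r s
  assume "enc_lit x @ r = enc_lit y @ s"
  then have "snd x = snd y" "enc_nat (fst x) @ r = enc_nat (fst y) @ s" by (simp_all add: enc_lit_def)
  moreover then have "fst x = fst y" "r = s" using prefix_free_enc_nat unfolding prefix_free_def by blast+
  ultimately show "x = y \<and> r = s" by (simp add: prod_eq_iff)
qed

text \<open>\<open>REG_RES_SIZE\<close> asks for some decoding of a word; injectivity ensures that
  this is the formula and the bound that were encoded.\<close>

lemma enc_instance_inject:
  assumes "enc_instance cs k = enc_instance cs' k'"
  shows "cs = cs' \<and> k = k'"
proof -
  have "prefix_free (enc_list (enc_list enc_lit))"
    by (intro prefix_free_enc_list prefix_free_enc_lit)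
  then have cs: "cs = cs'" and k: "enc_int k = enc_int k'"
    using assms unfolding prefix_free_def enc_instance_def by blast+
  from k have s: "(k < 0) = (k' < 0)" and "enc_nat (nat \<bar>k\<bar>) @ [] = enc_nat (nat \<bar>k'\<bar>) @ []"
    by (simp_all add: enc_int_def)
  then have "nat \<bar>k\<bar> = nat \<bar>k'\<bar>" using prefix_free_enc_nat unfolding prefix_free_def by blast
  with s cs show ?thesis by auto
qed

section \<open>Soundness of resolution\<close>

definition falsified :: "(nat \<Rightarrow> bool) \<Rightarrow> clause \<Rightarrow> bool" where
  "falsified \<sigma> C \<longleftrightarrow> (\<forall>(x, b)\<in>C. \<sigma> x \<noteq> b)"

lemma not_falsified_iff: "\<not> falsified \<sigma> C \<longleftrightarrow> (\<exists>l\<in>C. \<sigma> (fst l) = snd l)"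
  by (auto simp: falsified_def split_beta)

definition satisfiable :: "cnf \<Rightarrow> bool" where
  "satisfiable F \<longleftrightarrow> (\<exists>\<sigma>. \<forall>C\<in>F. \<not> falsified \<sigma> C)"

definition node_ok :: "cnf \<Rightarrow> (nat \<Rightarrow> clause) \<Rightarrow> (nat \<Rightarrow> (nat \<times> nat \<times> nat) option) \<Rightarrow> nat \<Rightarrow> bool" where
  "node_ok F lab par i = (case par i of
           None \<Rightarrow> lab i \<in> F
         | Some (j, k, x) \<Rightarrow> j < i \<and> k < i \<and> j \<noteq> k
              \<and> (x, True) \<in> lab j \<and> (x, False) \<in> lab k
              \<and> lab i = (lab j - {(x, True)}) \<union> (lab k - {(x, False)}))"

lemma resolution_sound:
  assumes "resolution_proof F P"
  shows "\<not> satisfiable F"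
proof
  assume "satisfiable F"
  then obtain \<sigma> where \<sigma>: "\<And>C. C \<in> F \<Longrightarrow> \<not> falsified \<sigma> C" by (auto simp: satisfiable_def)
  obtain m lab par where P: "P = (m, lab, par)" by (metis prod_cases3)
  have ok: "0 < m" "\<And>i. i < m \<Longrightarrow> node_ok F lab par i" "lab (m - 1) = {}"
    using assms by (auto simp: P resolution_proof_def node_ok_def)
  have "i < m \<Longrightarrow> \<not> falsified \<sigma> (lab i)" for i
  proof (induction i rule: less_induct)
    case (less i)
    show ?case
    proof (cases "par i")
      case None
      then show ?thesis using ok(2)[OF less.prems] \<sigma> by (simp add: node_ok_def)
    next
      case (Some t)
      obtain j k x where t: "t = (j, k, x)" by (metis prod_cases3)
      have n: "j < i" "k < i" "lab i = (lab j - {(x, True)}) \<union> (lab k - {(x, False)})"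
        using ok(2)[OF less.prems] by (auto simp: node_ok_def Some t)
      have "\<not> falsified \<sigma> (lab j)" "\<not> falsified \<sigma> (lab k)"
        using less n by simp_all
      then obtain l1 l2 where l: "l1 \<in> lab j" "\<sigma> (fst l1) = snd l1" "l2 \<in> lab k" "\<sigma> (fst l2) = snd l2"
        unfolding not_falsified_iff by blast
      have "l1 \<noteq> (x, True) \<or> l2 \<noteq> (x, False)" using l(2,4) by auto
      then show ?thesis unfolding n(3) not_falsified_iff using l by blast
    qed
  qed
  from this[of "m - 1"] ok(1,3) show False by (simp add: falsified_def)
qed

section \<open>Regular refutations from decision trees\<close>

definition derivation :: "cnf \<Rightarrow> nat set \<Rightarrow> nat \<Rightarrow> (nat \<Rightarrow> clause) \<Rightarrow> (nat \<Rightarrow> (nat \<times> nat \<times> nat) option) \<Rightarrow> bool" where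
  "derivation F V m lab par \<longleftrightarrow> 0 < m \<and> (\<forall>i<m. node_ok F lab par i) \<and>
     (\<forall>i<m. \<forall>j k x. par i = Some (j, k, x) \<longrightarrow> x \<in> V) \<and>
     (\<forall>i<m. (m - 1, i) \<in> (dag_edges (m, lab, par))\<^sup>*) \<and>
     (\<forall>i<m. \<forall>j<m. \<forall>j1 k1 x1 j2 k2 x2. (i, j) \<in> (dag_edges (m, lab, par))\<^sup>+ \<longrightarrow>
        par i = Some (j1, k1, x1) \<longrightarrow> par j = Some (j2, k2, x2) \<longrightarrow> x1 \<noteq> x2)"

lemma derivation_mono: "derivation F V m lab par \<Longrightarrow> V \<subseteq> V' \<Longrightarrow> derivation F V' m lab par"
  unfolding derivation_def
  by (elim conjE, intro conjI; (assumption | (intro allI impI, rule subsetD, assumption, blast)))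

lemma edges_decrease:
  assumes "\<forall>i<m. node_ok F lab par i" "(i, j) \<in> dag_edges (m, lab, par)"
  shows "j < i" "i < m"
proof -
  obtain j' k x where i: "i < m" "par i = Some (j', k, x)" and j: "j = j' \<or> j = k"
    using assms(2) by (auto simp: dag_edges_def)
  have "node_ok F lab par i" using assms(1) i(1) by blast
  then have "j' < i" "k < i" by (simp_all add: node_ok_def i(2))
  then show "j < i" "i < m" using i(1) j by blast+
qed

lemma split_index: "i < m1 + m2 + 1 \<Longrightarrow> i < m1 \<or> (m1 \<le> i \<and> i < m1 + m2) \<or> i = m1 + (m2 :: nat)"
  by linarith

text \<open>The two derivations become disjoint parts, the second shifted by \<open>m1\<close>,
  below a new root \<open>m1 + m2\<close>. No edge joins the parts, so a path that leaves the root
  stays in one of them, where regularity is inherited; the root itself resolves on a variable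
  outside \<open>V\<close>.\<close>

lemma derivation_join:
  assumes d1: "derivation F V m1 lab1 par1" and d2: "derivation F V m2 lab2 par2" and x: "x \<notin> V"
    and x1: "(x, True) \<in> lab1 (m1 - 1)" and x2: "(x, False) \<in> lab2 (m2 - 1)"
  shows "\<exists>lab par. derivation F (insert x V) (m1 + m2 + 1) lab par \<and>
     lab (m1 + m2) = (lab1 (m1 - 1) - {(x, True)}) \<union> (lab2 (m2 - 1) - {(x, False)})"
proof -
  define C where "C = (lab1 (m1 - 1) - {(x, True)}) \<union> (lab2 (m2 - 1) - {(x, False)})"
  define lab where "lab = (\<lambda>i. if i < m1 then lab1 i else if i < m1 + m2 then lab2 (i - m1) else C)"
  define par where "par = (\<lambda>i. if i < m1 then par1 i else if i < m1 + m2
      then map_option (\<lambda>(j, k, y). (j + m1, k + m1, y)) (par2 (i - m1)) else Some (m1 - 1, m1 + m2 - 1, x))"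
  let ?m = "m1 + m2 + 1"
  let ?E1 = "dag_edges (m1, lab1, par1)" and ?E2 = "dag_edges (m2, lab2, par2)" and ?E = "dag_edges (?m, lab, par)"
  note D1 = d1[unfolded derivation_def] and D2 = d2[unfolded derivation_def]
  note V1 = D1[THEN conjunct2, THEN conjunct2, THEN conjunct1, rule_format]
    and V2 = D2[THEN conjunct2, THEN conjunct2, THEN conjunct1, rule_format]
    and R1 = D1[THEN conjunct2, THEN conjunct2, THEN conjunct2, THEN conjunct2, rule_format]
    and R2 = D2[THEN conjunct2, THEN conjunct2, THEN conjunct2, THEN conjunct2, rule_format]
  have m: "0 < m1" "0 < m2" using D1 D2 by auto
  have ok1: "\<forall>i<m1. node_ok F lab1 par1 i" and ok2: "\<forall>i<m2. node_ok F lab2 par2 i" using D1 D2 by auto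
  have ok: "node_ok F lab par i" if im: "i < ?m" for i
  proof -
    consider "i < m1" | "m1 \<le> i" "i < m1 + m2" | "i = m1 + m2"
      using split_index[OF im] by blast
    then show ?thesis
    proof cases
      case 1
      then have n: "node_ok F lab1 par1 i" using ok1 by blast
      show ?thesis
      proof (cases "par1 i")
        case None
        then show ?thesis using n 1 by (simp add: node_ok_def lab_def par_def)
      next
        case (Some t)
        obtain j k y where t: "t = (j, k, y)" by (metis prod_cases3)
        have "j < i" "k < i" using n by (simp_all add: node_ok_def Some t)
        moreover then have "j < m1" "k < m1" using 1 by linarith+
        ultimately show ?thesis using n 1 by (simp add: node_ok_def lab_def par_def Some t)
      qed
    next
      case 2
      then have i2: "i - m1 < m2" "\<not> i < m1" by linarith+
      then have n: "node_ok F lab2 par2 (i - m1)" using ok2 by blast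
      show ?thesis
      proof (cases "par2 (i - m1)")
        case None
        then show ?thesis using n 2 by (simp add: node_ok_def lab_def par_def)
      next
        case (Some t)
        obtain j k y where t: "t = (j, k, y)" by (metis prod_cases3)
        have "j < i - m1" "k < i - m1" using n by (simp_all add: node_ok_def Some t)
        moreover then have "j + m1 < i" "k + m1 < i" "j + m1 < m1 + m2" "k + m1 < m1 + m2" using 2 by linarith+
        ultimately show ?thesis using n 2 i2 by (simp add: node_ok_def lab_def par_def Some t)
      qed
    next
      case 3
      have "m1 - 1 < m1" "\<not> m1 + m2 - 1 < m1" "m1 + m2 - 1 < m1 + m2" "m1 + m2 - 1 - m1 = m2 - 1" using m by linarith+
      then show ?thesis using m x1 x2 3 by (auto simp: node_ok_def lab_def par_def C_def)
    qed
  qed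
  have E1: "(i, j) \<in> ?E \<longleftrightarrow> (i, j) \<in> ?E1" if "i < m1" for i j
    using that by (auto simp: dag_edges_def par_def)
  have E2: "(i + m1, j) \<in> ?E \<longleftrightarrow> (\<exists>j'. j = j' + m1 \<and> (i, j') \<in> ?E2)" if "i < m2" for i j
    using that by (auto simp: dag_edges_def par_def)
  have E3: "(m1 + m2, m1 - 1) \<in> ?E" "(m1 + m2, m1 + m2 - 1) \<in> ?E"
    by (auto simp: dag_edges_def par_def)
  have star1: "(i, j) \<in> ?E\<^sup>*" if "(i, j) \<in> ?E1\<^sup>*" for i j
  proof -
    have "?E1 \<subseteq> ?E" using E1 edges_decrease(2)[OF ok1] by auto
    then show ?thesis using that rtrancl_mono by blast
  qed
  have star2: "(i + m1, j + m1) \<in> ?E\<^sup>*" if "(i, j) \<in> ?E2\<^sup>*" for i j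
    using that
  proof (induction rule: rtrancl_induct)
    case (step y z)
    then have "(y + m1, z + m1) \<in> ?E" using E2 edges_decrease(2)[OF ok2] by blast
    then show ?case using step by simp
  qed simp
  have reach: "(?m - 1, i) \<in> ?E\<^sup>*" if im: "i < ?m" for i
  proof -
    consider "i < m1" | "m1 \<le> i" "i < m1 + m2" | "i = m1 + m2"
      using split_index[OF im] by blast
    then show ?thesis
    proof cases
      case 1
      then have "(m1 - 1, i) \<in> ?E\<^sup>*" using D1 star1 by blast
      then show ?thesis using E3(1) by (simp add: converse_rtrancl_into_rtrancl)
    next
      case 2
      then have "i - m1 < m2" by linarith
      then have "(m2 - 1, i - m1) \<in> ?E2\<^sup>*" using D2 by blast
      then have "(m2 - 1 + m1, i - m1 + m1) \<in> ?E\<^sup>*" by (rule star2)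
      moreover have "m2 - 1 + m1 = m1 + m2 - 1" "i - m1 + m1 = i" using m 2 by linarith+
      ultimately show ?thesis using E3(2) by (simp add: converse_rtrancl_into_rtrancl)
    qed simp
  qed
  have plus1: "(i, j) \<in> ?E1\<^sup>+ \<and> j < m1" if "(i, j) \<in> ?E\<^sup>+" "i < m1" for i j
    using that
  proof (induction rule: trancl_induct)
    case (base y)
    then show ?case using E1 edges_decrease[OF ok1] by (meson less_trans trancl.r_into_trancl)
  next
    case (step y z)
    then show ?case using E1 edges_decrease[OF ok1] by (meson less_trans trancl.trancl_into_trancl)
  qed
  have plus2: "\<exists>j'. j = j' + m1 \<and> (i, j') \<in> ?E2\<^sup>+ \<and> j' < m2" if "(i + m1, j) \<in> ?E\<^sup>+" "i < m2" for i j
    using that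
  proof (induction rule: trancl_induct)
    case (base y)
    then show ?case using E2 edges_decrease[OF ok2] by (meson less_trans trancl.r_into_trancl)
  next
    case (step y z)
    then obtain j' where j': "y = j' + m1" "(i, j') \<in> ?E2\<^sup>+" "j' < m2" by blast
    then obtain z' where z': "z = z' + m1" "(j', z') \<in> ?E2" using E2 step.hyps(2) by blast
    have "z' < m2" using edges_decrease(1)[OF ok2 z'(2)] j'(3) by linarith
    moreover have "(i, z') \<in> ?E2\<^sup>+" using j'(2) z'(2) by (rule trancl.trancl_into_trancl)
    ultimately show ?case using z'(1) by blast
  qed
  have dec: "j < i" if "(i, j) \<in> ?E\<^sup>+" for i j
    using that
  proof (induction rule: trancl_induct)
    case (base y)
    then show ?case using edges_decrease(1) ok by blast
  next
    case (step y z)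
    then show ?case using edges_decrease(1) ok by (meson less_trans)
  qed
  have V: "y \<in> V" if pj: "par i = Some (j, k, y)" "i < m1 + m2" for i j k y
  proof (cases "i < m1")
    case True
    then show ?thesis using that V1[of i] by (simp add: par_def)
  next
    case False
    then have "i - m1 < m2" using that by linarith
    moreover obtain j' k' where "par2 (i - m1) = Some (j', k', y)"
      using pj False by (auto simp: par_def)
    ultimately show ?thesis by (rule V2)
  qed
  have reg: "x1 \<noteq> x2" if ij: "i < ?m" "(i, j) \<in> ?E\<^sup>+" "par i = Some (j1, k1, x1)" "par j = Some (j2, k2, x2)"
    for i j j1 k1 x1 j2 k2 x2
  proof -
    consider "i < m1" | "m1 \<le> i" "i < m1 + m2" | "i = m1 + m2"
      using split_index[OF ij(1)] by blast
    then show ?thesis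
    proof cases
      case 1
      then have "(i, j) \<in> ?E1\<^sup>+" "j < m1" using plus1[OF ij(2)] by blast+
      moreover then have "par1 i = Some (j1, k1, x1)" "par1 j = Some (j2, k2, x2)"
        using 1 ij(3,4) by (simp_all add: par_def)
      ultimately show ?thesis using R1[OF 1] by blast
    next
      case 2
      then obtain i' where i': "i = i' + m1" "i' < m2" by (metis add.commute le_Suc_ex nat_add_left_cancel_less)
      then obtain j' where "j = j' + m1" "(i', j') \<in> ?E2\<^sup>+" "j' < m2" using plus2 ij(2) by blast
      moreover then obtain a1 b1 a2 b2 where "par2 i' = Some (a1, b1, x1)" "par2 j' = Some (a2, b2, x2)"
        using i' ij(3,4) by (auto simp: par_def)
      ultimately show ?thesis using R2[OF i'(2)] by blast
    next
      case 3
      then have "x1 = x" using ij by (simp add: par_def)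
      moreover have "x2 \<in> V" using V dec[OF ij(2)] 3 ij(4) by blast
      ultimately show ?thesis using x by auto
    qed
  qed
  have "derivation F (insert x V) ?m lab par"
    unfolding derivation_def
  proof (intro conjI)
    show "\<forall>i<?m. \<forall>j k y. par i = Some (j, k, y) \<longrightarrow> y \<in> insert x V"
    proof (intro allI impI)
      fix i j k y assume "i < ?m" "par i = Some (j, k, y)"
      then show "y \<in> insert x V" using V by (cases "i < m1 + m2") (auto simp: par_def)
    qed
    show "\<forall>i<?m. \<forall>j<?m. \<forall>j1 k1 x1 j2 k2 x2. (i, j) \<in> ?E\<^sup>+ \<longrightarrow>
        par i = Some (j1, k1, x1) \<longrightarrow> par j = Some (j2, k2, x2) \<longrightarrow> x1 \<noteq> x2"
      using reg by blast
    show "\<forall>i<?m. node_ok F lab par i" using ok by blast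
    show "\<forall>i<?m. (?m - 1, i) \<in> ?E\<^sup>*" using reach by blast
  qed simp
  then show ?thesis by (intro exI[of _ lab] exI[of _ par]) (simp add: lab_def C_def)
qed

text \<open>\<open>N\<close> is the clause falsified exactly by the current branch of the tree and
  \<open>V\<close> the set of variables not yet queried. At a leaf every variable of
  \<open>F\<close> is decided, so a falsified clause of \<open>F\<close> lies inside
  \<open>N\<close>. At an inner node a subderivation whose root lacks the pivot literal is kept as
  it is; otherwise the two are resolved, and m1 + m2 + 1 < 2 * 2^(v+1) when both sizes are below
  2^(v+1).\<close>

lemma derivation_exists:
  assumes "finite V"
  shows "\<forall>\<sigma>. falsified \<sigma> N \<longrightarrow> (\<exists>C\<in>F. falsified \<sigma> C) \<Longrightarrow> \<exists>\<sigma>. falsified \<sigma> N \<Longrightarrow>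
    \<forall>C\<in>F. fst ` C \<subseteq> V \<union> fst ` N \<Longrightarrow> V \<inter> fst ` N = {} \<Longrightarrow>
    \<exists>m lab par. derivation F V m lab par \<and> lab (m - 1) \<subseteq> N \<and> m < 2 ^ (card V + 1)"
  using assms
proof (induction V arbitrary: N rule: finite_induct)
  case empty
  then obtain \<sigma> C where \<sigma>: "falsified \<sigma> N" and C: "C \<in> F" "falsified \<sigma> C" by blast
  have "C \<subseteq> N"
  proof
    fix l assume l: "l \<in> C"
    then obtain l' where l': "l' \<in> N" "fst l' = fst l" using empty.prems(3) C(1) by fastforce
    then have "snd l' = snd l" using \<sigma> C(2) l by (fastforce simp: falsified_def)
    with l' have "l' = l" by (simp add: prod_eq_iff)
    with l' show "l \<in> N" by simp
  qed
  moreover have "derivation F {} 1 (\<lambda>_. C) (\<lambda>_. None)"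
    using C by (auto simp: derivation_def node_ok_def)
  ultimately show ?case by (intro exI[of _ 1] exI[of _ "\<lambda>_. C"] exI[of _ "\<lambda>_. None"]) auto
next
  case (insert x V)
  have "\<exists>m lab par. derivation F V m lab par \<and> lab (m - 1) \<subseteq> insert (x, b) N \<and> m < 2 ^ (card V + 1)" for b
  proof (rule insert.IH)
    show "\<forall>\<sigma>. falsified \<sigma> (insert (x, b) N) \<longrightarrow> (\<exists>C\<in>F. falsified \<sigma> C)"
      using insert.prems(1) by (auto simp: falsified_def)
    obtain \<sigma> where "falsified \<sigma> N" using insert.prems(2) by blast
    moreover have "(x, c) \<notin> N" for c
    proof
      assume "(x, c) \<in> N"
      then have "x \<in> fst ` N" by (metis fst_conv imageI)
      then show False using insert.prems(4) by simp
    qed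
    ultimately have "falsified (\<sigma>(x := \<not> b)) (insert (x, b) N)"
      unfolding falsified_def by (auto simp: split_beta)
    then show "\<exists>\<sigma>. falsified \<sigma> (insert (x, b) N)" by blast
    show "\<forall>C\<in>F. fst ` C \<subseteq> V \<union> fst ` insert (x, b) N" using insert.prems(3) by auto
    show "V \<inter> fst ` insert (x, b) N = {}" using insert.prems(4) insert.hyps by auto
  qed
  from this[of True] this[of False] obtain m1 lab1 par1 m2 lab2 par2 where
    d1: "derivation F V m1 lab1 par1" "lab1 (m1 - 1) \<subseteq> insert (x, True) N" "m1 < 2 ^ (card V + 1)" and
    d2: "derivation F V m2 lab2 par2" "lab2 (m2 - 1) \<subseteq> insert (x, False) N" "m2 < 2 ^ (card V + 1)"
    by blast
  have card: "(2 :: nat) ^ (card (insert x V) + 1) = 2 * 2 ^ (card V + 1)" using insert.hyps by simp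
  consider "(x, True) \<notin> lab1 (m1 - 1)" | "(x, False) \<notin> lab2 (m2 - 1)" |
    "(x, True) \<in> lab1 (m1 - 1)" "(x, False) \<in> lab2 (m2 - 1)" by blast
  then show ?case
  proof cases
    case 1
    then have "lab1 (m1 - 1) \<subseteq> N" using d1(2) by auto
    moreover have "derivation F (insert x V) m1 lab1 par1" using derivation_mono[OF d1(1)] by blast
    moreover have "m1 < 2 ^ (card (insert x V) + 1)" using d1(3) unfolding card by simp
    ultimately show ?thesis by blast
  next
    case 2
    then have "lab2 (m2 - 1) \<subseteq> N" using d2(2) by auto
    moreover have "derivation F (insert x V) m2 lab2 par2" using derivation_mono[OF d2(1)] by blast
    moreover have "m2 < 2 ^ (card (insert x V) + 1)" using d2(3) unfolding card by simp
    ultimately show ?thesis by blast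
  next
    case 3
    from derivation_join[OF d1(1) d2(1) insert.hyps(2) 3] obtain lab par where
      d: "derivation F (insert x V) (m1 + m2 + 1) lab par"
      and l: "lab (m1 + m2) = (lab1 (m1 - 1) - {(x, True)}) \<union> (lab2 (m2 - 1) - {(x, False)})" by blast
    have "lab (m1 + m2 + 1 - 1) \<subseteq> N" using l d1(2) d2(2) by auto
    moreover have "m1 + m2 + 1 < 2 ^ (card (insert x V) + 1)" using d1(3) d2(3) unfolding card by linarith
    ultimately show ?thesis using d by blast
  qed
qed

lemma derivation_regular:
  assumes "derivation F V m lab par" "lab (m - 1) = {}"
  shows "regular_resolution_proof F (m, lab, par)"
proof -
  have "resolution_proof F (m, lab, par)"
    using assms unfolding derivation_def resolution_proof_def node_ok_def by simp
  moreover have "regular (m, lab, par)"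
    unfolding regular_def
  proof (intro allI impI)
    fix i j
    assume ij: "(i, j) \<in> (dag_edges (m, lab, par))\<^sup>+" "is_internal (m, lab, par) i" "is_internal (m, lab, par) j"
    then obtain j1 k1 x1 j2 k2 x2 where "i < m" "j < m" "par i = Some (j1, k1, x1)" "par j = Some (j2, k2, x2)"
      by (auto simp: is_internal_def)
    moreover from this have "x1 \<noteq> x2"
      using assms(1)[unfolded derivation_def, THEN conjunct2, THEN conjunct2, THEN conjunct2, THEN conjunct2] ij(1) by blast
    ultimately show "pivot (m, lab, par) i \<noteq> pivot (m, lab, par) j" by (simp add: pivot_def)
  qed
  ultimately show ?thesis by (simp add: regular_resolution_proof_def)
qed

lemma unsat_regular_refutation:
  assumes "\<not> satisfiable F" "finite V" "\<forall>C\<in>F. fst ` C \<subseteq> V"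
  shows "\<exists>P. regular_resolution_proof F P \<and> dag_size P < 2 ^ (card V + 1)"
proof -
  have "\<exists>m lab par. derivation F V m lab par \<and> lab (m - 1) \<subseteq> {} \<and> m < 2 ^ (card V + 1)"
    by (rule derivation_exists) (use assms in \<open>auto simp: satisfiable_def falsified_def\<close>)
  then show ?thesis using derivation_regular by (fastforce simp: dag_size_def)
qed

lemma nat_of_bits_ones: "nat_of_bits (replicate L True) + 1 = 2 ^ L"
  by (induction L) auto

lemma enc_instance_in_REG_RES_SIZE:
  assumes "finite V" "\<forall>C\<in>set (map set cs). fst ` C \<subseteq> V" "card V < L"
  shows "enc_instance cs (int (nat_of_bits (replicate L True))) \<in> REG_RES_SIZE \<longleftrightarrow> \<not> satisfiable (set (map set cs))"
proof
  assume "enc_instance cs (int (nat_of_bits (replicate L True))) \<in> REG_RES_SIZE"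
  then obtain P where "regular_resolution_proof (set (map set cs)) P"
    unfolding REG_RES_SIZE_def using enc_instance_inject by blast
  then show "\<not> satisfiable (set (map set cs))"
    using resolution_sound unfolding regular_resolution_proof_def by blast
next
  assume "\<not> satisfiable (set (map set cs))"
  then obtain P where P: "regular_resolution_proof (set (map set cs)) P" "dag_size P < 2 ^ (card V + 1)"
    using unsat_regular_refutation assms by blast
  have "(2::nat) ^ (card V + 1) \<le> 2 ^ L" using assms(3) by (intro power_increasing) auto
  then have "dag_size P \<le> nat_of_bits (replicate L True)" using P(2) nat_of_bits_ones[of L] by linarith
  then have "int (dag_size P) \<le> int (nat_of_bits (replicate L True))" by simp
  then show "enc_instance cs (int (nat_of_bits (replicate L True))) \<in> REG_RES_SIZE"
    unfolding REG_RES_SIZE_def using P(1) by blast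
qed

section \<open>The tableau of a computation\<close>

text \<open>A number below S is a tape symbol; S * Suc q + a is the symbol a scanned by the head in state q.\<close>

definition cell :: "nat \<Rightarrow> config \<Rightarrow> int \<Rightarrow> nat" where
  "cell S c i = (case c of (q, t, p) \<Rightarrow> if i = p then S * Suc q + t i else t i)"

text \<open>Here the triple (0, 0, 0) stands for a cell without a moving head; in particular state 1 halts.\<close>

definition upd :: "tm \<Rightarrow> nat \<Rightarrow> nat \<Rightarrow> nat \<Rightarrow> nat" where
  "upd M a b c = (case M of (Q, S, \<delta>) \<Rightarrow>
     let \<Delta> = (\<lambda>s. if s div S = 0 \<or> s div S = 2 then (0, 0, 0) else \<delta> (s div S - 1) (s mod S)) in
     if b div S \<noteq> 0 then
       if b div S = 2 then b else (case \<Delta> b of (q', a', d) \<Rightarrow> if d = 0 then S * Suc q' + a' else a')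
     else if snd (snd (\<Delta> a)) = 1 then S * Suc (fst (\<Delta> a)) + b
     else if snd (snd (\<Delta> c)) = -1 then S * Suc (fst (\<Delta> c)) + b
     else b)"

definition valid_conf :: "tm \<Rightarrow> config \<Rightarrow> bool" where
  "valid_conf M c = (case M of (Q, S, \<delta>) \<Rightarrow> case c of (q, t, p) \<Rightarrow> q < Q \<and> (\<forall>i. t i < S))"

lemma wf_tmD:
  assumes "wf_tm (Q, S, \<delta>)" "q < Q" "a < S" "q \<noteq> 1" "\<delta> q a = (q', a', d)"
  shows "q' < Q" "a' < S" "d = -1 \<or> d = 0 \<or> d = 1"
  using assms unfolding wf_tm_def by fastforce+

lemma valid_conf_step:
  assumes "wf_tm M" "valid_conf M c"
  shows "valid_conf M (tm_step M c)"
proof -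
  obtain Q S \<delta> q t p where M: "M = (Q, S, \<delta>)" and c: "c = (q, t, p)" by (metis prod_cases3)
  obtain q' a' d where ad: "\<delta> q (t p) = (q', a', d)" by (metis prod_cases3)
  have v: "q < Q" "\<And>i. t i < S" using assms(2) by (simp_all add: valid_conf_def M c)
  show ?thesis
  proof (cases "q = 1")
    case True
    then show ?thesis using assms(2) by (simp add: tm_step_def M c)
  next
    case False
    then show ?thesis using v wf_tmD(1,2)[OF assms(1)[unfolded M] v(1) v(2) False ad]
      by (simp add: tm_step_def M c ad valid_conf_def)
  qed
qed

lemma cell_step:
  assumes "wf_tm M" "valid_conf M c"
  shows "cell (fst (snd M)) (tm_step M c) i = upd M (cell (fst (snd M)) c (i - 1)) (cell (fst (snd M)) c i) (cell (fst (snd M)) c (i + 1))"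
proof -
  obtain Q S \<delta> q t p where M: "M = (Q, S, \<delta>)" and c: "c = (q, t, p)" by (metis prod_cases3)
  obtain q' a' d where ad: "\<delta> q (t p) = (q', a', d)" by (metis prod_cases3)
  have v: "q < Q" "\<And>i. t i < S" using assms(2) by (simp_all add: valid_conf_def M c)
  have dm: "(S * Suc q + t i) div S = Suc q" "(S * Suc q + t i) mod S = t i" "t i div S = 0" "t i mod S = t i" for i
    using v(2)[of i] by (simp_all add: div_add1_eq add.commute[of _ "t i"] del: mult_Suc_right)
  have cl: "cell S c j = (if j = p then S * Suc q + t j else t j)" for j by (simp add: cell_def c)
  consider "i = p" | "i - 1 = p" "i \<noteq> p" "i + 1 \<noteq> p" | "i + 1 = p" "i \<noteq> p" "i - 1 \<noteq> p" | "i \<noteq> p" "i - 1 \<noteq> p" "i + 1 \<noteq> p"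
    by linarith
  note cs = this
  show ?thesis
  proof (cases "q = 1")
    case True
    then have st: "tm_step M c = c" by (simp add: tm_step_def M c)
    have q2: "Suc q = 2" using True by simp
    from cs show ?thesis
      by cases (simp_all add: st[unfolded M] M cl upd_def dm dm[unfolded q2] Let_def q2 del: mult_Suc_right)
  next
    case False
    then have st: "tm_step M c = (q', t(p := a'), p + d)" by (simp add: tm_step_def M c ad)
    have d: "d = -1 \<or> d = 0 \<or> d = 1" using wf_tmD(3)[OF assms(1)[unfolded M] v(1) v(2) False ad] .
    have q2: "Suc q \<noteq> 2" using False by simp
    from cs show ?thesis
    proof cases
      case 1
      then show ?thesis using d q2 False
        by (auto simp: st[unfolded M] M cl upd_def dm Let_def ad cell_def[of S "(q', t(p := a'), p + d)"] simp del: mult_Suc_right)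
    next
      case 2
      then have "t i = t (p + 1)" "i = p + 1" by (auto simp: algebra_simps)
      then show ?thesis using 2 d q2 False
        by (auto simp: st[unfolded M] M cl upd_def dm Let_def ad cell_def[of S "(q', t(p := a'), p + d)"] simp del: mult_Suc_right)
    next
      case 3
      then have "i = p - 1" by simp
      then show ?thesis using 3 d q2 False
        by (auto simp: st[unfolded M] M cl upd_def dm Let_def ad cell_def[of S "(q', t(p := a'), p + d)"] simp del: mult_Suc_right)
    next
      case 4
      then have "i \<noteq> p + d" using d by auto
      then show ?thesis using 4 
        by (simp add: st[unfolded M] M cl upd_def dm Let_def cell_def[of S "(q', t(p := a'), p + d)"] del: mult_Suc_right)
    qed
  qed
qed

text \<open>Windows that no configuration produces are included: there is a step clause for every
  triple of codes, and its variables count towards the size bound.\<close>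

lemma upd_bound:
  assumes "wf_tm (Q, S, \<delta>)" "a < S * Suc Q" "b < S * Suc Q" "c < S * Suc Q"
  shows "upd (Q, S, \<delta>) a b c < S * Suc Q"
proof -
  have S: "0 < S" "0 < Q" using assms(1) by (auto simp: wf_tm_def)
  define \<Delta> where "\<Delta> = (\<lambda>s. if s div S = 0 \<or> s div S = 2 then (0, 0, 0) else \<delta> (s div S - 1) (s mod S))"
  have \<Delta>: "fst (\<Delta> s) < Q \<and> fst (snd (\<Delta> s)) < S" if "s < S * Suc Q" for s
  proof (cases "s div S = 0 \<or> s div S = 2")
    case False
    have "s div S < Suc Q" using that by (metis less_mult_imp_div_less mult.commute)
    then have 1: "s div S - 1 < Q" "s div S - 1 \<noteq> 1" using False by linarith+
    obtain q' a' d where ad: "\<delta> (s div S - 1) (s mod S) = (q', a', d)" by (metis prod_cases3)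
    have "s mod S < S" using S by simp
    from wf_tmD(1,2)[OF assms(1) 1(1) this 1(2) ad] show ?thesis using False by (simp add: \<Delta>_def ad[unfolded One_nat_def])
  qed (use S in \<open>auto simp: \<Delta>_def\<close>)
  have add: "S * Suc q + r < S * Suc Q" if "q < Q" "r < S" for q r
  proof -
    have "S * Suc q + r < S * Suc (Suc q)" using that by simp
    also have "\<dots> \<le> S * Suc Q" using that by (intro mult_le_mono2) simp
    finally show ?thesis .
  qed
  have SQ: "S \<le> S * Suc Q" by simp
  have bS: "b < S" if "b div S = 0" using that S by (simp add: div_eq_0_iff)
  have u: "upd (Q, S, \<delta>) a b c = (if b div S \<noteq> 0 then
       if b div S = 2 then b else (case \<Delta> b of (q', a', d) \<Rightarrow> if d = 0 then S * Suc q' + a' else a')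
     else if snd (snd (\<Delta> a)) = 1 then S * Suc (fst (\<Delta> a)) + b
     else if snd (snd (\<Delta> c)) = -1 then S * Suc (fst (\<Delta> c)) + b
     else b)" by (simp add: upd_def \<Delta>_def Let_def)
  obtain q' a' d where b: "\<Delta> b = (q', a', d)" by (metis prod_cases3)
  show ?thesis
    unfolding u b prod.case
    using \<Delta>[OF assms(2)] \<Delta>[OF assms(3)] \<Delta>[OF assms(4)] assms(3) bS SQ add[of q' a'] add[of _ b] b
    by (auto simp del: mult_Suc_right intro: less_le_trans)
qed

definition conf :: "tm \<Rightarrow> bool list \<Rightarrow> nat \<Rightarrow> config" where
  "conf M z n = (tm_step M ^^ n) (tm_init z)"

lemma conf_Suc: "conf M z (Suc n) = tm_step M (conf M z n)"
  by (simp add: conf_def)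

lemma valid_conf_conf: "wf_tm M \<Longrightarrow> valid_conf M (conf M z n)"
proof (induction n)
  case 0
  then show ?case by (auto simp: conf_def valid_conf_def tm_init_def wf_tm_def split: prod.splits)
next
  case (Suc n)
  then show ?case by (simp add: conf_Suc valid_conf_step)
qed

lemma conf_spread:
  assumes "wf_tm M"
  shows "\<forall>q t p. conf M z n = (q, t, p) \<longrightarrow> - int n \<le> p \<and> p \<le> int n \<and> (\<forall>i. i < - int n \<or> i \<ge> int (length z) + int n \<longrightarrow> t i = 0)"
proof (induction n)
  case 0
  show ?case by (auto simp: conf_def tm_init_def)
next
  case (Suc n)
  obtain Q S \<delta> where M: "M = (Q, S, \<delta>)" by (metis prod_cases3)
  obtain q t p where c: "conf M z n = (q, t, p)" by (metis prod_cases3)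
  obtain q' a' d where ad: "\<delta> q (t p) = (q', a', d)" by (metis prod_cases3)
  have v: "q < Q" "t p < S" using valid_conf_conf[OF assms, of z n] by (simp_all add: valid_conf_def M c[unfolded M])
  have IH: "- int n \<le> p" "p \<le> int n" "\<And>i. i < - int n \<or> i \<ge> int (length z) + int n \<Longrightarrow> t i = 0"
    using Suc c by auto
  show ?case
  proof (cases "q = 1")
    case True
    then have "conf M z (Suc n) = (q, t, p)" unfolding conf_Suc c by (simp add: tm_step_def M)
    then show ?thesis using IH by auto
  next
    case False
    then have s: "conf M z (Suc n) = (q', t(p := a'), p + d)" unfolding conf_Suc c by (simp add: tm_step_def M ad)
    have "d = -1 \<or> d = 0 \<or> d = 1" using wf_tmD(3)[OF assms[unfolded M] v False ad] .
    then show ?thesis unfolding s using IH by auto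
  qed
qed

lemma conf_halted:
  assumes "fst (conf M z n) = 1"
  shows "conf M z (n + k) = conf M z n"
proof (induction k)
  case (Suc k)
  then show ?case using assms by (auto simp: conf_Suc tm_step_def split: prod.splits)
qed simp

text \<open>The computation is laid out on a helix: rows of width W are concatenated, so that a cell and
  its successor W + 1 places later hold the same tape position at consecutive times.\<close>

definition helix :: "tm \<Rightarrow> bool list \<Rightarrow> nat \<Rightarrow> nat \<Rightarrow> nat \<Rightarrow> nat" where
  "helix M z H W j = cell (fst (snd M)) (conf M z (j div W)) (int (j mod W) - int H)"

text \<open>\<open>H\<close> is the position of tape cell 0 within a row. The two inequalities keep
  the head and all nonblank symbols off both row ends.\<close>

locale halting_run =
  fixes M :: tm and z :: "bool list" and T H W :: nat
  assumes wf: "wf_tm M" and halt: "\<exists>n\<le>T. fst (conf M z n) = 1"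
    and H: "T < H" and W: "H + length z + T + 1 < W"
begin

text \<open>A halted configuration persists, so what holds during the first T steps holds
  forever.\<close>

lemma conf_le: "\<exists>n\<le>T. conf M z t = conf M z n"
proof (cases "t \<le> T")
  case False
  obtain n where n: "n \<le> T" "fst (conf M z n) = 1" using halt by blast
  from conf_halted[OF n(2), of "t - n"] show ?thesis using n(1) False by (intro exI[of _ n]) simp
qed auto

lemma conf_range:
  assumes "conf M z t = (q, tt, p)"
  shows "- int T \<le> p" "p \<le> int T" "i < - int T \<or> i \<ge> int (length z) + int T \<Longrightarrow> tt i = 0"
proof -
  obtain n where n: "n \<le> T" "conf M z n = (q, tt, p)" using conf_le[of t] assms by auto
  note s = conf_spread[OF wf, of z n, rule_format, OF n(2)]
  show "- int T \<le> p" "p \<le> int T" using s n(1) by linarith+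
  show "tt i = 0" if "i < - int T \<or> i \<ge> int (length z) + int T" using s n(1) that by force
qed

lemma cell_blank: "i < - int T \<or> i > int (length z) + int T \<Longrightarrow> cell S (conf M z t) i = 0"
proof -
  assume i: "i < - int T \<or> i > int (length z) + int T"
  obtain q tt p where c: "conf M z t = (q, tt, p)" by (metis prod_cases3)
  have "i \<noteq> p" using conf_range(1,2)[OF c] i by linarith
  moreover have "tt i = 0" using conf_range(3)[OF c, of i] i by linarith
  ultimately show ?thesis by (simp add: cell_def c)
qed

text \<open>The window starting at j determines the cell one row below its middle, hence the
  distance W + 1 from the start of the window. At a row end the window reaches into the neighbouring
  row instead of the true tape neighbour, but both cells lie in the blank margins.\<close>

lemma helix_upd:
  "helix M z H W (j + 1 + W) = upd M (helix M z H W j) (helix M z H W (j + 1)) (helix M z H W (j + 2))"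
proof -
  define t where "t = (j + 1) div W"
  define r where "r = (j + 1) mod W"
  let ?c = "\<lambda>t i. cell (fst (snd M)) (conf M z t) i"
  have W0: "0 < W" "1 < W" using W by auto
  have j: "j + 1 = W * t + r" "r < W" using W0 by (simp_all add: t_def r_def)
  have hx: "helix M z H W (W * t' + r') = ?c t' (int r' - int H)" if "r' < W" for t' r'
    using that by (simp add: helix_def)
  have 1: "helix M z H W (j + 1) = ?c t (int r - int H)" unfolding j(1) by (rule hx) (rule j(2))
  have 2: "helix M z H W (j + 1 + W) = ?c (Suc t) (int r - int H)"
  proof -
    have "j + 1 + W = W * Suc t + r" using j(1) by simp
    then show ?thesis using hx[OF j(2), of "Suc t"] by (simp only:)
  qed
  have 3: "helix M z H W j = ?c t (int r - int H - 1)"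
  proof (cases r)
    case 0
    then obtain t' where t': "t = Suc t'" using j(1) by (cases t) auto
    then have "j = W * t' + (W - 1)" using j(1) 0 W0 by simp
    then have "helix M z H W j = ?c t' (int (W - 1) - int H)" using hx[of "W - 1" t'] W0 by simp
    also have "\<dots> = 0" by (rule cell_blank) (use W in linarith)
    also have "?c t (int r - int H - 1) = 0" by (rule cell_blank) (use H 0 in linarith)
    finally show ?thesis by simp
  next
    case (Suc r')
    then have "j = W * t + r'" using j(1) by simp
    then show ?thesis using hx[of r' t] j(2) Suc by simp
  qed
  have 4: "helix M z H W (j + 2) = ?c t (int r - int H + 1)"
  proof (cases "Suc r < W")
    case True
    have "j + 2 = W * t + Suc r" using j(1) by simp
    then show ?thesis using hx[OF True, of t] by (simp add: algebra_simps)
  next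
    case False
    then have r: "Suc r = W" using j(2) by simp
    then have "j + 2 = W * Suc t + 0" using j(1) by simp
    then have "helix M z H W (j + 2) = ?c (Suc t) (int 0 - int H)" using hx[OF W0(1), of "Suc t"] by simp
    also have "\<dots> = 0" by (rule cell_blank) (use H in linarith)
    also have "?c t (int r - int H + 1) = 0" by (rule cell_blank) (use r W in linarith)
    finally show ?thesis by simp
  qed
  show ?thesis
    unfolding 1 2 3 4 conf_Suc by (rule cell_step[OF wf valid_conf_conf[OF wf]])
qed

lemma helix_bound:
  assumes "M = (Q, S, \<delta>)"
  shows "helix M z H W j < S * Suc Q"
proof -
  obtain q tt p where c: "conf M z (j div W) = (q, tt, p)" by (metis prod_cases3)
  have v: "q < Q" "\<And>i. tt i < S" using valid_conf_conf[OF wf, of z "j div W"] by (simp_all add: valid_conf_def assms c[unfolded assms])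
  have "S * Suc q + tt i < S * Suc Q" for i
  proof -
    have "S * Suc q + tt i < S * Suc (Suc q)" using v(2)[of i] by simp
    also have "\<dots> \<le> S * Suc Q" using v(1) by (intro mult_le_mono2) simp
    finally show ?thesis .
  qed
  moreover have "tt i < S * Suc Q" for i using v(2)[of i] by simp
  ultimately show ?thesis by (simp add: helix_def c[unfolded assms] cell_def assms del: mult_Suc_right)
qed

end

definition symbol :: "bool \<Rightarrow> nat" where
  "symbol b = (if b then 2 else 1)"

text \<open>The three-way choice in a guessed cell is the only clause with several positive
  literals. Blankness is passed on to the right, so the guessed cells allow a bit string followed by
  blanks, that is, a certificate of any length up to the number of these cells.\<close>

definition init_clauses :: "nat \<Rightarrow> letter \<Rightarrow> tlit list list" where
  "init_clauses S l = (case l of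
     Fam Bl _ \<Rightarrow> [[(True, False, 1, 0)]]
   | Cell h b \<Rightarrow> [[(True, False, 1, (if h then S else 0) + symbol b)]]
   | Fam Gu _ \<Rightarrow> [[(True, False, 1, 0), (True, False, 1, 1), (True, False, 1, 2)], [(False, False, 1, 0), (True, False, 2, 0)]]
   | _ \<Rightarrow> [])"

definition cell_bound :: "tm \<Rightarrow> nat" where
  "cell_bound M = fst (snd M) * Suc (fst M)"

text \<open>In block j the near field is j + 1 and the far field j + R + 2. With near offset 1 for
  cell j itself and far offset 0, cell i always has index i + 2, and the conclusion speaks of cell j
  + R.\<close>

definition step_clauses :: "tm \<Rightarrow> tlit list list" where
  "step_clauses M = hom (\<lambda>a. hom (\<lambda>b. map (\<lambda>c.
      [(False, False, 1, a), (False, False, 2, b), (False, False, 3, c), (True, True, 0, upd M a b c)])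
     [0..<cell_bound M]) [0..<cell_bound M]) [0..<cell_bound M]"

text \<open>The number 2 S + 1 encodes the head in the halting state reading the bit False, that is, rejection.\<close>

definition clauses :: "tm \<Rightarrow> letter \<Rightarrow> tlit list list" where
  "clauses M l = init_clauses (fst (snd M)) l @ [[(False, False, 1, 2 * fst (snd M) + 1)]] @ step_clauses M"

definition init_ok :: "nat \<Rightarrow> (nat \<Rightarrow> nat \<Rightarrow> bool) \<Rightarrow> nat \<Rightarrow> letter \<Rightarrow> bool" where
  "init_ok S \<tau> j l = (case l of
     Fam Bl _ \<Rightarrow> \<tau> j 0
   | Cell h b \<Rightarrow> \<tau> j ((if h then S else 0) + symbol b)
   | Fam Gu _ \<Rightarrow> (\<tau> j 0 \<or> \<tau> j 1 \<or> \<tau> j 2) \<and> (\<tau> j 0 \<longrightarrow> \<tau> (j + 1) 0)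
   | _ \<Rightarrow> True)"

definition table_ok :: "tm \<Rightarrow> letter list \<Rightarrow> (nat \<Rightarrow> nat \<Rightarrow> bool) \<Rightarrow> bool" where
  "table_ok M tys \<tau> \<longleftrightarrow> (\<forall>j<length tys. init_ok (fst (snd M)) \<tau> j (tys ! j) \<and> \<not> \<tau> j (2 * fst (snd M) + 1) \<and>
     (\<forall>a<cell_bound M. \<forall>b<cell_bound M. \<forall>c<cell_bound M.
        \<tau> j a \<longrightarrow> \<tau> (j + 1) b \<longrightarrow> \<tau> (j + 2) c \<longrightarrow> \<tau> (j + length (filter is_first tys)) (upd M a b c)))"

definition tlit_true :: "(nat \<Rightarrow> nat \<Rightarrow> bool) \<Rightarrow> nat \<Rightarrow> nat \<Rightarrow> tlit \<Rightarrow> bool" where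
  "tlit_true \<tau> a b = (\<lambda>(pol, far, off, s). \<tau> (off + (if far then b else a)) s = pol)"

lemma satisfiable_formula:
  "satisfiable (set (map set (formula cls tys))) \<longleftrightarrow>
    (\<exists>\<tau>. \<forall>j<length tys. \<forall>c\<in>set (cls (tys ! j)). \<exists>l\<in>set c.
       tlit_true \<tau> (Suc j) (Suc j + Suc (length (filter is_first tys))) l)"
proof -
  let ?R = "length (filter is_first tys)"
  have *: "(\<forall>C\<in>set (map set (formula cls tys)). \<not> falsified \<sigma> C) \<longleftrightarrow>
     (\<forall>j<length tys. \<forall>c\<in>set (cls (tys ! j)). \<exists>l\<in>set c. tlit_true (\<lambda>i s. \<sigma> (var i s)) (Suc j) (Suc j + Suc ?R) l)" for \<sigma>
  proof -
    have "\<not> falsified \<sigma> (set (map (inst a b) c)) \<longleftrightarrow> (\<exists>l\<in>set c. tlit_true (\<lambda>i s. \<sigma> (var i s)) a b l)" for a b c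
      unfolding not_falsified_iff by (simp add: inst_def tlit_true_def split_beta)
    moreover have "(\<forall>C\<in>set (map set (formula cls tys)). \<not> falsified \<sigma> C) \<longleftrightarrow>
      (\<forall>j<length tys. \<forall>c\<in>set (cls (tys ! j)). \<not> falsified \<sigma> (set (map (inst (Suc j) (Suc j + Suc ?R)) c)))"
      unfolding formula_def Let_def by (simp add: atLeast0LessThan) (simp only: Ball_def lessThan_iff)
    ultimately show ?thesis by (simp only:)
  qed
  show ?thesis
  proof
    assume "satisfiable (set (map set (formula cls tys)))"
    then show "\<exists>\<tau>. \<forall>j<length tys. \<forall>c\<in>set (cls (tys ! j)). \<exists>l\<in>set c. tlit_true \<tau> (Suc j) (Suc j + Suc ?R) l"
      unfolding satisfiable_def * by blast
  next
    assume "\<exists>\<tau>. \<forall>j<length tys. \<forall>c\<in>set (cls (tys ! j)). \<exists>l\<in>set c. tlit_true \<tau> (Suc j) (Suc j + Suc ?R) l"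
    then obtain \<tau> where \<tau>: "\<forall>j<length tys. \<forall>c\<in>set (cls (tys ! j)). \<exists>l\<in>set c. tlit_true \<tau> (Suc j) (Suc j + Suc ?R) l" ..
    \<comment> \<open>Reading the table back into an assignment works because \<open>var\<close> is
      injective.\<close>
    define \<sigma> where "\<sigma> = (\<lambda>v. \<exists>i s. v = var i s \<and> \<tau> i s)"
    have "(\<lambda>i s. \<sigma> (var i s)) = \<tau>" by (simp add: \<sigma>_def fun_eq_iff)
    then show "satisfiable (set (map set (formula cls tys)))"
      unfolding satisfiable_def * using \<tau> by (intro exI[of _ \<sigma>]) (simp only:)
  qed
qed

lemma clauses_true_iff:
  "(\<forall>c\<in>set (clauses M l). \<exists>t\<in>set c. tlit_true \<tau> (Suc j) (Suc j + Suc R) t) \<longleftrightarrow>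
    init_ok (fst (snd M)) (\<lambda>i. \<tau> (i + 2)) j l \<and> \<not> \<tau> (j + 2) (2 * fst (snd M) + 1) \<and>
     (\<forall>a<cell_bound M. \<forall>b<cell_bound M. \<forall>c<cell_bound M.
        \<tau> (j + 2) a \<longrightarrow> \<tau> (j + 1 + 2) b \<longrightarrow> \<tau> (j + 2 + 2) c \<longrightarrow> \<tau> (j + R + 2) (upd M a b c))"
proof -
  let ?P = "\<lambda>c. \<exists>t\<in>set c. tlit_true \<tau> (Suc j) (Suc j + Suc R) t"
  have 1: "(\<forall>c\<in>set (init_clauses S l). ?P c) \<longleftrightarrow> init_ok S (\<lambda>i. \<tau> (i + 2)) j l" for S
    by (auto simp: init_clauses_def init_ok_def tlit_true_def split: letter.split fam.split)
  have 2: "?P [(False, False, 1, s)] \<longleftrightarrow> \<not> \<tau> (j + 2) s" for s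
    by (simp add: tlit_true_def)
  have 3: "?P [(False, False, 1, a), (False, False, 2, b), (False, False, 3, c), (True, True, 0, s)] \<longleftrightarrow>
     (\<tau> (j + 2) a \<longrightarrow> \<tau> (j + 1 + 2) b \<longrightarrow> \<tau> (j + 2 + 2) c \<longrightarrow> \<tau> (j + R + 2) s)" for a b c s
    by (simp add: tlit_true_def eval_nat_numeral) blast
  have "(\<forall>c\<in>set (step_clauses M). ?P c) \<longleftrightarrow> (\<forall>a<cell_bound M. \<forall>b<cell_bound M. \<forall>c<cell_bound M.
     ?P [(False, False, 1, a), (False, False, 2, b), (False, False, 3, c), (True, True, 0, upd M a b c)])"
    unfolding step_clauses_def by (auto simp del: bex_simps)
  then have 4: "(\<forall>c\<in>set (step_clauses M). ?P c) \<longleftrightarrow> (\<forall>a<cell_bound M. \<forall>b<cell_bound M. \<forall>c<cell_bound M.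
     \<tau> (j + 2) a \<longrightarrow> \<tau> (j + 1 + 2) b \<longrightarrow> \<tau> (j + 2 + 2) c \<longrightarrow> \<tau> (j + R + 2) (upd M a b c))"
    unfolding 3 .
  have "(\<forall>c\<in>set (clauses M l). ?P c) \<longleftrightarrow> (\<forall>c\<in>set (init_clauses (fst (snd M)) l). ?P c) \<and>
     ?P [(False, False, 1, 2 * fst (snd M) + 1)] \<and> (\<forall>c\<in>set (step_clauses M). ?P c)"
    unfolding clauses_def by (simp only: set_append ball_Un list.set ball_simps) simp
  then show ?thesis unfolding 1 2 4 .
qed

lemma satisfiable_table:
  "satisfiable (set (map set (formula (clauses M) tys))) \<longleftrightarrow> (\<exists>\<tau>. table_ok M tys \<tau>)"
proof -
  have "(\<exists>\<tau>. table_ok M tys (\<lambda>i. \<tau> (i + 2))) \<longleftrightarrow> (\<exists>\<tau>. table_ok M tys \<tau>)"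
  proof
    assume "\<exists>\<tau>. table_ok M tys \<tau>"
    then obtain \<tau> where "table_ok M tys \<tau>" ..
    \<comment> \<open>Cells sit at index 2 and above; the values that truncated subtraction gives at
      0 and 1 are a mere default.\<close>
    then have "table_ok M tys (\<lambda>i. (\<lambda>k. \<tau> (k - 2)) (i + 2))" by simp
    then show "\<exists>\<tau>. table_ok M tys (\<lambda>i. \<tau> (i + 2))" by (rule exI[of _ "\<lambda>k. \<tau> (k - 2)"])
  qed blast
  then show ?thesis
    unfolding satisfiable_formula clauses_true_iff table_ok_def by (simp only:)
qed

text \<open>This bounds the number of variables, which the number of digits of the size bound has to
  exceed.\<close>

lemma fst_formula_vars:
  assumes "wf_tm M" "C \<in> set (map set (formula (clauses M) tys))"
  shows "fst ` C \<subseteq> (\<lambda>(i, s). var i s) ` ({..<length tys + length (filter is_first tys) + 4} \<times> {..<cell_bound M})"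
proof -
  let ?R = "length (filter is_first tys)"
  obtain j c where j: "j < length tys" and c: "c \<in> set (clauses M (tys ! j))"
    and C: "C = set (map (inst (Suc j) (Suc j + Suc ?R)) c)"
    using assms(2) by (auto simp: formula_def Let_def)
  obtain Q S \<delta> where M: "M = (Q, S, \<delta>)" by (metis prod_cases3)
  have QS: "2 \<le> Q" "3 \<le> S" using assms(1) by (auto simp: wf_tm_def M)
  have b: "S * 3 \<le> cell_bound M" using QS by (simp add: cell_bound_def M del: mult_Suc_right)
  have off: "far \<and> off = 0 \<or> \<not> far \<and> off \<le> 3" "s < cell_bound M" if "(pol, far, off, s) \<in> set c" for pol far off s
  proof -
    from c consider "c \<in> set (init_clauses S (tys ! j))" | "c = [(False, False, 1, 2 * S + 1)]"
      | a b d where "a < cell_bound M" "b < cell_bound M" "d < cell_bound M"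
         "c = [(False, False, 1, a), (False, False, 2, b), (False, False, 3, d), (True, True, 0, upd M a b d)]"
      by (auto simp: clauses_def step_clauses_def M)
    then have "(far \<and> off = 0 \<or> \<not> far \<and> off \<le> 3) \<and> s < cell_bound M"
    proof cases
      case 1
      then show ?thesis using that b QS
        by (auto simp: init_clauses_def symbol_def split: letter.splits fam.splits if_splits)
    next
      case 2
      then show ?thesis using that b QS by auto
    next
      case 3
      have "upd M a b d < cell_bound M"
        using upd_bound[OF assms(1)[unfolded M]] 3(1-3) by (simp add: M cell_bound_def)
      then show ?thesis using that 3 by auto
    qed
    then show "far \<and> off = 0 \<or> \<not> far \<and> off \<le> 3" "s < cell_bound M" by auto
  qed
  show ?thesis
  proof
    fix v assume "v \<in> fst ` C"
    then obtain pol far off s where t: "(pol, far, off, s) \<in> set c" and v: "v = var (off + (if far then Suc j + Suc ?R else Suc j)) s"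
      unfolding C by (auto simp: inst_def split: prod.splits)
    have "off + (if far then Suc j + Suc ?R else Suc j) < length tys + ?R + 4" using off(1)[OF t] j by auto
    then show "v \<in> (\<lambda>(i, s). var i s) ` ({..<length tys + ?R + 4} \<times> {..<cell_bound M})"
      using off(2)[OF t] v by (intro image_eqI[of _ _ "(off + (if far then Suc j + Suc ?R else Suc j), s)"]) auto
  qed
qed

section \<open>The cells of the first row\<close>

lemma filter_xcells:
  "filter is_block (xcells x) = (case dup x @ [False] of b # w \<Rightarrow> Cell True b # map (Cell False) w)"
proof -
  have "filter is_block (hom (\<lambda>b. [Cell False True, Cell False b, K False]) x) = map (Cell False) (dup x)" for x
    by (induction x) (auto simp: is_block_def)
  then show ?thesis by (cases x) (simp_all add: xcells_def is_block_def)
qed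

lemma xcells_nth:
  assumes "k < 2 * length x + 1"
  shows "filter is_block (xcells x) ! k = Cell (k = 0) ((dup x @ [False]) ! k)"
proof -
  have l: "length (dup x @ [False]) = 2 * length x + 1" by (induction x) auto
  obtain b w where w: "dup x @ [False] = b # w" by (cases "dup x @ [False]") auto
  then show ?thesis using assms l unfolding filter_xcells w by (cases k) auto
qed

lemma length_xcells: "length (filter is_block (xcells x)) = 2 * length x + 1"
proof -
  have "length (dup x) = 2 * length x" by (induction x) auto
  then show ?thesis unfolding filter_xcells by (cases x) auto
qed

lemma first_skeleton:
  "length (filter is_first (skeleton e x)) = 2 * e Bl + (2 * length x + 1) + e Gu"
proof -
  have "a \<notin> range (Fam No)" if "a \<in> set (xcells x)" for a
    using xcells_letters[of x] that by auto
  then have "filter is_first (filter is_block (xcells x)) = filter is_block (xcells x)"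
    unfolding filter_filter by (intro filter_cong) (auto simp: is_first_def)
  moreover have "is_first (Fam Bl True)" "is_first (Fam Gu True)" "\<not> is_first (Fam No True)"
    by (auto simp: is_first_def is_block_def)
  ultimately show ?thesis using length_xcells[of x] by (simp add: skeleton_def)
qed

lemma length_skeleton: "length (skeleton e x) = 2 * e Bl + (2 * length x + 1) + e Gu + e No"
  by (simp add: skeleton_def length_xcells)

lemma skeleton_nth:
  fixes x e
  defines "n1 \<equiv> e Bl + (2 * length x + 1)"
  shows "j < e Bl \<Longrightarrow> skeleton e x ! j = Fam Bl True"
    "e Bl \<le> j \<Longrightarrow> j < n1 \<Longrightarrow> skeleton e x ! j = Cell (j = e Bl) ((dup x @ [False]) ! (j - e Bl))"
    "n1 \<le> j \<Longrightarrow> j < n1 + e Gu \<Longrightarrow> skeleton e x ! j = Fam Gu True"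
    "n1 + e Gu \<le> j \<Longrightarrow> j < n1 + e Gu + e Bl \<Longrightarrow> skeleton e x ! j = Fam Bl True"
    "n1 + e Gu + e Bl \<le> j \<Longrightarrow> j < n1 + e Gu + e Bl + e No \<Longrightarrow> skeleton e x ! j = Fam No True"
proof -
  show "skeleton e x ! j = Fam Bl True" if "j < e Bl"
    using that by (simp add: skeleton_def nth_append)
  show "skeleton e x ! j = Cell (j = e Bl) ((dup x @ [False]) ! (j - e Bl))" if "e Bl \<le> j" "j < n1"
  proof -
    have "j - e Bl < 2 * length x + 1" using that unfolding n1_def by linarith
    from xcells_nth[OF this] show ?thesis
      using that \<open>j - e Bl < 2 * length x + 1\<close> unfolding skeleton_def
      by (simp add: nth_append length_xcells) 
  qed
  show "skeleton e x ! j = Fam Gu True" if "n1 \<le> j" "j < n1 + e Gu"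
  proof -
    have "\<not> j < e Bl" "\<not> j - e Bl < 2 * length x + 1" "j - e Bl - (2 * length x + 1) < e Gu" using that unfolding n1_def by linarith+
    then show ?thesis unfolding skeleton_def by (simp only: nth_append length_replicate length_xcells if_False if_True nth_replicate)
  qed
  show "skeleton e x ! j = Fam Bl True" if "n1 + e Gu \<le> j" "j < n1 + e Gu + e Bl"
  proof -
    have "\<not> j < e Bl" "\<not> j - e Bl < 2 * length x + 1" "\<not> j - e Bl - (2 * length x + 1) < e Gu"
      "j - e Bl - (2 * length x + 1) - e Gu < e Bl" using that unfolding n1_def by linarith+
    then show ?thesis unfolding skeleton_def by (simp only: nth_append length_replicate length_xcells if_False if_True nth_replicate)
  qed
  show "skeleton e x ! j = Fam No True" if "n1 + e Gu + e Bl \<le> j" "j < n1 + e Gu + e Bl + e No"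
  proof -
    have "\<not> j < e Bl" "\<not> j - e Bl < 2 * length x + 1" "\<not> j - e Bl - (2 * length x + 1) < e Gu"
      "\<not> j - e Bl - (2 * length x + 1) - e Gu < e Bl" "j - e Bl - (2 * length x + 1) - e Gu - e Bl < e No" using that unfolding n1_def by linarith+
    then show ?thesis unfolding skeleton_def by (simp only: nth_append length_replicate length_xcells if_False if_True nth_replicate)
  qed
qed

lemma cell_init:
  "cell S (tm_init z) i = (if i = 0 then S else 0) + (if 0 \<le> i \<and> i < int (length z) then symbol (z ! nat i) else 0)"
  by (auto simp: cell_def tm_init_def symbol_def)

text \<open>A one-bit answer is the scanned symbol, so the verdict is visible in the single cell
  that carries the head.\<close>

lemma tm_output_single:
  assumes "tm_output (q, t, p) = [b]"
  shows "t p \<in> {1, 2}" "t p = 2 \<longleftrightarrow> b"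
proof -
  define n where "n = (LEAST n. t (p + int n) \<notin> {1, 2})"
  have m: "map (\<lambda>i. t (p + int i) = 2) [0..<n] = [b]" using assms by (simp add: tm_output_def n_def)
  then have n: "n = 1" by (metis length_map length_upt diff_zero length_Cons list.size(3) One_nat_def)
  then show "t p = 2 \<longleftrightarrow> b" using m by simp
  have "0 < n" using n by simp
  from not_less_Least[OF this[unfolded n_def]] show "t p \<in> {1, 2}" by auto
qed

text \<open>Rows have width R - 1, one less than the number of first-row blocks, because R is the
  distance from the start of a window. The 3 in \<open>H\<close> is what the strict bound on the
  width in \<open>halting_run\<close> then requires. \<open>N\<close> leaves room for the T + 1 rows
  up to the halting time.\<close>

locale reduction =
  fixes M :: tm and x :: "bool list" and e :: "fam \<Rightarrow> nat" and T R :: nat and V :: "bool list set"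
  assumes wf: "wf_tm M"
    and run: "length y \<le> e Gu \<Longrightarrow> \<exists>n\<le>T. fst (conf M (enc_pair x y) n) = 1 \<and>
      tm_output (conf M (enc_pair x y) n) = [enc_pair x y \<in> V]"
    and H: "T + 3 \<le> e Bl"
    and R: "R = 2 * e Bl + (2 * length x + 1) + e Gu"
    and N: "e Bl * R \<le> e No"
begin

abbreviation "n1 \<equiv> e Bl + (2 * length x + 1)"
abbreviation "S \<equiv> fst (snd M)"
abbreviation "tab y \<equiv> helix M (enc_pair x y) (e Bl) (R - 1)"

lemma enc_pair_eq: "enc_pair x y = (dup x @ [False]) @ y"
  by (simp add: enc_pair_def)

lemma length_prefix: "length (dup x @ [False]) = 2 * length x + 1"
  by (induction x) auto

lemma length_enc_pair: "length (enc_pair x y) = 2 * length x + 1 + length y"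
  unfolding enc_pair_eq length_append[of _ y] length_prefix ..

lemma halting: "length y \<le> e Gu \<Longrightarrow> halting_run M (enc_pair x y) T (e Bl) (R - 1)"
  using wf run[of y] H R by unfold_locales (auto simp: length_enc_pair)

lemma tab_first:
  assumes y: "length y \<le> e Gu" and j: "j < R"
  shows "tab y j = (if j < e Bl then 0 else if j < n1 then (if j = e Bl then S else 0) + symbol ((dup x @ [False]) ! (j - e Bl))
     else if j < n1 + length y then symbol (y ! (j - n1)) else 0)"
proof (cases "j < R - 1")
  case False
  \<comment> \<open>The last first-row block already belongs to the second row: it is the leftmost
    cell at time 1, deep in the blank margin.\<close>
  then have j': "j = R - 1" using j by simp
  have "R - 1 \<noteq> 0" using R H by simp
  then have "tab y j = cell S (conf M (enc_pair x y) 1) (- int (e Bl))"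
    by (simp add: helix_def j')
  also have "\<dots> = 0" by (rule halting_run.cell_blank[OF halting[OF y]]) (use H in linarith)
  finally show ?thesis using j' R y H by simp
next
  case True
  let ?i = "int j - int (e Bl)"
  have t: "tab y j = cell S (tm_init (enc_pair x y)) ?i"
    using True by (simp add: helix_def conf_def)
  consider "j < e Bl" | "e Bl \<le> j" "j < n1" | "n1 \<le> j" "j < n1 + length y" | "n1 + length y \<le> j"
    by linarith
  then show ?thesis
  proof cases
    case 1
    then show ?thesis unfolding t cell_init by simp
  next
    case 2
    then have k: "nat ?i = j - e Bl" "j - e Bl < 2 * length x + 1" by linarith+
    then have "enc_pair x y ! nat ?i = (dup x @ [False]) ! (j - e Bl)"
      unfolding enc_pair_eq by (simp only: nth_append[of _ y] length_prefix if_True)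
    moreover have "?i < int (length (enc_pair x y))" "0 \<le> ?i" using 2 length_enc_pair[of y] by linarith+
    ultimately show ?thesis unfolding t cell_init using 2 by simp
  next
    case 3
    then have k: "nat ?i = j - e Bl" "\<not> j - e Bl < 2 * length x + 1" "j - e Bl - (2 * length x + 1) = j - n1" by linarith+
    then have "enc_pair x y ! nat ?i = y ! (j - n1)"
      unfolding enc_pair_eq by (simp only: nth_append[of _ y] length_prefix if_False)
    moreover have "?i < int (length (enc_pair x y))" "0 \<le> ?i" "?i \<noteq> 0" using 3 length_enc_pair[of y] by linarith+
    ultimately show ?thesis unfolding t cell_init using 3 by simp
  next
    case 4
    then have "\<not> ?i < int (length (enc_pair x y))" "?i \<noteq> 0" using length_enc_pair[of y] by linarith+
    then show ?thesis unfolding t cell_init using 4 by simp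
  qed
qed

lemma tab_upd:
  assumes "length y \<le> e Gu"
  shows "tab y (j + R) = upd M (tab y j) (tab y (j + 1)) (tab y (j + 2))"
proof -
  have "j + R = j + 1 + (R - 1)" using R by simp
  then show ?thesis using halting_run.helix_upd[OF halting[OF assms], of j] by (simp only:)
qed

lemma tab_bound: "length y \<le> e Gu \<Longrightarrow> tab y j < cell_bound M"
proof -
  assume y: "length y \<le> e Gu"
  obtain Q S' \<delta> where M: "M = (Q, S', \<delta>)" by (metis prod_cases3)
  show ?thesis
    using halting_run.helix_bound[OF halting[OF y] M, of j] by (simp add: cell_bound_def M)
qed

lemma S_ge: "3 \<le> S"
  using wf by (auto simp: wf_tm_def split: prod.splits)

lemma tab_halting_iff:
  assumes y: "length y \<le> e Gu" and c: "conf M (enc_pair x y) t = (q, u, p)" "q = 1"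
  shows "u p \<in> {1, 2}" "u p = 2 \<longleftrightarrow> enc_pair x y \<in> V"
proof -
  obtain n where n: "fst (conf M (enc_pair x y) n) = 1" "tm_output (conf M (enc_pair x y) n) = [enc_pair x y \<in> V]"
    using run[OF y] by blast
  have "conf M (enc_pair x y) t = conf M (enc_pair x y) n"
  proof (cases "t \<le> n")
    case True
    then show ?thesis using conf_halted[of M "enc_pair x y" t "n - t"] c by simp
  next
    case False
    then show ?thesis using conf_halted[OF n(1), of "t - n"] by simp
  qed
  then have "tm_output (q, u, p) = [enc_pair x y \<in> V]" using n(2) c(1) by simp
  then show "u p \<in> {1, 2}" "u p = 2 \<longleftrightarrow> enc_pair x y \<in> V" by (rule tm_output_single)+
qed

lemma tab_not_rejecting:
  assumes y: "length y \<le> e Gu" and V: "enc_pair x y \<in> V"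
  shows "tab y j \<noteq> 2 * S + 1"
proof
  assume a: "tab y j = 2 * S + 1"
  let ?t = "j div (R - 1)" and ?i = "int (j mod (R - 1)) - int (e Bl)"
  obtain q u p where c: "conf M (enc_pair x y) ?t = (q, u, p)" by (metis prod_cases3)
  obtain Q S' \<delta> where M: "M = (Q, S', \<delta>)" by (metis prod_cases3)
  have u: "u ?i < S" using valid_conf_conf[OF wf, of "enc_pair x y" ?t] unfolding c by (simp add: valid_conf_def M)
  have cl: "(if ?i = p then S * Suc q + u ?i else u ?i) = 2 * S + 1"
    using a unfolding helix_def c cell_def prod.case .
  \<comment> \<open>A bare tape symbol is below S, so the code 2 * S + 1 can only come from the cell
    under the head.\<close>
  then have i: "?i = p" using u S_ge by (auto split: if_splits)
  then have eq: "S * Suc q + u p = S * 2 + 1" "u p < S" using cl u by auto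
  have "(S * Suc q + u p) div S = Suc q" using eq(2) by (simp add: div_add1_eq del: mult_Suc_right)
  moreover have "(S * 2 + 1) div S = 2" by (rule div_nat_eqI) (use S_ge in auto)
  ultimately have "Suc q = 2" unfolding eq(1) by (rule trans[OF sym])
  then have q: "q = 1" by simp
  then have "u p = 1" using eq(1) by simp
  then show False using tab_halting_iff[OF y c q] V by simp
qed

lemma table_exists:
  assumes y: "length y \<le> e Gu" and V: "enc_pair x y \<in> V"
  shows "table_ok M (skeleton e x) (\<lambda>j s. tab y j = s)"
  unfolding table_ok_def first_skeleton R[symmetric]
proof (intro allI impI conjI)
  fix j assume j: "j < length (skeleton e x)"
  show "tab y j \<noteq> 2 * S + 1" by (rule tab_not_rejecting[OF y V])
  consider "j < e Bl" | "e Bl \<le> j" "j < n1" | "n1 \<le> j" "j < n1 + e Gu" | "n1 + e Gu \<le> j" "j < n1 + e Gu + e Bl"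
    | "n1 + e Gu + e Bl \<le> j" "j < n1 + e Gu + e Bl + e No"
    using j unfolding length_skeleton by linarith
  then show "init_ok S (\<lambda>j s. tab y j = s) j (skeleton e x ! j)"
  proof cases
    case 1
    then have "j < R" using R by simp
    from tab_first[OF y this] show ?thesis using 1 by (simp add: skeleton_nth(1) init_ok_def)
  next
    case 2
    then have "j < R" using R by simp
    from tab_first[OF y this] show ?thesis using 2 by (simp add: skeleton_nth(2) init_ok_def)
  next
    case 3
    have jR: "j < R" "j + 1 < R" using 3 R H by simp_all
    have "\<not> j < e Bl" "\<not> j + 1 < e Bl" "\<not> j < n1" "\<not> j + 1 < n1" using 3 by linarith+
    with tab_first[OF y jR(1)] tab_first[OF y jR(2)]
    have t: "tab y j = (if j < n1 + length y then symbol (y ! (j - n1)) else 0)"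
      "tab y (j + 1) = (if j + 1 < n1 + length y then symbol (y ! (j + 1 - n1)) else 0)" by (simp_all only: if_False)
    have g: "skeleton e x ! j = Fam Gu True" using 3 by (rule skeleton_nth(3))
    show ?thesis
      unfolding g init_ok_def letter.case fam.case t
      by (cases "j < n1 + length y") (auto simp: symbol_def)
  next
    case 4
    then have "j < R" using R by simp
    moreover have "\<not> j < e Bl" "\<not> j < n1" "\<not> j < n1 + length y" using 4 y by linarith+
    ultimately have "tab y j = 0" using tab_first[OF y, of j] by (simp only: if_False)
    moreover have "skeleton e x ! j = Fam Bl True" using 4 by (rule skeleton_nth(4))
    ultimately show ?thesis by (simp add: init_ok_def)
  next
    case 5
    then have "skeleton e x ! j = Fam No True" by (rule skeleton_nth(5))
    then show ?thesis by (simp add: init_ok_def)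
  qed
next
  fix j a b c
  assume "tab y j = a" "tab y (j + 1) = b" "tab y (j + 2) = c"
  then show "tab y (j + R) = upd M a b c" using tab_upd[OF y] by simp
qed

text \<open>A table may allow several symbols in a cell. The certificate stops at the first guessed
  cell that allows a blank; each cell before it allows 1 or 2, and preferring 2 settles the rest. By
  induction along the line the step clauses force every symbol of the run on this certificate into
  the table. That run halts, and the clause against rejection leaves only acceptance.\<close>

lemma table_witness:
  assumes tab: "table_ok M (skeleton e x) \<tau>"
  shows "\<exists>y. length y \<le> e Gu \<and> enc_pair x y \<in> V"
proof -
  let ?tys = "skeleton e x"
  have len: "length ?tys = R + e No" by (simp add: length_skeleton R)
  have init: "init_ok S \<tau> j (?tys ! j)" and rej: "\<not> \<tau> j (2 * S + 1)"
    and step: "\<lbrakk>a < cell_bound M; b < cell_bound M; c < cell_bound M; \<tau> j a; \<tau> (j + 1) b; \<tau> (j + 2) c\<rbrakk> \<Longrightarrow> \<tau> (j + R) (upd M a b c)"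
    if "j < length ?tys" for j a b c
    using tab that unfolding table_ok_def first_skeleton R[symmetric] by blast+
  \<comment> \<open>The alternative \<open>k = e Gu\<close> provides a value when no guessed cell
    allows a blank.\<close>
  define g where "g = (LEAST k. k = e Gu \<or> \<tau> (n1 + k) 0)"
  have g: "g = e Gu \<or> \<tau> (n1 + g) 0" unfolding g_def by (rule LeastI[of _ "e Gu"]) simp
  have gle: "g \<le> e Gu" unfolding g_def by (rule Least_le) simp
  have gl: "\<not> \<tau> (n1 + k) 0" if "k < g" for k using not_less_Least[OF that[unfolded g_def]] by blast
  define y where "y = map (\<lambda>k. \<tau> (n1 + k) 2) [0..<g]"
  have ly: "length y = g" by (simp add: y_def)
  have y: "length y \<le> e Gu" using gle ly by simp
  have gu: "(\<tau> (n1 + k) 0 \<or> \<tau> (n1 + k) 1 \<or> \<tau> (n1 + k) 2) \<and> (\<tau> (n1 + k) 0 \<longrightarrow> \<tau> (n1 + k + 1) 0)" if "k < e Gu" for k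
  proof -
    have "?tys ! (n1 + k) = Fam Gu True" using that by (intro skeleton_nth(3)) auto
    moreover have "n1 + k < length ?tys" using that by (simp add: len R)
    ultimately show ?thesis using init[of "n1 + k"] by (simp add: init_ok_def)
  qed
  have bl: "\<tau> (n1 + k) 0" if "g \<le> k" "k < e Gu" for k
    using that
  proof (induction k rule: dec_induct)
    case base
    then show ?case using g by auto
  next
    case (step k)
    then show ?case using gu[of k] by simp
  qed
  have first: "\<tau> j (tab y j)" if j: "j < R" for j
  proof -
    have jl: "j < length ?tys" using j len by simp
    consider "j < e Bl" | "e Bl \<le> j" "j < n1" | "n1 \<le> j" "j < n1 + e Gu" | "n1 + e Gu \<le> j" "j < n1 + e Gu + e Bl"
      using j R by linarith
    then show ?thesis
    proof cases
      case 1
      then show ?thesis using init[OF jl] tab_first[OF y j] by (simp add: skeleton_nth(1) init_ok_def)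
    next
      case 2
      then show ?thesis using init[OF jl] tab_first[OF y j] by (simp add: skeleton_nth(2) init_ok_def)
    next
      case 3
      define k where "k = j - n1"
      have k: "j = n1 + k" "k < e Gu" using 3 by (auto simp: k_def)
      have "\<not> j < e Bl" "\<not> j < n1" using 3 by linarith+
      then have t: "tab y j = (if j < n1 + length y then symbol (y ! (j - n1)) else 0)"
        using tab_first[OF y j] by (simp only: if_False)
      show ?thesis
      proof (cases "k < g")
        case True
        then have "tab y j = symbol (\<tau> (n1 + k) 2)" using t k(1) by (simp add: ly) (simp add: y_def)
        then show ?thesis using gu[OF k(2)] gl[OF True] by (auto simp: symbol_def k(1))
      next
        case False
        then have "tab y j = 0" using t k(1) by (simp add: ly)
        then show ?thesis using bl[of k] False k by simp
      qed
    next
      case 4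
      then have "\<not> j < e Bl" "\<not> j < n1" "\<not> j < n1 + length y" using y by linarith+
      then have "tab y j = 0" using tab_first[OF y j] by (simp only: if_False)
      moreover have "?tys ! j = Fam Bl True" using 4 by (rule skeleton_nth(4))
      ultimately show ?thesis using init[OF jl] by (simp add: init_ok_def)
    qed
  qed
  have R3: "3 \<le> R" using R H by simp
  have all: "j < length ?tys \<Longrightarrow> \<tau> j (tab y j)" for j
  proof (induction j rule: less_induct)
    case (less j)
    show ?case
    proof (cases "j < R")
      case True
      then show ?thesis by (rule first)
    next
      case False
      define i where "i = j - R"
      have i: "j = i + R" "i < length ?tys" "i < j" "i + 1 < j" "i + 2 < j" using False R3 less.prems by (auto simp: i_def)
      have "\<tau> (i + R) (upd M (tab y i) (tab y (i + 1)) (tab y (i + 2)))"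
        by (rule step[OF i(2)]) (use less i tab_bound[OF y] in auto)
      then show ?thesis unfolding i(1) tab_upd[OF y] .
    qed
  qed
  obtain n where n: "n \<le> T" "fst (conf M (enc_pair x y) n) = 1" using run[OF y] by blast
  obtain q u p where c: "conf M (enc_pair x y) n = (q, u, p)" by (metis prod_cases3)
  have q: "q = 1" using n(2) c by simp
  have p: "- int T \<le> p" "p \<le> int T" using halting_run.conf_range(1,2)[OF halting[OF y] c] .
  define r where "r = nat (p + int (e Bl))"
  have r: "int r = p + int (e Bl)" "r < R - 1" using p H R by (auto simp: r_def)
  \<comment> \<open>The cell under the head at the halting time n: row n, column r.\<close>
  let ?j = "n * (R - 1) + r"
  have "tab y ?j = cell S (q, u, p) p"
    using r c by (simp add: helix_def)
  then have t: "tab y ?j = 2 * S + u p" by (simp add: cell_def q)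
  have "?j < length ?tys"
  proof -
    have "?j < n * (R - 1) + (R - 1)" using r by simp
    also have "\<dots> = Suc n * (R - 1)" by simp
    also have "\<dots> \<le> e Bl * R" using n(1) H by (intro mult_le_mono) auto
    finally show ?thesis using N len by simp
  qed
  from all[OF this] rej[OF this] have "u p \<noteq> 1" unfolding t by auto
  then have "enc_pair x y \<in> V" using tab_halting_iff[OF y c q] by auto
  then show ?thesis using y by blast
qed

lemma satisfiable_iff:
  "satisfiable (set (map set (formula (clauses M) (skeleton e x)))) \<longleftrightarrow> (\<exists>y. length y \<le> e Gu \<and> enc_pair x y \<in> V)"
  unfolding satisfiable_table using table_exists table_witness by blast

lemma in_REG_RES_SIZE_iff:
  assumes "6 * cell_bound M * e No \<le> e Ka"
  shows "enc_instance (formula (clauses M) (skeleton e x)) (int (nat_of_bits (replicate (e Ka) True))) \<in> REG_RES_SIZE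
    \<longleftrightarrow> \<not> (\<exists>y. length y \<le> e Gu \<and> enc_pair x y \<in> V)"
proof -
  let ?I = "{..<length (skeleton e x) + length (filter is_first (skeleton e x)) + 4} \<times> {..<cell_bound M}"
  let ?V = "(\<lambda>(i, s). var i s) ` ?I"
  have fin: "finite ?V" by simp
  have "card ?V \<le> card ?I" by (rule card_image_le) simp
  also have "\<dots> = (2 * R + e No + 4) * cell_bound M"
    unfolding card_cartesian_product card_lessThan by (simp add: first_skeleton length_skeleton R)
  \<comment> \<open>With 3 \<le> R \<le> e No, the left factor is at most 3 * e No + 4, which is
    below 6 * e No.\<close>
  also have "\<dots> < 6 * e No * cell_bound M"
  proof (rule mult_strict_right_mono)
    have "1 * R \<le> e Bl * R" using H by (intro mult_le_mono1) simp
    then have "R \<le> e No" using N by linarith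
    moreover have "3 \<le> R" using R H by simp
    ultimately show "2 * R + e No + 4 < 6 * e No" by linarith
    show "0 < cell_bound M" using S_ge by (simp add: cell_bound_def)
  qed
  also have "\<dots> \<le> e Ka" using assms by (simp add: mult.commute mult.left_commute)
  finally have "card ?V < e Ka" .
  from enc_instance_in_REG_RES_SIZE[OF fin _ this, of "formula (clauses M) (skeleton e x)"]
  show ?thesis using fst_formula_vars[OF wf] satisfiable_iff by blast
qed

end

section \<open>Choice of the polynomials\<close>

theorem theorem8:
  shows "coNP_hard REG_RES_SIZE"
  unfolding coNP_hard_def
proof (intro allI impI)
  fix L' assume "in_coNP L'"
  then obtain V c d where "in_P V"
    and NP: "\<And>x. x \<in> - L' \<longleftrightarrow> (\<exists>y. length y \<le> c * (length x + 1) ^ d \<and> enc_pair x y \<in> V)"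
    unfolding in_coNP_def in_NP_def by blast
  then obtain M c' d' where wf: "wf_tm M" and M: "\<And>z. \<exists>n. n \<le> c' * (length z + 1) ^ d' \<and>
      fst ((tm_step M ^^ n) (tm_init z)) = 1 \<and> tm_output ((tm_step M ^^ n) (tm_init z)) = [z \<in> V]"
    unfolding in_P_def poly_time_computable_def by blast
  \<comment> \<open>With m = length x + 1, a pair of x and a certificate has length below (c + 2) *
    m^(d+1), so the verifier takes at most T = c' * (c + 2)^d' * m^D steps. The added 3 in
    \<open>CB\<close> pays for the margin T + 3.\<close>
  define D where "D = (d + 1) * d'"
  define CB where "CB = c' * (c + 2) ^ d' + 3"
  \<comment> \<open>R is at most (2 * CB + 2 + c) * m^(D + d + 1); \<open>CN\<close> and its
    exponent come from multiplying this by the margin CB * m^D. The amount of \<open>Ka\<close> is 6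
    * \<open>cell_bound M\<close> times that, to exceed the number of variables.\<close>
  define CN where "CN = CB * (2 * CB + 2 + c)"
  define C where "C = (\<lambda>f. case f of Bl \<Rightarrow> CB | Gu \<Rightarrow> c | No \<Rightarrow> CN | Ka \<Rightarrow> 6 * cell_bound M * CN)"
  define deg where "deg = (\<lambda>f. case f of Bl \<Rightarrow> D | Gu \<Rightarrow> d | No \<Rightarrow> D + (D + d + 1) | Ka \<Rightarrow> D + (D + d + 1))"
  define f where "f = (\<lambda>x. enc_instance (formula (clauses M) (skeleton (amount C deg (length x)) x))
       (int (nat_of_bits (replicate (amount C deg (length x) Ka) True))))"
  have "cell_bound M > 0" using wf by (auto simp: wf_tm_def cell_bound_def split: prod.splits)
  then have "C Ka > 0" by (simp add: C_def CN_def CB_def)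
  then have poly: "poly_time_computable f" unfolding f_def by (rule poly_time_formula)
  have "x \<in> L' \<longleftrightarrow> f x \<in> REG_RES_SIZE" for x
  proof -
    define m where "m = length x + 1"
    have m: "1 \<le> m" "Suc (length x) = m" by (simp_all add: m_def)
    let ?e = "amount C deg (length x)"
    define T where "T = (CB - 3) * m ^ D"
    define R where "R = 2 * ?e Bl + (2 * length x + 1) + ?e Gu"
    have e: "?e Bl = CB * m ^ D" "?e Gu = c * m ^ d" "?e No = CN * m ^ (D + (D + d + 1))"
      "?e Ka = 6 * cell_bound M * CN * m ^ (D + (D + d + 1))"
      by (simp_all add: amount_def C_def deg_def m)
    have pow: "m ^ i \<le> m ^ j" if "i \<le> j" for i j using that m(1) by (rule power_increasing)
    interpret reduction M x ?e T R V
    proof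
      show "wf_tm M" by (rule wf)
      show "R = 2 * ?e Bl + (2 * length x + 1) + ?e Gu" by (rule R_def)
      have "CB * m ^ D = T + 3 * m ^ D" by (simp add: T_def CB_def distrib_right)
      then show "T + 3 \<le> ?e Bl" using e(1) pow[of 0 D] by simp
      show "\<exists>n\<le>T. fst (conf M (enc_pair x y) n) = 1 \<and> tm_output (conf M (enc_pair x y) n) = [enc_pair x y \<in> V]"
        if y: "length y \<le> ?e Gu" for y
      proof -
        have "length (enc_pair x y) = 2 * length x + 1 + length y"
          unfolding enc_pair_def by (induction x) auto
        then have "length (enc_pair x y) + 1 \<le> 2 * m + c * m ^ d" using y e(2) by (simp add: m_def)
        also have "\<dots> \<le> 2 * m ^ (d + 1) + c * m ^ (d + 1)"
          using pow[of 1 "d + 1"] pow[of d "d + 1"] by (intro add_mono mult_le_mono2) simp_all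
        also have "\<dots> = (c + 2) * m ^ (d + 1)" by (simp add: algebra_simps)
        finally have "c' * (length (enc_pair x y) + 1) ^ d' \<le> c' * ((c + 2) * m ^ (d + 1)) ^ d'"
          by (intro mult_le_mono2 power_mono) auto
        also have "\<dots> = T" by (simp only: T_def CB_def D_def power_mult_distrib power_mult mult.assoc add_diff_cancel_right')
        finally show ?thesis using M[of "enc_pair x y"] unfolding conf_def by (meson order_trans)
      qed
      have "R \<le> 2 * (CB * m ^ (D + d + 1)) + 2 * m ^ (D + d + 1) + c * m ^ (D + d + 1)"
        unfolding R_def e using pow[of 1 "D + d + 1"] pow[of d "D + d + 1"] pow[of D "D + d + 1"]
        by (intro add_mono mult_le_mono2) (simp_all add: m_def)
      also have "\<dots> = (2 * CB + 2 + c) * m ^ (D + d + 1)" by (simp add: algebra_simps)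
      finally have "?e Bl * R \<le> (CB * m ^ D) * ((2 * CB + 2 + c) * m ^ (D + d + 1))"
        unfolding e(1) by (rule mult_le_mono2)
      also have "\<dots> = ?e No" unfolding e(3) CN_def power_add[of m D "D + d + 1"] by (simp only: mult.assoc mult.left_commute)
      finally show "?e Bl * R \<le> ?e No" .
    qed
    have "6 * cell_bound M * ?e No \<le> ?e Ka" unfolding e by (simp add: mult.assoc)
    from in_REG_RES_SIZE_iff[OF this] show ?thesis
      using NP[of x] unfolding f_def e(2) m_def by auto
  qed
  with poly show "\<exists>f. poly_time_computable f \<and> (\<forall>x. x \<in> L' \<longleftrightarrow> f x \<in> REG_RES_SIZE)" by blast
qed

end
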